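(* Let $\alpha>0$. A discrete set $\Gamma\subset\mathbb{C}$ is a set of sampling for $F_\alpha^2$ if and only if $\Gamma$ can be expressed as a finite union of uniformly discrete sets and $\Gamma$ contains a uniformly discrete subset $\Gamma'$ for which $D^-(\Gamma')>\alpha/\pi$.
   Context: For $\alpha>0$ let $d\mu_\alpha(z)=(\alpha/\pi)e^{-\alpha|z|^2}\,dx\,dy$, $z=x+iy$. The Bargmann-Fock space $F_\alpha^2$ is the Hilbert space of entire functions $f$ with $\|f\|_2^2=\int_{\mathbb{C}}|f(z)|^2\,d\mu_\alpha(z)<\infty$. A discrete set $\Gamma\subset\mathbb{C}$ is a set of sampling for $F_\alpha^2$ if there exist positive numbers $A$ and $B$ such that $A\|f\|_2^2\le\sum_{z\in\Gamma}e^{-\alpha|z|^2}|f(z)|^2\le B\|f\|_2^2$ for all $f\in F_\alpha^2$. A set $\Gamma=\{z_j\}\subset\mathbb{C}$ (distinct points) is uniformly discrete if $q=\inf_{j\ne k}|z_j-z_k|>0$. Lower uniform density: fix a compact set $I\subset\mathbb{C}$ of (Lebesgue) measure $1$ whose boundary has measure $0$. For a uniformly discrete set $\Gamma$ and $r>0$, let $n^-(r)$ be the smallest number of points of $\Gamma$ to be found in a translate of $rI$. Then $D^-(\Gamma)=\liminf_{r\to\infty} n^-(r)/r^2$. (This value is independent of the choice of $I$, by a result of Landau.) *)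

theory Defs
  imports "HOL-Analysis.Analysis"
begin

definition gauss_measure :: "real \<Rightarrow> complex measure" where
  "gauss_measure \<alpha> = density lborel (\<lambda>z. ennreal (\<alpha> / pi * exp (- \<alpha> * (cmod z)\<^sup>2)))"

definition fock_space :: "real \<Rightarrow> (complex \<Rightarrow> complex) set" where
  "fock_space \<alpha> = {f. f holomorphic_on UNIV \<and> integrable (gauss_measure \<alpha>) (\<lambda>z. (cmod (f z))\<^sup>2)}"

definition fock_norm :: "real \<Rightarrow> (complex \<Rightarrow> complex) \<Rightarrow> real" where
  "fock_norm \<alpha> f = sqrt (LINT z|gauss_measure \<alpha>. (cmod (f z))\<^sup>2)"

text \<open>
  Summability is demanded explicitly because \<^const>\<open>infsum\<close> is 0 on families that are not
  summable; for the nonnegative terms below it says exactly that the sum is finite.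
\<close>

definition sampling_set :: "real \<Rightarrow> complex set \<Rightarrow> bool" where
  "sampling_set \<alpha> \<Gamma> \<longleftrightarrow>
    (\<exists>A>0. \<exists>B>0. \<forall>f\<in>fock_space \<alpha>.
      (\<lambda>z. exp (- \<alpha> * (cmod z)\<^sup>2) * (cmod (f z))\<^sup>2) summable_on \<Gamma> \<and>
      A * (fock_norm \<alpha> f)\<^sup>2 \<le> (\<Sum>\<^sub>\<infinity>z\<in>\<Gamma>. exp (- \<alpha> * (cmod z)\<^sup>2) * (cmod (f z))\<^sup>2) \<and>
      (\<Sum>\<^sub>\<infinity>z\<in>\<Gamma>. exp (- \<alpha> * (cmod z)\<^sup>2) * (cmod (f z))\<^sup>2) \<le> B * (fock_norm \<alpha> f)\<^sup>2)"

text \<open>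
  The library's \<^const>\<open>uniform_discrete\<close> is positivity of the separation constant, with the
  infimum taken in \<^typ>\<open>ereal\<close> so that sets with at most one point have separation \<open>\<infinity>\<close>.
\<close>

lemma uniform_discrete_iff_separation:
  fixes \<Gamma> :: "complex set"
  shows "uniform_discrete \<Gamma> \<longleftrightarrow>
    0 < (INF (z, w) \<in> {(z, w). z \<in> \<Gamma> \<and> w \<in> \<Gamma> \<and> z \<noteq> w}. ereal (cmod (z - w)))"
    (is "_ \<longleftrightarrow> 0 < ?q")
proof
  assume "uniform_discrete \<Gamma>"
  then obtain e where e: "e > 0" "\<And>z w. z \<in> \<Gamma> \<Longrightarrow> w \<in> \<Gamma> \<Longrightarrow> dist z w < e \<Longrightarrow> z = w"
    unfolding uniform_discrete_def by blast
  have "ereal e \<le> ?q"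
  proof (rule INF_greatest, clarify)
    fix z w assume zw: "z \<in> \<Gamma>" "w \<in> \<Gamma>" "z \<noteq> w"
    have "\<not> dist z w < e"
      using zw e(2) by blast
    then show "ereal e \<le> ereal (cmod (z - w))"
      by (simp add: dist_norm)
  qed
  moreover have "0 < ereal e"
    using e(1) by simp
  ultimately show "0 < ?q"
    by (rule less_le_trans[rotated])
next
  assume "0 < ?q"
  then obtain e where e: "0 < ereal e" "ereal e < ?q"
    using ereal_dense2 by blast
  show "uniform_discrete \<Gamma>"
  proof (rule uniformI2)
    show "e > 0" using e(1) by simp
    fix z w assume zw: "z \<in> \<Gamma>" "w \<in> \<Gamma>" "z \<noteq> w"
    have "?q \<le> ereal (cmod (z - w))"
      by (rule INF_lower2[of "(z, w)"]) (use zw in simp_all)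
    with e(2) have "ereal e < ereal (cmod (z - w))"
      by (rule less_le_trans)
    then show "e \<le> dist z w"
      by (simp add: dist_norm)
  qed
qed

text \<open>
  For uniformly discrete \<open>\<Gamma>\<close> and compact \<open>I\<close> the intersections below are finite, so \<^const>\<open>card\<close>
  is the true number of points, and the infimum of natural numbers is attained.
\<close>

definition lower_count :: "complex set \<Rightarrow> complex set \<Rightarrow> real \<Rightarrow> nat" where
  "lower_count I \<Gamma> r = (INF a. card (\<Gamma> \<inter> (\<lambda>w. a + r *\<^sub>R w) ` I))"

definition lower_density :: "complex set \<Rightarrow> complex set \<Rightarrow> ereal" where
  "lower_density I \<Gamma> = Liminf at_top (\<lambda>r. ereal (real (lower_count I \<Gamma> r) / r\<^sup>2))"

end

theory Submission
  imports Defs "HOL-Complex_Analysis.Complex_Analysis" "HOL-Probability.Distributions"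
begin

text \<open>
  Every entire function \<open>f\<close> is measured by its weighted modulus \<open>u(z) = \<bar>f(z)\<bar> exp(-\<alpha>\<bar>z\<bar>\<^sup>2/2)\<close>; the Fock norm is
  the \<open>L\<^sup>2\<close> norm of \<open>u\<close> up to a constant. Multiplying \<open>f\<close> by the exponential of a linear function multiplies
  the modulus by a factor that recentres the weight, so that translations, dilations and changes of the
  exponent \<open>\<alpha>\<close> turn weighted moduli into weighted moduli times Gaussians (\<open>recenter\<close>). Everything below is
  built on this and on the sub-mean value property of \<open>\<bar>f\<bar>\<^sup>2\<close>, which controls the local
  variation of \<open>u\<close> by its local \<open>L\<^sup>2\<close> mass.
  Between square sampling and density stands sampling for the supremum norm: \<open>sup u \<le> K sup\<^bsub>\<Gamma>\<^esub> u\<close> for all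
  bounded \<open>u\<close> (\<open>sup_sampling\<close>). Square sampling at \<open>\<alpha>\<close> gives supremum sampling at some exponent strictly
  above \<open>\<alpha>\<close>, and supremum sampling at any exponent above \<open>\<alpha>\<close> gives square sampling at \<open>\<alpha>\<close>; this is where the
  strict inequality for the density comes from.

  \<^bold>\<open>Sampling implies density.\<close> Testing the upper inequality on reproducing kernels bounds the number of points
  in any disc of given radius, and such a set splits into finitely many separated ones. For the lower
  inequality, let \<open>u\<close> be bounded at an exponent \<open>\<beta>\<close> slightly above \<open>\<alpha>\<close>. A slight contraction of \<open>f\<close> towards a
  point \<open>a\<close> gives a function of the Fock space at \<open>\<alpha>\<close>: its weighted modulus at \<open>z\<close> is that of \<open>f\<close> at the contracted
  point times a wide Gaussian around \<open>a\<close>. Square sampling for it would bound \<open>u(a)\<close> by the values of \<open>u\<close> at \<open>\<Gamma>\<close>,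
  had the contraction not moved the points of \<open>\<Gamma>\<close>. On the scale of the Gaussian the displacement is so
  small that the error is a small multiple of an integral of the same kind as the left-hand side, and it is
  absorbed (\<open>sampling_imp_sup_sampling\<close>). In the supremum norm, \<open>\<Gamma>\<close> may be thinned out to a separated set. If a disc of
  radius \<open>R\<close> contained only \<open>N < b R\<^sup>2\<close> of its points for some \<open>b < \<beta>\<close> and large \<open>R\<close>, then the polynomial of degree \<open>N\<close>
  with these zeros, weighted around the centre of the disc, would be much smaller outside the disc than its
  maximum (\<open>sup_sampling_count\<close>). Hence every large disc contains more than \<open>\<alpha> R\<^sup>2\<close> points, with room to spare.

  \<^bold>\<open>Density implies sampling.\<close> If every large disc of radius \<open>R\<close> contains at least about \<open>D R\<^sup>2\<close> points of a separated
  set and \<open>\<beta> < D\<close>, then a function growing like \<open>exp(\<beta>\<bar>z\<bar>\<^sup>2/2)\<close> has too many zeros for Jensen's formula if it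
  vanishes on the set, and a quantitative form of this with approximate zeros gives the supremum
  inequality (\<open>disc_counts_imp_sup_sampling\<close>). Applied to \<open>f\<close> times a Gaussian centred at \<open>z\<close>, that inequality
  bounds \<open>u(z)\<^sup>2\<close> at a smaller exponent by a sum of \<open>u(\<gamma>)\<^sup>2\<close> against Gaussian weights; integration in \<open>z\<close> gives square
  sampling (\<open>sup_sampling_imp_sampling\<close>).

  The test set \<open>I\<close> is exchanged for discs by averaging the number of points over translates
  (\<open>count_averaging\<close>).
\<close>

section \<open>Lebesgue measure on the complex plane\<close>

lemma complex_Basis: "(Basis :: complex set) = {1, \<i>}"
  by (simp add: Basis_complex_def)

lemma measurable_Complex_pair [measurable]:
  "(\<lambda>(x, y). Complex x y) \<in> borel_measurable (lborel \<Otimes>\<^sub>M lborel)"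
proof -
  have "(\<lambda>(x, y). Complex x y) \<in> borel_measurable borel"
    unfolding Complex_eq case_prod_beta
    by (intro borel_measurable_continuous_onI continuous_intros)
  then show ?thesis by (simp add: lborel_prod)
qed

text \<open>
  Fubini's theorem in the coordinates \<open>x + \<i>y\<close> rests on this: both measures give every box the product of
  its sides.
\<close>

lemma lborel_complex_pair:
  "(lborel :: complex measure) = distr (lborel \<Otimes>\<^sub>M lborel) borel (\<lambda>(x, y). Complex x y)"
proof (rule lborel_eqI)
  fix l u :: complex
  assume lu: "\<And>b. b \<in> Basis \<Longrightarrow> l \<bullet> b \<le> u \<bullet> b"
  have le: "Re l \<le> Re u" "Im l \<le> Im u"
    using lu[of 1] lu[of \<i>] by (auto simp: complex_Basis)
  have "(\<lambda>(x, y). Complex x y) -` box l u = {Re l<..<Re u} \<times> {Im l<..<Im u}"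
    by (auto simp: box_def complex_Basis)
  then have "emeasure (distr (lborel \<Otimes>\<^sub>M lborel) borel (\<lambda>(x, y). Complex x y)) (box l u)
      = emeasure (lborel \<Otimes>\<^sub>M lborel) ({Re l<..<Re u} \<times> {Im l<..<Im u})"
    by (subst emeasure_distr) (auto simp: space_pair_measure)
  also have "\<dots> = ennreal (Re u - Re l) * ennreal (Im u - Im l)"
    using le by (subst lborel.emeasure_pair_measure_Times) auto
  also have "\<dots> = (\<Prod>b\<in>Basis. (u - l) \<bullet> b)"
    using le by (simp add: complex_Basis ennreal_mult)
  finally show "emeasure (distr (lborel \<Otimes>\<^sub>M lborel) borel (\<lambda>(x, y). Complex x y)) (box l u)
      = (\<Prod>b\<in>Basis. (u - l) \<bullet> b)" .
qed simp

lemma measurable_Complex [measurable (raw)]: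
  assumes [measurable]: "f \<in> borel_measurable M" "g \<in> borel_measurable M"
  shows "(\<lambda>x. Complex (f x) (g x)) \<in> borel_measurable M"
  unfolding Complex_eq by measurable

lemma
  assumes [measurable]: "(f :: complex \<Rightarrow> ennreal) \<in> borel_measurable borel"
  shows nn_integral_complex: "(\<integral>\<^sup>+z. f z \<partial>lborel) = (\<integral>\<^sup>+x. \<integral>\<^sup>+y. f (Complex x y) \<partial>lborel \<partial>lborel)"
    and nn_integral_complex_swap: "(\<integral>\<^sup>+z. f z \<partial>lborel) = (\<integral>\<^sup>+y. \<integral>\<^sup>+x. f (Complex x y) \<partial>lborel \<partial>lborel)"
proof -
  have "(\<integral>\<^sup>+z. f z \<partial>lborel) = (\<integral>\<^sup>+z. f (Complex (fst z) (snd z)) \<partial>(lborel \<Otimes>\<^sub>M lborel))"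
    by (subst lborel_complex_pair, subst nn_integral_distr) (auto simp: case_prod_beta)
  also have "\<dots> = (\<integral>\<^sup>+x. \<integral>\<^sup>+y. f (Complex x y) \<partial>lborel \<partial>lborel)"
    by (subst lborel.nn_integral_fst[symmetric]) auto
  finally show 1: "(\<integral>\<^sup>+z. f z \<partial>lborel) = (\<integral>\<^sup>+x. \<integral>\<^sup>+y. f (Complex x y) \<partial>lborel \<partial>lborel)" .
  also have "\<dots> = (\<integral>\<^sup>+y. \<integral>\<^sup>+x. f (Complex x y) \<partial>lborel \<partial>lborel)"
    by (subst lborel_pair.Fubini') (auto simp: case_prod_beta)
  finally show "(\<integral>\<^sup>+z. f z \<partial>lborel) = (\<integral>\<^sup>+y. \<integral>\<^sup>+x. f (Complex x y) \<partial>lborel \<partial>lborel)" .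
qed

lemma nn_integral_translate_real:
  assumes [measurable]: "(f :: real \<Rightarrow> ennreal) \<in> borel_measurable borel"
  shows "(\<integral>\<^sup>+x. f (x + t) \<partial>lborel) = (\<integral>\<^sup>+x. f x \<partial>lborel)"
  using nn_integral_real_affine[of f 1 t] by (simp add: add.commute)

lemma nn_integral_shear_Re:
  assumes [measurable]: "(f :: complex \<Rightarrow> ennreal) \<in> borel_measurable borel"
  shows "(\<integral>\<^sup>+z. f (Complex (Re z + k * Im z) (Im z)) \<partial>lborel) = (\<integral>\<^sup>+z. f z \<partial>lborel)"
  by (simp add: nn_integral_complex_swap nn_integral_translate_real[of "\<lambda>x. f (Complex x _)"])

lemma nn_integral_shear_Im:
  assumes [measurable]: "(f :: complex \<Rightarrow> ennreal) \<in> borel_measurable borel"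
  shows "(\<integral>\<^sup>+z. f (Complex (Re z) (Im z + k * Re z)) \<partial>lborel) = (\<integral>\<^sup>+z. f z \<partial>lborel)"
  by (simp add: nn_integral_complex nn_integral_translate_real[of "\<lambda>y. f (Complex _ y)"])

text \<open>
  A rotation is a product of three shears, and a shear preserves the measure because it translates each
  horizontal (or vertical) line.
\<close>

lemma nn_integral_rotate:
  assumes f [measurable]: "(f :: complex \<Rightarrow> ennreal) \<in> borel_measurable borel" and c: "cmod c = 1"
  shows "(\<integral>\<^sup>+z. f (c * z) \<partial>lborel) = (\<integral>\<^sup>+z. f z \<partial>lborel)"
proof -
  have generic: "(\<integral>\<^sup>+z. g (c * z) \<partial>lborel) = (\<integral>\<^sup>+z. g z \<partial>lborel)"
    if [measurable]: "(g :: complex \<Rightarrow> ennreal) \<in> borel_measurable borel" 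
      and c: "cmod c = 1" "Re c \<noteq> -1" for g c
  proof -
    \<comment> \<open>the tangent of half the angle; it is infinite for the half turn \<open>c = -1\<close>, which is
      treated at the end as two quarter turns\<close>
    define T where "T = Im c / (1 + Re c)"
    have c1: "(Re c)\<^sup>2 + (Im c)\<^sup>2 = 1"
      using c(1) by (simp add: cmod_def)
    have T1: "T * (1 + Re c) = Im c"
      using c(2) by (simp add: T_def)
    have T2: "T * Im c = 1 - Re c"
    proof -
      have "T * Im c * (1 + Re c) = (T * (1 + Re c)) * Im c" by (simp only: mult_ac)
      also have "\<dots> = (1 - Re c) * (1 + Re c)"
        unfolding T1 using c1 by (simp add: algebra_simps power2_eq_square)
      finally have "T * Im c * (1 + Re c) = (1 - Re c) * (1 + Re c)" .
      then show ?thesis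
        using c(2) by (metis add.commute add_eq_0_iff mult_right_cancel)
    qed
    define h where "h = (\<lambda>z. g (Complex (Re z + (-T) * Im z) (Im z)))"
    define k where "k = (\<lambda>z. h (Complex (Re z) (Im z + Im c * Re z)))"
    have [measurable]: "h \<in> borel_measurable borel" "k \<in> borel_measurable borel"
      unfolding h_def k_def by measurable
    have "g (c * z) = k (Complex (Re z + (-T) * Im z) (Im z))" for z
    proof -
      have 1: "Im z + Im c * (Re z + - T * Im z) = Im c * Re z + Re c * Im z"
        using T2 by algebra
      have 2: "Re z + - T * Im z + - T * (Im c * Re z + Re c * Im z) = Re c * Re z - Im c * Im z"
      proof -
        have "Re z + - T * Im z + - T * (Im c * Re z + Re c * Im z) = Re z * (1 - T * Im c) - Im z * (T * (1 + Re c))"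
          by (simp add: algebra_simps)
        then show ?thesis by (simp add: T1 T2 mult.commute)
      qed
      have "c * z = Complex (Re z + - T * Im z + - T * (Im z + Im c * (Re z + - T * Im z))) (Im z + Im c * (Re z + - T * Im z))"
        unfolding 1 2 by (auto simp: complex_eq_iff)
      then show ?thesis
        by (simp only: k_def h_def complex.sel)
    qed
    then have "(\<integral>\<^sup>+z. g (c * z) \<partial>lborel) = (\<integral>\<^sup>+z. k (Complex (Re z + (-T) * Im z) (Im z)) \<partial>lborel)"
      by simp
    also have "\<dots> = (\<integral>\<^sup>+z. k z \<partial>lborel)" by (rule nn_integral_shear_Re) measurable
    also have "\<dots> = (\<integral>\<^sup>+z. h z \<partial>lborel)" unfolding k_def by (rule nn_integral_shear_Im) measurable
    also have "\<dots> = (\<integral>\<^sup>+z. g z \<partial>lborel)" unfolding h_def by (rule nn_integral_shear_Re) measurable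
    finally show ?thesis .
  qed
  show ?thesis
  proof (cases "Re c = -1")
    case False
    then show ?thesis using generic c f by blast
  next
    case True
    have "Im c = 0"
      using c True by (simp add: cmod_def)
    then have c': "c = \<i> * \<i>" using True by (simp add: complex_eq_iff)
    have "(\<integral>\<^sup>+z. f (c * z) \<partial>lborel) = (\<integral>\<^sup>+z. f (\<i> * (\<i> * z)) \<partial>lborel)"
      by (simp only: c' mult.assoc)
    also have "\<dots> = (\<integral>\<^sup>+z. f (\<i> * z) \<partial>lborel)"
      by (rule generic) auto
    also have "\<dots> = (\<integral>\<^sup>+z. f z \<partial>lborel)"
      by (rule generic) auto
    finally show ?thesis .
  qed
qed

lemma nn_integral_complex_affine:
  assumes [measurable]: "(f :: complex \<Rightarrow> ennreal) \<in> borel_measurable borel" and c: "c \<noteq> 0"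
  shows "(\<integral>\<^sup>+z. f z \<partial>lborel) = ennreal (c\<^sup>2) * (\<integral>\<^sup>+z. f (t + c *\<^sub>R z) \<partial>lborel)"
  by (subst lborel_affine[OF c, of t])
     (simp add: nn_integral_density nn_integral_distr nn_integral_cmult)

lemma emeasure_complex_cball: 
  assumes "r \<ge> 0" shows "emeasure lborel (cball (a::complex) r) = ennreal (pi * r\<^sup>2)"
  using emeasure_cball[OF assms, of a] by (simp add: unit_ball_vol_2)

lemma emeasure_affine_image:
  assumes [measurable]: "S \<in> sets borel" and r: "r > 0"
  shows "(\<lambda>w. b + r *\<^sub>R w) ` S \<in> sets (borel :: complex measure)"
    and "emeasure lborel ((\<lambda>w. b + r *\<^sub>R w) ` S) = ennreal (r\<^sup>2) * emeasure lborel (S :: complex set)"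
proof -
  have eq: "(\<lambda>w. b + r *\<^sub>R w) ` S = (\<lambda>z. (1/r) *\<^sub>R (z - b)) -` S \<inter> space borel"
  proof (intro equalityI subsetI)
    fix z assume "z \<in> (\<lambda>z. (1/r) *\<^sub>R (z - b)) -` S \<inter> space borel"
    moreover have "z = b + r *\<^sub>R ((1/r) *\<^sub>R (z - b))" using r by simp
    ultimately show "z \<in> (\<lambda>w. b + r *\<^sub>R w) ` S" by blast
  qed (use r in auto)
  show meas: "(\<lambda>w. b + r *\<^sub>R w) ` S \<in> sets (borel :: complex measure)"
    unfolding eq by measurable
  have "emeasure lborel ((\<lambda>w. b + r *\<^sub>R w) ` S) = (\<integral>\<^sup>+z. indicator ((\<lambda>w. b + r *\<^sub>R w) ` S) z \<partial>lborel)"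
    using meas by simp
  also have "\<dots> = ennreal (r\<^sup>2) * (\<integral>\<^sup>+z. indicator ((\<lambda>w. b + r *\<^sub>R w) ` S) (b + r *\<^sub>R z) \<partial>lborel)"
    using meas r by (intro nn_integral_complex_affine) auto
  also have "(\<integral>\<^sup>+z. indicator ((\<lambda>w. b + r *\<^sub>R w) ` S) (b + r *\<^sub>R z) \<partial>lborel) = (\<integral>\<^sup>+z. indicator S z \<partial>lborel)"
    using r by (intro nn_integral_cong) (auto simp: indicator_def)
  finally show "emeasure lborel ((\<lambda>w. b + r *\<^sub>R w) ` S) = ennreal (r\<^sup>2) * emeasure lborel (S :: complex set)"
    by simp
qed

lemma nn_integral_gauss_real:
  "(\<integral>\<^sup>+x. ennreal (exp (- x\<^sup>2)) \<partial>lborel) = ennreal (sqrt pi)"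
proof -
  have "has_bochner_integral lborel (\<lambda>x::real. exp (- x\<^sup>2)) (2 *\<^sub>R (sqrt pi / 2))"
    by (rule has_bochner_integral_even_function[OF gaussian_moment_0]) simp
  then show ?thesis
    by (simp add: has_bochner_integral_iff nn_integral_eq_integral)
qed

lemma nn_integral_gauss:
  fixes a :: complex
  assumes t: "t > 0"
  shows "(\<integral>\<^sup>+z. ennreal (exp (- t * (cmod (z - a))\<^sup>2)) \<partial>lborel) = ennreal (pi / t)"
proof -
  define s where "s = 1 / sqrt t"
  have s: "s \<noteq> 0" "s\<^sup>2 = 1 / t" "t * s\<^sup>2 = 1"
    using t by (auto simp: s_def power_divide)
  have "(\<integral>\<^sup>+z. ennreal (exp (- t * (cmod (z - a))\<^sup>2)) \<partial>lborel)
      = ennreal (s\<^sup>2) * (\<integral>\<^sup>+z. ennreal (exp (- t * (cmod (a + s *\<^sub>R z - a))\<^sup>2)) \<partial>lborel)"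
    by (rule nn_integral_complex_affine) (use s in auto)
  also have "(\<lambda>z. - t * (cmod (a + s *\<^sub>R z - a))\<^sup>2) = (\<lambda>z. - ((Re z)\<^sup>2 + (Im z)\<^sup>2))"
    using s by (auto simp: fun_eq_iff power_mult_distrib cmod_power2[symmetric] mult.assoc[symmetric])
  also have "(\<integral>\<^sup>+z. ennreal (exp (- ((Re z)\<^sup>2 + (Im z)\<^sup>2))) \<partial>lborel)
      = (\<integral>\<^sup>+x. \<integral>\<^sup>+y. ennreal (exp (- x\<^sup>2)) * ennreal (exp (- y\<^sup>2)) \<partial>lborel \<partial>lborel)"
    by (subst nn_integral_complex) (auto simp: exp_add[symmetric] ennreal_mult[symmetric])
  also have "\<dots> = ennreal (sqrt pi) * ennreal (sqrt pi)"
    by (simp add: nn_integral_cmult nn_integral_multc nn_integral_gauss_real)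
  also have "\<dots> = ennreal pi" by (simp add: ennreal_mult[symmetric])
  finally show ?thesis
    using t s by (simp add: ennreal_mult[symmetric])
qed

section \<open>Mean values of entire functions\<close>

lemma borel_measurable_entire:
  "f holomorphic_on UNIV \<Longrightarrow> f \<in> borel_measurable borel"
  by (intro borel_measurable_continuous_onI holomorphic_on_imp_continuous_on)

text \<open>
  This is Cauchy's formula at the centre of the unit circle for \<open>w \<mapsto> f (a + w h)\<close>. The vector \<open>h\<close> is an
  arbitrary complex number, not a radius, so that the inequality can next be averaged over \<open>h\<close> in a disc.
\<close>

lemma entire_norm_le_circle_mean:
  fixes f :: "complex \<Rightarrow> complex"
  assumes f: "f holomorphic_on UNIV"
  shows "ennreal (cmod (f a)) \<le> (\<integral>\<^sup>+t. ennreal (cmod (f (a + cis (2 * pi * t) * h))) * indicator {0..1} t \<partial>lborel)"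
proof -
  define g where "g = (\<lambda>w. f (a + w * h))"
  have g: "g holomorphic_on S" for S
    unfolding g_def by (intro holomorphic_on_compose_gen[OF _ f, unfolded o_def] holomorphic_intros) auto
  have "((\<lambda>u. g u / (u - 0)) has_contour_integral (2 * of_real pi * \<i> * g 0)) (circlepath 0 1)"
    by (rule Cauchy_integral_circlepath) (auto intro!: holomorphic_on_imp_continuous_on g)
  then have "((\<lambda>t. g (circlepath 0 1 t) / circlepath 0 1 t * (2 * pi * \<i> * exp (2 * of_real pi * \<i> * t)))
      has_integral (2 * of_real pi * \<i> * g 0)) {0..1}"
    unfolding has_contour_integral 
    by (rule has_integral_eq[rotated]) (simp add: vector_derivative_circlepath)
  then have 1: "((\<lambda>t. (2 * of_real pi * \<i>) * g (cis (2 * pi * t))) has_integral (2 * of_real pi * \<i>) * g 0) {0..1}"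
    by (rule has_integral_eq[rotated]) (simp add: circlepath cis_conv_exp mult_ac)
  have hi: "((\<lambda>t. g (cis (2 * pi * t))) has_integral g 0) {0..1}"
  proof -
    define c :: complex where "c = 2 * of_real pi * \<i>"
    have "c \<noteq> 0" by (simp add: c_def)
    then have c: "inverse c * (c * w) = w" for w
      by (simp add: mult.assoc[symmetric])
    show ?thesis
      using has_integral_mult_right[OF 1, of "inverse c"] unfolding c_def[symmetric] c .
  qed
  have contg: "continuous_on S g" for S using g by (rule holomorphic_on_imp_continuous_on)
  have cont: "continuous_on S (\<lambda>t. g (cis (2 * pi * t)))" for S :: "real set"
    by (rule continuous_on_compose2[OF contg[of UNIV]]) (auto simp: cis_conv_exp intro!: continuous_intros)
  have cont': "continuous_on {0..1} (\<lambda>t. cmod (g (cis (2 * pi * t))))"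
    by (intro continuous_intros cont)
  have "cmod (g 0) \<le> integral {0..1} (\<lambda>t. cmod (g (cis (2 * pi * t))))"
  proof -
    have "cmod (integral {0..1} (\<lambda>t. g (cis (2 * pi * t)))) \<le> integral {0..1} (\<lambda>t. cmod (g (cis (2 * pi * t))))"
      by (rule integral_norm_bound_integral) (auto intro: integrable_continuous_real cont cont')
    then show ?thesis using hi by (simp add: integral_unique)
  qed
  also have si: "set_integrable lborel {0..1} (\<lambda>t. cmod (g (cis (2 * pi * t))))"
    by (rule borel_integrable_atLeastAtMost'[OF cont'])
  have "integral {0..1} (\<lambda>t. cmod (g (cis (2 * pi * t)))) = (LINT t:{0..1}|lborel. cmod (g (cis (2 * pi * t))))"
    using si by (simp add: set_borel_integral_eq_integral)
  finally have "ennreal (cmod (g 0)) \<le> ennreal (LINT t:{0..1}|lborel. cmod (g (cis (2 * pi * t))))"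
    by (rule ennreal_leI)
  also have "\<dots> = (\<integral>\<^sup>+t. ennreal (indicator {0..1} t * cmod (g (cis (2 * pi * t)))) \<partial>lborel)"
    using si unfolding set_lebesgue_integral_def set_integrable_def
    by (subst nn_integral_eq_integral) auto
  also have "\<dots> = (\<integral>\<^sup>+t. ennreal (cmod (g (cis (2 * pi * t)))) * indicator {0..1} t \<partial>lborel)"
    by (intro nn_integral_cong) (auto simp: indicator_def)
  finally show ?thesis by (simp add: g_def)
qed

text \<open>
  Apply the circle inequality to \<open>f\<^sup>2\<close> and integrate over \<open>h\<close> in the disc: by rotation invariance every
  point of the circle contributes the same area integral.
\<close>

lemma entire_sub_mean_value:
  assumes f: "f holomorphic_on UNIV" and r: "r \<ge> 0"
  shows "ennreal (pi * r\<^sup>2) * ennreal ((cmod (f a))\<^sup>2)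
     \<le> (\<integral>\<^sup>+z. ennreal ((cmod (f z))\<^sup>2) * indicator (cball a r) z \<partial>lborel)"
proof -
  have [measurable]: "f \<in> borel_measurable borel"
    using f by (rule borel_measurable_entire)
  have [measurable]: "cis \<in> borel_measurable borel"
    by (intro borel_measurable_continuous_onI) (simp add: cis_conv_exp continuous_intros)
  have f2: "(\<lambda>z. (f z)\<^sup>2) holomorphic_on UNIV"
    using f by (intro holomorphic_intros)
  have [measurable]: "cball (0 :: complex) r \<in> sets borel" "cball a r \<in> sets borel" by simp_all
  define F where "F = (\<lambda>h. ennreal ((cmod (f (a + h)))\<^sup>2) * indicator (cball 0 r) h)"
  have [measurable]: "F \<in> borel_measurable borel" unfolding F_def by measurable
  have "ennreal (pi * r\<^sup>2) * ennreal ((cmod (f a))\<^sup>2)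
      = (\<integral>\<^sup>+h. ennreal ((cmod (f a))\<^sup>2) * indicator (cball 0 r) h \<partial>(lborel :: complex measure))"
    using r by (subst nn_integral_cmult_indicator) (auto simp: emeasure_complex_cball mult.commute)
  also have "\<dots> \<le> (\<integral>\<^sup>+h. (\<integral>\<^sup>+t. F (cis (2 * pi * t) * h) * indicator {0..1} t \<partial>lborel) \<partial>lborel)"
  proof (rule nn_integral_mono)
    fix h :: complex
    have "ennreal ((cmod (f a))\<^sup>2) * indicator (cball 0 r) h
      \<le> (\<integral>\<^sup>+t. ennreal (cmod ((f (a + cis (2 * pi * t) * h))\<^sup>2)) * indicator {0..1} t \<partial>lborel) * indicator (cball 0 r) h"
      using entire_norm_le_circle_mean[OF f2, of a h]
      by (intro mult_right_mono) (auto simp: norm_power)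
    also have "\<dots> = (\<integral>\<^sup>+t. F (cis (2 * pi * t) * h) * indicator {0..1} t \<partial>lborel)"
      by (subst nn_integral_multc[symmetric])
         (auto simp: F_def norm_power norm_mult mult_ac intro!: nn_integral_cong split: split_indicator)
    finally show "ennreal ((cmod (f a))\<^sup>2) * indicator (cball 0 r) h
      \<le> (\<integral>\<^sup>+t. F (cis (2 * pi * t) * h) * indicator {0..1} t \<partial>lborel)" .
  qed
  also have "\<dots> = (\<integral>\<^sup>+t. (\<integral>\<^sup>+h. F (cis (2 * pi * t) * h) * indicator {0..1} t \<partial>lborel) \<partial>lborel)"
    by (rule lborel_pair.Fubini'[symmetric]) (simp add: case_prod_beta)
  also have "\<dots> = (\<integral>\<^sup>+t. (\<integral>\<^sup>+h. F h \<partial>lborel) * indicator {0..1::real} t \<partial>lborel)"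
    by (intro nn_integral_cong) (simp add: nn_integral_multc nn_integral_rotate)
  also have "\<dots> = (\<integral>\<^sup>+h. F h \<partial>lborel)"
    by (simp add: nn_integral_cmult)
  also have "\<dots> = (\<integral>\<^sup>+z. ennreal ((cmod (f z))\<^sup>2) * indicator (cball a r) z \<partial>lborel)"
    by (subst (2) nn_integral_complex_affine[of _ 1 a]) 
       (auto simp: F_def dist_norm intro!: nn_integral_cong split: split_indicator)
  finally show ?thesis .
qed

section \<open>The weighted modulus of an entire function\<close>

text \<open>
  The square of the weighted modulus is the integrand of the Fock norm and the summand of the sampling sum.
\<close>

definition wmod :: "real \<Rightarrow> (complex \<Rightarrow> complex) \<Rightarrow> complex \<Rightarrow> real" where
  "wmod \<alpha> f z = cmod (f z) * exp (- (\<alpha> / 2) * (cmod z)\<^sup>2)"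

lemma wmod_nonneg [simp]: "wmod \<alpha> f z \<ge> 0"
  by (simp add: wmod_def)

lemma wmod_power2: "(wmod \<alpha> f z)\<^sup>2 = exp (- \<alpha> * (cmod z)\<^sup>2) * (cmod (f z))\<^sup>2"
  by (simp add: wmod_def power_mult_distrib power2_eq_square[of "exp _"] exp_add[symmetric])

lemma continuous_on_wmod:
  assumes "f holomorphic_on UNIV" shows "continuous_on S (wmod \<alpha> f)"
  unfolding wmod_def
  by (intro continuous_intros continuous_on_subset[OF holomorphic_on_imp_continuous_on[OF assms]]) auto

lemma borel_measurable_wmod [measurable]:
  "f holomorphic_on UNIV \<Longrightarrow> wmod \<alpha> f \<in> borel_measurable borel"
  by (intro borel_measurable_continuous_onI continuous_on_wmod)

text \<open>
  The weight \<open>exp(-\<alpha>\<bar>z\<bar>\<^sup>2/2)\<close> centred at the origin differs from the one centred at \<open>a\<close> by the modulus of the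
  exponential of an affine function of \<open>z\<close>, hence holomorphically. The cases in use are \<open>\<alpha> = 0\<close>, \<open>s = 1\<close> (local
  estimates), \<open>\<beta> = 0\<close>, \<open>s = 1\<close> (reproducing kernels and polynomials around \<open>a\<close>), \<open>s < 1\<close> (contractions) and
  \<open>\<beta> < \<alpha>\<close>, \<open>s = 1\<close> (localisation by a Gaussian).
\<close>

lemma recenter:
  assumes f: "f holomorphic_on UNIV"
  shows "\<exists>G. G holomorphic_on UNIV \<and>
    (\<forall>z. wmod \<alpha> G z = wmod \<beta> f (a + s *\<^sub>R (z - a)) * exp (- ((\<alpha> - s\<^sup>2 * \<beta>) / 2) * (cmod (z - a))\<^sup>2))"
proof -
  define G where "G = (\<lambda>z. f (a + of_real s * (z - a)) *
    exp (of_real (\<alpha> - \<beta> * s) * ((z - a) * cnj a) + of_real ((\<alpha> - \<beta>) / 2 * (cmod a)\<^sup>2)))"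
  have "G holomorphic_on UNIV"
    unfolding G_def
    by (intro holomorphic_intros holomorphic_on_compose_gen[OF _ f, unfolded o_def]) auto
  moreover have "wmod \<alpha> G z = wmod \<beta> f (a + s *\<^sub>R (z - a)) * exp (- ((\<alpha> - s\<^sup>2 * \<beta>) / 2) * (cmod (z - a))\<^sup>2)" for z
  proof -
    have "(\<alpha> - \<beta> * s) * Re ((z - a) * cnj a) + (\<alpha> - \<beta>) / 2 * (cmod a)\<^sup>2 + - (\<alpha> / 2) * (cmod z)\<^sup>2
      = - (\<beta> / 2) * (cmod (a + s *\<^sub>R (z - a)))\<^sup>2 + - ((\<alpha> - s\<^sup>2 * \<beta>) / 2) * (cmod (z - a))\<^sup>2"
      unfolding cmod_power2 by (simp add: field_simps power2_eq_square)
    then show ?thesis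
      by (simp add: wmod_def G_def norm_mult exp_add[symmetric] scaleR_conv_of_real mult.assoc)
  qed
  ultimately show ?thesis by blast
qed

lemma recenter_local:
  assumes f: "f holomorphic_on UNIV"
  obtains G where "G holomorphic_on UNIV"
    "\<And>z. cmod (G z) = wmod \<alpha> f z * exp (\<alpha> / 2 * (cmod (z - a))\<^sup>2)"
  using recenter[OF f, of 0 \<alpha> a 1] by (auto simp: wmod_def[of 0])

definition local_mass :: "real \<Rightarrow> (complex \<Rightarrow> complex) \<Rightarrow> complex \<Rightarrow> ennreal" where
  "local_mass \<alpha> f a = (\<integral>\<^sup>+z. ennreal ((wmod \<alpha> f z)\<^sup>2) * indicator (cball a 1) z \<partial>lborel)"

lemma integral_le_local_mass:
  assumes f: "f holomorphic_on UNIV" and \<alpha>: "\<alpha> \<ge> 0"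
    and G: "\<And>z. cmod (G z) = wmod \<alpha> f z * exp (\<alpha> / 2 * (cmod (z - a))\<^sup>2)"
    and r: "r \<le> 1 - cmod (w - a)"
  shows "(\<integral>\<^sup>+z. ennreal ((cmod (G z))\<^sup>2) * indicator (cball w r) z \<partial>lborel) \<le> ennreal (exp \<alpha>) * local_mass \<alpha> f a"
proof -
  have [measurable]: "wmod \<alpha> f \<in> borel_measurable borel" "cball a 1 \<in> sets borel"
    using f by auto
  have "(\<integral>\<^sup>+z. ennreal ((cmod (G z))\<^sup>2) * indicator (cball w r) z \<partial>lborel)
    \<le> (\<integral>\<^sup>+z. ennreal (exp \<alpha>) * (ennreal ((wmod \<alpha> f z)\<^sup>2) * indicator (cball a 1) z) \<partial>lborel)"
  proof (rule nn_integral_mono)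
    fix z
    show "ennreal ((cmod (G z))\<^sup>2) * indicator (cball w r) z \<le> 
      ennreal (exp \<alpha>) * (ennreal ((wmod \<alpha> f z)\<^sup>2) * indicator (cball a 1) z)"
    proof (cases "z \<in> cball w r")
      case True
      then have za: "cmod (z - a) \<le> 1"
        using r norm_triangle_ineq[of "z - w" "w - a"] by (simp add: dist_norm norm_minus_commute)
      have "(cmod (z - a))\<^sup>2 \<le> 1"
        using za by (simp add: power_le_one)
      then have "\<alpha> * (cmod (z - a))\<^sup>2 \<le> \<alpha>"
        using \<alpha> by (simp add: mult_left_le)
      then have "(cmod (G z))\<^sup>2 \<le> exp \<alpha> * (wmod \<alpha> f z)\<^sup>2"
        unfolding G power_mult_distrib power2_eq_square[of "exp _"] exp_add[symmetric]
        by (subst mult.commute) (simp add: mult_right_mono)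
      then show ?thesis
        using True za by (simp add: dist_norm norm_minus_commute ennreal_mult[symmetric])
    qed simp
  qed
  also have "\<dots> = ennreal (exp \<alpha>) * local_mass \<alpha> f a"
    unfolding local_mass_def by (rule nn_integral_cmult) measurable
  finally show "(\<integral>\<^sup>+z. ennreal ((cmod (G z))\<^sup>2) * indicator (cball w r) z \<partial>lborel) \<le> ennreal (exp \<alpha>) * local_mass \<alpha> f a" .
qed

lemma wmod_le_local_mass:
  assumes f: "f holomorphic_on UNIV" and \<alpha>: "\<alpha> \<ge> 0"
  shows "ennreal ((wmod \<alpha> f a)\<^sup>2) \<le> ennreal (exp \<alpha> / pi) * local_mass \<alpha> f a"
proof -
  obtain G where G: "G holomorphic_on UNIV"
    "\<And>z. cmod (G z) = wmod \<alpha> f z * exp (\<alpha> / 2 * (cmod (z - a))\<^sup>2)"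
    using recenter_local[OF f] by blast
  have "ennreal pi * ennreal ((wmod \<alpha> f a)\<^sup>2) \<le> ennreal (exp \<alpha>) * local_mass \<alpha> f a"
    using entire_sub_mean_value[OF G(1), of 1 a] integral_le_local_mass[OF f \<alpha> G(2), of 1 a]
    by (simp add: G(2))
  then have "ennreal (1 / pi) * (ennreal pi * ennreal ((wmod \<alpha> f a)\<^sup>2)) \<le> ennreal (1 / pi) * (ennreal (exp \<alpha>) * local_mass \<alpha> f a)"
    by (rule mult_left_mono) simp
  then show ?thesis
    by (simp add: mult.assoc[symmetric] ennreal_mult[symmetric])
qed

text \<open>
  Replacing one sample by another costs the square of the displacement times the local mass. For small
  displacements this is a derivative estimate; for large ones the sub-mean value property alone suffices.
  The inequality is needed for all displacements, because a dilation moves distant points far.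
\<close>

lemma wmod_variation:
  assumes f: "f holomorphic_on UNIV" and \<alpha>: "\<alpha> \<ge> 0"
  shows "ennreal ((wmod \<alpha> f p)\<^sup>2) \<le> ennreal (2 * exp \<alpha> * (wmod \<alpha> f g)\<^sup>2) 
    + ennreal (200 * exp \<alpha> * (cmod (p - g))\<^sup>2) * local_mass \<alpha> f p"
proof (cases "local_mass \<alpha> f p = top")
  case True
  show ?thesis
  proof (cases "p = g")
    case True
    have "(wmod \<alpha> f g)\<^sup>2 \<le> 2 * exp \<alpha> * (wmod \<alpha> f g)\<^sup>2"
    proof -
      have "1 \<le> 2 * exp \<alpha>"
        using \<alpha> one_le_exp_iff[of \<alpha>] by linarith
      then show ?thesis
        using mult_right_mono[of 1 "2 * exp \<alpha>" "(wmod \<alpha> f g)\<^sup>2"] by simp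
    qed
    with True show ?thesis by simp
  next
    case False
    then show ?thesis using True by (simp add: ennreal_mult_top)
  qed
next
  case False
  then obtain V where V: "V \<ge> 0" "local_mass \<alpha> f p = ennreal V"
    by (metis ennreal_cases)
  obtain G where G: "G holomorphic_on UNIV"
    "\<And>z. cmod (G z) = wmod \<alpha> f z * exp (\<alpha> / 2 * (cmod (z - p))\<^sup>2)"
    using recenter_local[OF f] by blast
  have "(wmod \<alpha> f p)\<^sup>2 \<le> 2 * exp \<alpha> * (wmod \<alpha> f g)\<^sup>2 + 200 * exp \<alpha> * (cmod (p - g))\<^sup>2 * V"
  proof (cases "cmod (p - g) \<le> 1/2")
    case False
    have "ennreal ((wmod \<alpha> f p)\<^sup>2) \<le> ennreal (exp \<alpha> / pi * V)"
      using wmod_le_local_mass[OF f \<alpha>, of p] V by (simp add: ennreal_mult[symmetric])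
    then have "(wmod \<alpha> f p)\<^sup>2 \<le> exp \<alpha> / pi * V"
      using V by (subst (asm) ennreal_le_iff) auto
    also have "\<dots> \<le> exp \<alpha> * 1 * V"
      using V pi_gt3 by (intro mult_right_mono) (auto simp: field_simps)
    also have "\<dots> \<le> exp \<alpha> * (200 * (cmod (p - g))\<^sup>2) * V"
    proof -
      have "(1/2)\<^sup>2 \<le> (cmod (p - g))\<^sup>2"
        using False by (intro power_mono) auto
      then show ?thesis
        using V by (intro mult_right_mono mult_left_mono) (auto simp: power2_eq_square)
    qed
    also have "\<dots> \<le> 2 * exp \<alpha> * (wmod \<alpha> f g)\<^sup>2 + 200 * exp \<alpha> * (cmod (p - g))\<^sup>2 * V"
      by (simp add: mult_ac)
    finally show ?thesis .
  next
    case True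
    define Q where "Q = sqrt (16 / pi * exp \<alpha> * V)"
    have Q0: "Q \<ge> 0" and Q2: "Q\<^sup>2 = 16 / pi * exp \<alpha> * V"
      using V by (auto simp: Q_def)
    have sup: "cmod (G w) \<le> Q" if w: "cmod (w - p) \<le> 3/4" for w
    proof -
      have "ennreal (pi * (1/4)\<^sup>2) * ennreal ((cmod (G w))\<^sup>2) \<le> ennreal (exp \<alpha>) * ennreal V"
        using order_trans[OF entire_sub_mean_value[OF G(1), of "1/4" w] integral_le_local_mass[OF f \<alpha> G(2), of "1/4" w]] w V
        by (simp add: field_simps)
      then have "pi * (1/4)\<^sup>2 * (cmod (G w))\<^sup>2 \<le> exp \<alpha> * V"
        using V by (simp add: ennreal_mult[symmetric])
      then have "(cmod (G w))\<^sup>2 \<le> Q\<^sup>2"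
        unfolding Q2 using pi_gt_zero by (simp add: field_simps power2_eq_square)
      then show ?thesis using Q0 by (rule power2_le_imp_le)
    qed
    have der: "cmod (deriv G w) \<le> 4 * Q" if "w \<in> cball p (1/2)" for w
    proof -
      have "cmod ((deriv ^^ 1) G w) \<le> fact 1 * Q / (1/4) ^ 1"
      proof (rule Cauchy_inequality)
        show "G holomorphic_on ball w (1/4)" "continuous_on (cball w (1/4)) G"
          using G(1) holomorphic_on_subset holomorphic_on_imp_continuous_on by blast+
        fix x assume "cmod (w - x) = 1/4"
        then have "cmod (x - p) \<le> 3/4"
          using that norm_triangle_ineq[of "x - w" "w - p"] by (simp add: dist_norm norm_minus_commute)
        then show "cmod (G x) \<le> Q" by (rule sup)
      qed simp
      then show ?thesis by simp
    qed
    have "cmod (G p - G g) \<le> 4 * Q * cmod (p - g)"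
    proof (rule field_differentiable_bound)
      show "(G has_field_derivative deriv G z) (at z within cball p (1/2))" for z
        using G(1) by (meson DERIV_subset UNIV_I holomorphic_derivI open_UNIV subset_UNIV)
    qed (use True der in \<open>auto simp: dist_norm\<close>)
    then have "cmod (G p) \<le> cmod (G g) + 4 * Q * cmod (p - g)"
      using norm_triangle_ineq2[of "G p" "G g"] by linarith
    then have "(cmod (G p))\<^sup>2 \<le> (cmod (G g) + 4 * Q * cmod (p - g))\<^sup>2"
      by (intro power_mono) auto
    also have "\<dots> \<le> 2 * (cmod (G g))\<^sup>2 + 2 * (4 * Q * cmod (p - g))\<^sup>2"
      using sum_squares_bound[of "cmod (G g)" "4 * Q * cmod (p - g)"]
      by (simp add: power2_eq_square algebra_simps)
    also have "(4 * Q * cmod (p - g))\<^sup>2 = 256 / pi * exp \<alpha> * V * (cmod (p - g))\<^sup>2"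
      by (simp add: power_mult_distrib Q2)
    also have "(cmod (G g))\<^sup>2 \<le> exp \<alpha> * (wmod \<alpha> f g)\<^sup>2"
    proof -
      have "(cmod (g - p))\<^sup>2 \<le> 1"
        using True by (simp add: power_le_one norm_minus_commute)
      then have "\<alpha> * (cmod (g - p))\<^sup>2 \<le> \<alpha>"
        using \<alpha> by (simp add: mult_left_le)
      then show ?thesis
        unfolding G power_mult_distrib power2_eq_square[of "exp _"] exp_add[symmetric]
        by (subst mult.commute) (simp add: mult_right_mono)
    qed
    also have "2 * (256 / pi * exp \<alpha> * V * (cmod (p - g))\<^sup>2) \<le> 200 * exp \<alpha> * (cmod (p - g))\<^sup>2 * V"
    proof -
      have "512 / pi \<le> 200"
        using pi_gt3 by (simp add: field_simps)
      then have "(512 / pi) * (exp \<alpha> * V * (cmod (p - g))\<^sup>2) \<le> 200 * (exp \<alpha> * V * (cmod (p - g))\<^sup>2)"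
        using V by (intro mult_right_mono) auto
      then show ?thesis by (simp add: mult_ac)
    qed
    finally show ?thesis by (simp add: G(2))
  qed
  then have "ennreal ((wmod \<alpha> f p)\<^sup>2) \<le> ennreal (2 * exp \<alpha> * (wmod \<alpha> f g)\<^sup>2 + 200 * exp \<alpha> * (cmod (p - g))\<^sup>2 * V)"
    by (rule ennreal_leI)
  then show ?thesis
    using V by (simp add: ennreal_plus[symmetric] ennreal_mult[symmetric] del: ennreal_plus)
qed

lemma local_mass_le:
  assumes "f holomorphic_on UNIV" "\<And>z. wmod \<alpha> f z \<le> M"
  shows "local_mass \<alpha> f a \<le> ennreal (pi * M\<^sup>2)"
proof -
  have "M \<ge> 0" using assms(2)[of 0] wmod_nonneg[of \<alpha> f 0] by linarith
  have "local_mass \<alpha> f a \<le> (\<integral>\<^sup>+z. ennreal (M\<^sup>2) * indicator (cball a 1) z \<partial>lborel)"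
    unfolding local_mass_def by (intro nn_integral_mono mult_right_mono ennreal_leI power_mono assms) auto
  also have "\<dots> = ennreal (pi * M\<^sup>2)"
    by (subst nn_integral_cmult_indicator) (auto simp: emeasure_complex_cball ennreal_mult[symmetric] mult.commute)
  finally show ?thesis .
qed

lemma wmod_variation_bounded:
  assumes f: "f holomorphic_on UNIV" and \<alpha>: "\<alpha> \<ge> 0" and M: "\<And>z. wmod \<alpha> f z \<le> M"
  shows "(wmod \<alpha> f p)\<^sup>2 \<le> 2 * exp \<alpha> * (wmod \<alpha> f g)\<^sup>2 + 200 * pi * exp \<alpha> * (cmod (p - g))\<^sup>2 * M\<^sup>2"
proof -
  have "ennreal ((wmod \<alpha> f p)\<^sup>2) \<le> ennreal (2 * exp \<alpha> * (wmod \<alpha> f g)\<^sup>2) 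
    + ennreal (200 * exp \<alpha> * (cmod (p - g))\<^sup>2) * ennreal (pi * M\<^sup>2)"
    by (rule order_trans[OF wmod_variation[OF f \<alpha>, of p g]]) 
       (intro add_left_mono mult_left_mono local_mass_le[OF f M], auto)
  also have "\<dots> = ennreal (2 * exp \<alpha> * (wmod \<alpha> f g)\<^sup>2 + 200 * pi * exp \<alpha> * (cmod (p - g))\<^sup>2 * M\<^sup>2)"
    by (simp add: ennreal_plus[symmetric] ennreal_mult[symmetric] mult_ac del: ennreal_plus)
  finally show ?thesis by (subst (asm) ennreal_le_iff) auto
qed

section \<open>Uniformly locally finite sets\<close>

text \<open>
  This is what finite unions of uniformly discrete sets have in common, in a form that can be read off from
  the upper sampling inequality.
\<close>

definition uniformly_locally_finite :: "complex set \<Rightarrow> bool" where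
  "uniformly_locally_finite \<Gamma> \<longleftrightarrow> (\<forall>r. \<exists>m::nat. \<forall>a. finite (\<Gamma> \<inter> cball a r) \<and> card (\<Gamma> \<inter> cball a r) \<le> m)"

lemma uniformly_locally_finite_finite: "uniformly_locally_finite \<Gamma> \<Longrightarrow> finite (\<Gamma> \<inter> cball a r)"
  unfolding uniformly_locally_finite_def by meson

lemma uniformly_locally_finite_Un:
  assumes "uniformly_locally_finite A" "uniformly_locally_finite B"
  shows "uniformly_locally_finite (A \<union> B)"
  unfolding uniformly_locally_finite_def
proof
  fix r
  obtain m where m: "\<And>a. finite (A \<inter> cball a r)" "\<And>a. card (A \<inter> cball a r) \<le> m"
    using assms(1) unfolding uniformly_locally_finite_def by meson
  obtain n where n: "\<And>a. finite (B \<inter> cball a r)" "\<And>a. card (B \<inter> cball a r) \<le> n"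
    using assms(2) unfolding uniformly_locally_finite_def by meson
  have "finite ((A \<union> B) \<inter> cball a r) \<and> card ((A \<union> B) \<inter> cball a r) \<le> m + n" for a
    using m[of a] n[of a] card_Un_le[of "A \<inter> cball a r" "B \<inter> cball a r"]
    by (auto simp: Int_Un_distrib2)
  then show "\<exists>m. \<forall>a. finite ((A \<union> B) \<inter> cball a r) \<and> card ((A \<union> B) \<inter> cball a r) \<le> m"
    by blast
qed

lemma uniformly_locally_finite_Union:
  "finite \<G> \<Longrightarrow> (\<And>S. S \<in> \<G> \<Longrightarrow> uniformly_locally_finite S) \<Longrightarrow> uniformly_locally_finite (\<Union>\<G>)"
proof (induction \<G> rule: finite_induct)
  case empty
  show ?case by (auto simp: uniformly_locally_finite_def)
next
  case (insert S \<G>)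
  then show ?case by (simp add: uniformly_locally_finite_Un)
qed

lemma uniformly_locally_finite_countable:
  assumes "uniformly_locally_finite \<Gamma>" shows "countable \<Gamma>"
proof -
  have "\<Gamma> = (\<Union>n::nat. \<Gamma> \<inter> cball 0 n)"
    using real_arch_simple by (auto simp: dist_norm)
  moreover have "countable (\<Union>n::nat. \<Gamma> \<inter> cball 0 n)"
    using uniformly_locally_finite_finite[OF assms] by (intro countable_UN) (auto intro: countable_finite)
  ultimately show ?thesis by simp
qed

text \<open>
  Cover a disc at the origin by finitely many small discs; the same number, after translation, serves every
  other centre, and each small disc contains at most one point.
\<close>

lemma uniform_discrete_imp_uniformly_locally_finite:
  fixes \<Gamma> :: "complex set"
  assumes "uniform_discrete \<Gamma>" shows "uniformly_locally_finite \<Gamma>"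
  unfolding uniformly_locally_finite_def
proof
  fix r
  obtain e where e: "e > 0" "\<And>z w. z \<in> \<Gamma> \<Longrightarrow> w \<in> \<Gamma> \<Longrightarrow> dist z w < e \<Longrightarrow> z = w"
    using assms unfolding uniform_discrete_def by blast
  obtain T where T: "finite T" "cball 0 r \<subseteq> (\<Union>t\<in>T. ball (t::complex) (e/2))"
    using compact_cball[of "0::complex" r] e(1) unfolding compact_eq_totally_bounded by (meson half_gt_zero)
  have "finite (\<Gamma> \<inter> cball a r) \<and> card (\<Gamma> \<inter> cball a r) \<le> card T" for a
  proof -
    have "\<exists>t\<in>T. dist (x - a) t < e/2" if "x \<in> \<Gamma> \<inter> cball a r" for x
    proof -
      have "x - a \<in> cball 0 r" using that by (simp add: dist_norm norm_minus_commute)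
      then obtain t where "t \<in> T" "x - a \<in> ball t (e/2)" using T(2) by blast
      then show ?thesis by (auto simp: dist_commute)
    qed
    then obtain h where h: "\<And>x. x \<in> \<Gamma> \<inter> cball a r \<Longrightarrow> h x \<in> T \<and> dist (x - a) (h x) < e/2"
      by metis
    have "inj_on h (\<Gamma> \<inter> cball a r)"
    proof (rule inj_onI)
      fix x y assume xy: "x \<in> \<Gamma> \<inter> cball a r" "y \<in> \<Gamma> \<inter> cball a r" "h x = h y"
      have "dist (x - a) (y - a) < e"
        using dist_triangle_half_l[of "x - a" "h x" e "y - a"] h[OF xy(1)] h[OF xy(2)] xy(3) by simp
      then have "dist x y < e" by (simp add: dist_norm)
      then show "x = y" using e(2) xy by blast
    qed
    moreover have "h ` (\<Gamma> \<inter> cball a r) \<subseteq> T" using h by auto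
    ultimately show ?thesis
      using T(1) by (meson card_inj_on_le finite_imageD finite_subset)
  qed
  then show "\<exists>m. \<forall>a. finite (\<Gamma> \<inter> cball a r) \<and> card (\<Gamma> \<inter> cball a r) \<le> m" by blast
qed

lemma maximal_separated_subset:
  fixes \<Gamma> :: "complex set"
  assumes \<delta>: "\<delta> > 0"
  obtains S where "S \<subseteq> \<Gamma>" "\<And>x y. x \<in> S \<Longrightarrow> y \<in> S \<Longrightarrow> x \<noteq> y \<Longrightarrow> \<delta> \<le> dist x y"
    "\<And>x. x \<in> \<Gamma> \<Longrightarrow> \<exists>y\<in>S. dist x y < \<delta>"
proof -
  define \<A> where "\<A> = {S. S \<subseteq> \<Gamma> \<and> (\<forall>x\<in>S. \<forall>y\<in>S. x \<noteq> y \<longrightarrow> \<delta> \<le> dist x y)}"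
  have "\<exists>M\<in>\<A>. \<forall>X\<in>\<A>. M \<subseteq> X \<longrightarrow> X = M"
  proof (rule subset_Zorn')
    fix C assume C: "subset.chain \<A> C"
    then have "C \<subseteq> \<A>" and ch: "\<And>X Y. X \<in> C \<Longrightarrow> Y \<in> C \<Longrightarrow> X \<subseteq> Y \<or> Y \<subseteq> X"
      by (auto simp: subset.chain_def)
    have "\<delta> \<le> dist x y" if "x \<in> X" "X \<in> C" "y \<in> Y" "Y \<in> C" "x \<noteq> y" for x y X Y
      using ch[OF that(2,4)] \<open>C \<subseteq> \<A>\<close> that unfolding \<A>_def by blast
    then show "\<Union>C \<in> \<A>"
      using \<open>C \<subseteq> \<A>\<close> unfolding \<A>_def by blast
  qed
  then obtain S where S: "S \<in> \<A>" "\<And>X. X \<in> \<A> \<Longrightarrow> S \<subseteq> X \<Longrightarrow> X = S" by blast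
  have "\<exists>y\<in>S. dist x y < \<delta>" if x: "x \<in> \<Gamma>" for x
  proof (rule ccontr)
    assume *: "\<not> (\<exists>y\<in>S. dist x y < \<delta>)"
    then have "insert x S \<in> \<A>"
      using S(1) x unfolding \<A>_def by (auto simp: dist_commute not_less)
    then have "x \<in> S" using S(2)[of "insert x S"] by blast
    then show False using * \<delta> by auto
  qed
  then show ?thesis using S(1) that unfolding \<A>_def by blast
qed

text \<open>
  Removing a maximal separated subset removes a point from the neighbourhood of every remaining point, so
  the maximal local count drops.
\<close>

lemma bounded_count_imp_union_of_separated:
  fixes \<Gamma> :: "complex set"
  assumes "\<And>x. x \<in> \<Gamma> \<Longrightarrow> finite (\<Gamma> \<inter> ball x 1) \<and> card (\<Gamma> \<inter> ball x 1) \<le> m"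
  shows "\<exists>\<G>. finite \<G> \<and> (\<forall>S\<in>\<G>. uniform_discrete S) \<and> \<Gamma> = \<Union>\<G>"
  using assms
proof (induction m arbitrary: \<Gamma>)
  case 0
  have "\<Gamma> = {}"
  proof (rule ccontr)
    assume "\<Gamma> \<noteq> {}"
    then obtain x where "x \<in> \<Gamma>" by blast
    then have "\<Gamma> \<inter> ball x 1 = {}" using 0[of x] by (metis card_0_eq le_zero_eq)
    then show False using \<open>x \<in> \<Gamma>\<close> by auto
  qed
  then show ?case by (intro exI[of _ "{}"]) simp
next
  case (Suc m)
  obtain S where S: "S \<subseteq> \<Gamma>" "\<And>x y. x \<in> S \<Longrightarrow> y \<in> S \<Longrightarrow> x \<noteq> y \<Longrightarrow> 1 \<le> dist x y"
    "\<And>x. x \<in> \<Gamma> \<Longrightarrow> \<exists>y\<in>S. dist x y < 1"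
    using maximal_separated_subset[of 1 \<Gamma>] by auto
  have "finite ((\<Gamma> - S) \<inter> ball x 1) \<and> card ((\<Gamma> - S) \<inter> ball x 1) \<le> m" if x: "x \<in> \<Gamma> - S" for x
  proof -
    obtain y where y: "y \<in> S" "dist x y < 1" using S(3) x by blast
    have sub: "(\<Gamma> - S) \<inter> ball x 1 \<subset> \<Gamma> \<inter> ball x 1"
      using y S(1) by auto
    have fin: "finite (\<Gamma> \<inter> ball x 1)" "card (\<Gamma> \<inter> ball x 1) \<le> Suc m"
      using Suc.prems[of x] x by auto
    show ?thesis
      using psubset_card_mono[OF fin(1) sub] fin(2) finite_subset[OF psubset_imp_subset[OF sub] fin(1)] by linarith
  qed
  then obtain \<G> where \<G>: "finite \<G>" "\<forall>S\<in>\<G>. uniform_discrete S" "\<Gamma> - S = \<Union>\<G>"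
    using Suc.IH by meson
  have "uniform_discrete S" using S(2) by (intro uniformI2[of 1]) auto
  moreover have "\<Gamma> = \<Union>(insert S \<G>)" using \<G>(3) S(1) by auto
  ultimately show ?case using \<G> by (intro exI[of _ "insert S \<G>"]) auto
qed

lemma uniformly_locally_finite_imp_union_of_uniform_discrete:
  assumes "uniformly_locally_finite \<Gamma>"
  shows "\<exists>\<G>. finite \<G> \<and> (\<forall>S\<in>\<G>. uniform_discrete S) \<and> \<Gamma> = \<Union>\<G>"
proof -
  obtain m where m: "\<And>a. finite (\<Gamma> \<inter> cball a 1)" "\<And>a. card (\<Gamma> \<inter> cball a 1) \<le> m"
    using assms unfolding uniformly_locally_finite_def by meson
  have sub: "\<Gamma> \<inter> ball a 1 \<subseteq> \<Gamma> \<inter> cball a 1" for a by auto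
  have "finite (\<Gamma> \<inter> ball a 1) \<and> card (\<Gamma> \<inter> ball a 1) \<le> m" for a
    using finite_subset[OF sub m(1)] order_trans[OF card_mono[OF m(1) sub] m(2)] by blast
  then show ?thesis
    by (rule bounded_count_imp_union_of_separated)
qed

lemma sum_ball_integrals_le:
  fixes p :: "'i \<Rightarrow> complex"
  assumes F: "finite F" and [measurable]: "\<phi> \<in> borel_measurable borel"
    and m: "\<And>z. card {i \<in> F. dist (p i) z \<le> 1} \<le> m"
  shows "(\<Sum>i\<in>F. \<integral>\<^sup>+z. \<phi> z * indicator (cball (p i) 1) z \<partial>lborel) \<le> of_nat m * (\<integral>\<^sup>+z. \<phi> z \<partial>lborel)"
proof -
  have [measurable]: "cball (p i) 1 \<in> sets borel" for i by simp
  have "(\<Sum>i\<in>F. \<integral>\<^sup>+z. \<phi> z * indicator (cball (p i) 1) z \<partial>lborel)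
    = (\<integral>\<^sup>+z. (\<Sum>i\<in>F. \<phi> z * indicator (cball (p i) 1) z) \<partial>lborel)"
    by (rule nn_integral_sum[symmetric]) measurable
  also have "\<dots> \<le> (\<integral>\<^sup>+z. of_nat m * \<phi> z \<partial>lborel)"
  proof (rule nn_integral_mono)
    fix z
    have "(\<Sum>i\<in>F. \<phi> z * indicator (cball (p i) 1) z) = \<phi> z * (\<Sum>i\<in>F. indicator {i. dist (p i) z \<le> 1} i)"
      by (simp add: sum_distrib_left indicator_def)
    also have "(\<Sum>i\<in>F. indicator {i. dist (p i) z \<le> 1} i :: ennreal) = of_nat (card {i \<in> F. dist (p i) z \<le> 1})"
      using F by (simp add: indicator_def Collect_conj_eq sum.If_cases)
    also have "\<phi> z * \<dots> \<le> \<phi> z * of_nat m"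
      by (intro mult_left_mono) (use m in auto)
    finally show "(\<Sum>i\<in>F. \<phi> z * indicator (cball (p i) 1) z) \<le> of_nat m * \<phi> z"
      by (simp add: mult.commute)
  qed
  also have "\<dots> = of_nat m * (\<integral>\<^sup>+z. \<phi> z \<partial>lborel)"
    by (rule nn_integral_cmult) measurable
  finally show ?thesis .
qed

text \<open>
  Each square is bounded by a local mass, and the discs that carry these masses overlap boundedly.
\<close>

lemma bessel:
  assumes "uniformly_locally_finite \<Gamma>" and \<alpha>: "\<alpha> \<ge> 0"
  shows "\<exists>C>0. \<forall>f F. f holomorphic_on UNIV \<longrightarrow> finite F \<longrightarrow> F \<subseteq> \<Gamma> \<longrightarrow>
    (\<Sum>\<gamma>\<in>F. ennreal ((wmod \<alpha> f \<gamma>)\<^sup>2)) \<le> ennreal C * (\<integral>\<^sup>+z. ennreal ((wmod \<alpha> f z)\<^sup>2) \<partial>lborel)"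
proof -
  obtain m where m: "\<And>a. finite (\<Gamma> \<inter> cball a 1)" "\<And>a. card (\<Gamma> \<inter> cball a 1) \<le> m"
    using assms unfolding uniformly_locally_finite_def by meson
  have "(\<Sum>\<gamma>\<in>F. ennreal ((wmod \<alpha> f \<gamma>)\<^sup>2)) \<le> ennreal (exp \<alpha> / pi * real (Suc m)) * (\<integral>\<^sup>+z. ennreal ((wmod \<alpha> f z)\<^sup>2) \<partial>lborel)"
    if f: "f holomorphic_on UNIV" and F: "finite F" "F \<subseteq> \<Gamma>" for f F
  proof -
    have [measurable]: "wmod \<alpha> f \<in> borel_measurable borel" using f by simp
    have "(\<Sum>\<gamma>\<in>F. ennreal ((wmod \<alpha> f \<gamma>)\<^sup>2)) \<le> ennreal (exp \<alpha> / pi) * (\<Sum>\<gamma>\<in>F. local_mass \<alpha> f \<gamma>)"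
      unfolding sum_distrib_left by (intro sum_mono wmod_le_local_mass f \<alpha>)
    also have "(\<Sum>\<gamma>\<in>F. local_mass \<alpha> f \<gamma>) \<le> of_nat (Suc m) * (\<integral>\<^sup>+z. ennreal ((wmod \<alpha> f z)\<^sup>2) \<partial>lborel)"
      unfolding local_mass_def
    proof (rule sum_ball_integrals_le[OF F(1)])
      fix z
      have "card {\<gamma> \<in> F. dist \<gamma> z \<le> 1} \<le> card (\<Gamma> \<inter> cball z 1)"
        using F m(1) by (intro card_mono) (auto simp: dist_commute)
      then show "card {\<gamma> \<in> F. dist \<gamma> z \<le> 1} \<le> Suc m" using m(2)[of z] by linarith
    qed measurable
    finally show ?thesis
      by (simp add: mult_left_mono ennreal_mult mult.assoc ennreal_of_nat_eq_real_of_nat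
          del: of_nat_Suc times_divide_eq_left)
  qed
  moreover have "exp \<alpha> / pi * real (Suc m) > 0" by simp
  ultimately show ?thesis by blast
qed

lemma gauss_bump:
  obtains G where "G holomorphic_on UNIV" "\<And>z. wmod \<alpha> G z = exp (- (\<alpha> / 2) * (cmod (z - a))\<^sup>2)"
  using recenter[of "\<lambda>_. 1" \<alpha> 0 a 1] by (auto simp: wmod_def[of 0])

text \<open>
  The sum is the sum of squares in Bessel's inequality for a Gaussian bump at \<open>a\<close>, whose norm does not
  depend on \<open>a\<close>.
\<close>

lemma sum_gauss_le:
  assumes "uniformly_locally_finite \<Gamma>" and \<kappa>: "\<kappa> > 0"
  shows "\<exists>C>0. \<forall>a F. finite F \<longrightarrow> F \<subseteq> \<Gamma> \<longrightarrow> (\<Sum>\<gamma>\<in>F. exp (- \<kappa> * (cmod (\<gamma> - a))\<^sup>2)) \<le> C"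
proof -
  obtain C where C: "C > 0" "\<And>f F. f holomorphic_on UNIV \<Longrightarrow> finite F \<Longrightarrow> F \<subseteq> \<Gamma> \<Longrightarrow>
    (\<Sum>\<gamma>\<in>F. ennreal ((wmod \<kappa> f \<gamma>)\<^sup>2)) \<le> ennreal C * (\<integral>\<^sup>+z. ennreal ((wmod \<kappa> f z)\<^sup>2) \<partial>lborel)"
    using bessel[OF assms(1), of \<kappa>] \<kappa> by auto
  have "(\<Sum>\<gamma>\<in>F. exp (- \<kappa> * (cmod (\<gamma> - a))\<^sup>2)) \<le> C * (pi / \<kappa>)" if F: "finite F" "F \<subseteq> \<Gamma>" for a F
  proof -
    obtain G where G: "G holomorphic_on UNIV" "\<And>z. wmod \<kappa> G z = exp (- (\<kappa> / 2) * (cmod (z - a))\<^sup>2)"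
      using gauss_bump by blast
    have G2: "(wmod \<kappa> G z)\<^sup>2 = exp (- \<kappa> * (cmod (z - a))\<^sup>2)" for z
      by (simp add: G power2_eq_square[of "exp _"] exp_add[symmetric])
    have "ennreal (\<Sum>\<gamma>\<in>F. exp (- \<kappa> * (cmod (\<gamma> - a))\<^sup>2)) \<le> ennreal (C * (pi / \<kappa>))"
      using C(2)[OF G(1) F] \<kappa> C(1) nn_integral_gauss[OF \<kappa>, of a] unfolding G2
      by (simp add: sum_ennreal ennreal_mult[symmetric])
    then show ?thesis using C(1) \<kappa> by (subst (asm) ennreal_le_iff) auto
  qed
  moreover have "C * (pi / \<kappa>) > 0" using C(1) \<kappa> by simp
  ultimately show ?thesis by blast
qed

section \<open>Sampling inequalities in terms of the weighted modulus\<close>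

lemma
  assumes \<alpha>: "\<alpha> > 0"
  shows fock_space_iff: "f \<in> fock_space \<alpha> \<longleftrightarrow> f holomorphic_on UNIV \<and> (\<integral>\<^sup>+z. ennreal ((wmod \<alpha> f z)\<^sup>2) \<partial>lborel) < \<infinity>"
    and fock_norm_eq: "f \<in> fock_space \<alpha> \<Longrightarrow>
      ennreal ((fock_norm \<alpha> f)\<^sup>2) = ennreal (\<alpha> / pi) * (\<integral>\<^sup>+z. ennreal ((wmod \<alpha> f z)\<^sup>2) \<partial>lborel)"
proof -
  have eq: "(\<integral>\<^sup>+z. ennreal ((cmod (f z))\<^sup>2) \<partial>gauss_measure \<alpha>) = ennreal (\<alpha> / pi) * (\<integral>\<^sup>+z. ennreal ((wmod \<alpha> f z)\<^sup>2) \<partial>lborel)"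
    if f: "f holomorphic_on UNIV"
  proof -
    have [measurable]: "f \<in> borel_measurable borel" "wmod \<alpha> f \<in> borel_measurable borel" 
      using f by (auto intro: borel_measurable_entire)
    have "(\<integral>\<^sup>+z. ennreal ((cmod (f z))\<^sup>2) \<partial>gauss_measure \<alpha>) 
      = (\<integral>\<^sup>+z. ennreal (\<alpha> / pi) * ennreal ((wmod \<alpha> f z)\<^sup>2) \<partial>lborel)"
      unfolding gauss_measure_def wmod_power2 using \<alpha>
      by (subst nn_integral_density) (auto simp: ennreal_mult[symmetric] mult_ac)
    then show ?thesis by (simp add: nn_integral_cmult)
  qed
  have [measurable]: "(\<lambda>z. (cmod (f z))\<^sup>2) \<in> borel_measurable (gauss_measure \<alpha>)" if "f holomorphic_on UNIV"
  proof -
    have [measurable]: "f \<in> borel_measurable borel" using that by (rule borel_measurable_entire)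
    show ?thesis unfolding gauss_measure_def by measurable
  qed
  then have int: "integrable (gauss_measure \<alpha>) (\<lambda>z. (cmod (f z))\<^sup>2) \<longleftrightarrow> (\<integral>\<^sup>+z. ennreal ((wmod \<alpha> f z)\<^sup>2) \<partial>lborel) < \<infinity>"
    if "f holomorphic_on UNIV"
    using that \<alpha> by (auto simp: integrable_iff_bounded eq ennreal_mult_less_top)
  then show "f \<in> fock_space \<alpha> \<longleftrightarrow> f holomorphic_on UNIV \<and> (\<integral>\<^sup>+z. ennreal ((wmod \<alpha> f z)\<^sup>2) \<partial>lborel) < \<infinity>"
    unfolding fock_space_def by auto
  assume f: "f \<in> fock_space \<alpha>"
  then have "ennreal (LINT z|gauss_measure \<alpha>. (cmod (f z))\<^sup>2) = (\<integral>\<^sup>+z. ennreal ((cmod (f z))\<^sup>2) \<partial>gauss_measure \<alpha>)"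
    unfolding fock_space_def by (subst nn_integral_eq_integral) auto
  then show "ennreal ((fock_norm \<alpha> f)\<^sup>2) = ennreal (\<alpha> / pi) * (\<integral>\<^sup>+z. ennreal ((wmod \<alpha> f z)\<^sup>2) \<partial>lborel)"
    using f eq unfolding fock_norm_def fock_space_def by (simp add: integral_nonneg_AE)
qed

text \<open>
  Finite sums with an extended real bound \<open>X\<close> spare all later arguments the summability questions.
\<close>

lemma sampling_imp_lower_bound:
  assumes \<alpha>: "\<alpha> > 0" and s: "sampling_set \<alpha> \<Gamma>"
  obtains c where "c > 0" 
    "\<And>f X. f holomorphic_on UNIV \<Longrightarrow> (\<integral>\<^sup>+z. ennreal ((wmod \<alpha> f z)\<^sup>2) \<partial>lborel) < \<infinity> \<Longrightarrow>
      (\<And>F. finite F \<Longrightarrow> F \<subseteq> \<Gamma> \<Longrightarrow> (\<Sum>\<gamma>\<in>F. ennreal ((wmod \<alpha> f \<gamma>)\<^sup>2)) \<le> X) \<Longrightarrow>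
      ennreal c * (\<integral>\<^sup>+z. ennreal ((wmod \<alpha> f z)\<^sup>2) \<partial>lborel) \<le> X"
proof -
  obtain A B where A: "A > 0" and "B > 0" and AB: "\<forall>f\<in>fock_space \<alpha>. 
      (\<lambda>z. (wmod \<alpha> f z)\<^sup>2) summable_on \<Gamma> \<and> A * (fock_norm \<alpha> f)\<^sup>2 \<le> (\<Sum>\<^sub>\<infinity>z\<in>\<Gamma>. (wmod \<alpha> f z)\<^sup>2) \<and>
      (\<Sum>\<^sub>\<infinity>z\<in>\<Gamma>. (wmod \<alpha> f z)\<^sup>2) \<le> B * (fock_norm \<alpha> f)\<^sup>2"
    using s unfolding sampling_set_def wmod_power2[symmetric] by blast
  have samp: "(\<lambda>z. (wmod \<alpha> f z)\<^sup>2) summable_on \<Gamma> \<and> A * (fock_norm \<alpha> f)\<^sup>2 \<le> (\<Sum>\<^sub>\<infinity>z\<in>\<Gamma>. (wmod \<alpha> f z)\<^sup>2)"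
    if "f \<in> fock_space \<alpha>" for f
    using AB that by blast
  have "ennreal (A * (\<alpha> / pi)) * (\<integral>\<^sup>+z. ennreal ((wmod \<alpha> f z)\<^sup>2) \<partial>lborel) \<le> X"
    if f: "f holomorphic_on UNIV" "(\<integral>\<^sup>+z. ennreal ((wmod \<alpha> f z)\<^sup>2) \<partial>lborel) < \<infinity>"
      and X: "\<And>F. finite F \<Longrightarrow> F \<subseteq> \<Gamma> \<Longrightarrow> (\<Sum>\<gamma>\<in>F. ennreal ((wmod \<alpha> f \<gamma>)\<^sup>2)) \<le> X" for f X
  proof (cases X)
    case (real x)
    have fs: "f \<in> fock_space \<alpha>" using f fock_space_iff[OF \<alpha>] by blast
    have "(\<Sum>\<gamma>\<in>F. (wmod \<alpha> f \<gamma>)\<^sup>2) \<le> x" if "finite F" "F \<subseteq> \<Gamma>" for F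
      using X[OF that] real by (simp add: sum_ennreal sum_nonneg)
    then have "(\<Sum>\<^sub>\<infinity>z\<in>\<Gamma>. (wmod \<alpha> f z)\<^sup>2) \<le> x"
      using samp[OF fs] by (intro infsum_le_finite_sums) auto
    then have "A * (fock_norm \<alpha> f)\<^sup>2 \<le> x" using samp[OF fs] by linarith
    then have "ennreal A * ennreal ((fock_norm \<alpha> f)\<^sup>2) \<le> X"
      using A real by (simp add: ennreal_mult[symmetric] ennreal_leI)
    then show ?thesis
      unfolding fock_norm_eq[OF \<alpha> fs] using A \<alpha>
      by (simp add: ennreal_mult mult.assoc del: times_divide_eq_right)
  qed simp
  moreover have "A * (\<alpha> / pi) > 0" using A \<alpha> by simp
  ultimately show ?thesis using that by blast
qed

text \<open>
  The normalised reproducing kernel at \<open>a\<close> has norm 1 and is bounded below on the disc of radius \<open>r\<close> around \<open>a\<close>,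
  independently of \<open>a\<close>.
\<close>

lemma sampling_imp_uniformly_locally_finite:
  assumes \<alpha>: "\<alpha> > 0" and s: "sampling_set \<alpha> \<Gamma>"
  shows "uniformly_locally_finite \<Gamma>"
proof -
  obtain A B where "A > 0" and B: "B > 0" and AB: "\<forall>f\<in>fock_space \<alpha>. 
      (\<lambda>z. (wmod \<alpha> f z)\<^sup>2) summable_on \<Gamma> \<and> A * (fock_norm \<alpha> f)\<^sup>2 \<le> (\<Sum>\<^sub>\<infinity>z\<in>\<Gamma>. (wmod \<alpha> f z)\<^sup>2) \<and>
      (\<Sum>\<^sub>\<infinity>z\<in>\<Gamma>. (wmod \<alpha> f z)\<^sup>2) \<le> B * (fock_norm \<alpha> f)\<^sup>2"
    using s unfolding sampling_set_def wmod_power2[symmetric] by blast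
  have samp: "(\<lambda>z. (wmod \<alpha> f z)\<^sup>2) summable_on \<Gamma> \<and> (\<Sum>\<^sub>\<infinity>z\<in>\<Gamma>. (wmod \<alpha> f z)\<^sup>2) \<le> B * (fock_norm \<alpha> f)\<^sup>2"
    if "f \<in> fock_space \<alpha>" for f
    using AB that by blast
  show ?thesis
    unfolding uniformly_locally_finite_def
  proof
    fix r
    define m where "m = nat \<lfloor>B * exp (\<alpha> * r\<^sup>2)\<rfloor>"
    have "card F \<le> m" if F: "F \<subseteq> \<Gamma> \<inter> cball a r" "finite F" for F a
    proof -
      obtain G where G: "G holomorphic_on UNIV" "\<And>z. wmod \<alpha> G z = exp (- (\<alpha> / 2) * (cmod (z - a))\<^sup>2)"
        using gauss_bump by blast
      have G2: "(wmod \<alpha> G z)\<^sup>2 = exp (- \<alpha> * (cmod (z - a))\<^sup>2)" for z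
        by (simp add: G power2_eq_square[of "exp _"] exp_add[symmetric])
      have nn: "(\<integral>\<^sup>+z. ennreal ((wmod \<alpha> G z)\<^sup>2) \<partial>lborel) = ennreal (pi / \<alpha>)"
        unfolding G2 by (rule nn_integral_gauss[OF \<alpha>])
      have fs: "G \<in> fock_space \<alpha>" using G nn fock_space_iff[OF \<alpha>] by simp
      have "ennreal ((fock_norm \<alpha> G)\<^sup>2) = 1"
        unfolding fock_norm_eq[OF \<alpha> fs] nn using \<alpha> by (simp add: ennreal_mult[symmetric])
      then have n1: "(fock_norm \<alpha> G)\<^sup>2 = 1" by simp
      have "real (card F) * exp (- \<alpha> * r\<^sup>2) = (\<Sum>z\<in>F. exp (- \<alpha> * r\<^sup>2))" by simp
      also have "\<dots> \<le> (\<Sum>z\<in>F. (wmod \<alpha> G z)\<^sup>2)"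
      proof (rule sum_mono)
        fix z assume "z \<in> F"
        then have "cmod (z - a) \<le> r" using F by (auto simp: dist_norm norm_minus_commute)
        then have "(cmod (z - a))\<^sup>2 \<le> r\<^sup>2" by (intro power_mono) auto
        then show "exp (- \<alpha> * r\<^sup>2) \<le> (wmod \<alpha> G z)\<^sup>2" unfolding G2 using \<alpha> by simp
      qed
      also have "\<dots> \<le> (\<Sum>\<^sub>\<infinity>z\<in>\<Gamma>. (wmod \<alpha> G z)\<^sup>2)"
        using samp[OF fs] F by (intro finite_sum_le_infsum) auto
      also have "\<dots> \<le> B" using samp[OF fs] n1 by simp
      finally have "real (card F) \<le> B * exp (\<alpha> * r\<^sup>2)"
        by (simp add: exp_minus field_simps)
      then show ?thesis unfolding m_def by (simp add: le_nat_floor)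
    qed
    then have "finite (\<Gamma> \<inter> cball a r) \<and> card (\<Gamma> \<inter> cball a r) \<le> m" for a
      by (meson finite_if_finite_subsets_card_bdd order_refl)
    then show "\<exists>m. \<forall>a. finite (\<Gamma> \<inter> cball a r) \<and> card (\<Gamma> \<inter> cball a r) \<le> m" by blast
  qed
qed

lemma nn_integral_count_space_eq_infsum:
  assumes "\<And>x. x \<in> A \<Longrightarrow> f x \<ge> (0::real)" and "f summable_on A"
  shows "(\<integral>\<^sup>+x. ennreal (f x) \<partial>count_space A) = ennreal (infsum f A)"
proof -
  have "(\<lambda>x. norm (f x)) summable_on A"
    using assms by (subst summable_on_cong[of _ _ f]) auto
  then have "Infinite_Set_Sum.abs_summable_on f A"
    by (simp only: abs_summable_equivalent)
  then show ?thesis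
    using assms by (simp add: nn_integral_conv_infsetsum infsetsum_infsum)
qed

text \<open>
  The upper inequality is Bessel's, and a lower bound by the samples on a subset is one by all samples.
\<close>

lemma sampling_setI:
  assumes \<alpha>: "\<alpha> > 0" and ulf: "uniformly_locally_finite \<Gamma>" and sub: "\<Gamma>' \<subseteq> \<Gamma>" and K: "K > 0"
    and lower: "\<And>f. f holomorphic_on UNIV \<Longrightarrow> (\<integral>\<^sup>+z. ennreal ((wmod \<alpha> f z)\<^sup>2) \<partial>lborel) < \<infinity> \<Longrightarrow>
      (\<integral>\<^sup>+z. ennreal ((wmod \<alpha> f z)\<^sup>2) \<partial>lborel) \<le> ennreal K * (\<integral>\<^sup>+\<gamma>. ennreal ((wmod \<alpha> f \<gamma>)\<^sup>2) \<partial>count_space \<Gamma>')"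
  shows "sampling_set \<alpha> \<Gamma>"
proof -
  obtain C where C: "C > 0" "\<And>f F. f holomorphic_on UNIV \<Longrightarrow> finite F \<Longrightarrow> F \<subseteq> \<Gamma> \<Longrightarrow>
    (\<Sum>\<gamma>\<in>F. ennreal ((wmod \<alpha> f \<gamma>)\<^sup>2)) \<le> ennreal C * (\<integral>\<^sup>+z. ennreal ((wmod \<alpha> f z)\<^sup>2) \<partial>lborel)"
    using bessel[OF ulf, of \<alpha>] \<alpha> by auto
  define A where "A = \<alpha> / pi * K"
  define B where "B = C * (pi / \<alpha>)"
  have AB: "A > 0" "B > 0" using \<alpha> K C(1) by (auto simp: A_def B_def)
  have "(\<lambda>z. (wmod \<alpha> f z)\<^sup>2) summable_on \<Gamma> \<and> (fock_norm \<alpha> f)\<^sup>2 \<le> A * (\<Sum>\<^sub>\<infinity>z\<in>\<Gamma>. (wmod \<alpha> f z)\<^sup>2) \<and>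
      (\<Sum>\<^sub>\<infinity>z\<in>\<Gamma>. (wmod \<alpha> f z)\<^sup>2) \<le> B * (fock_norm \<alpha> f)\<^sup>2" if fs: "f \<in> fock_space \<alpha>" for f
  proof -
    have f: "f holomorphic_on UNIV" "(\<integral>\<^sup>+z. ennreal ((wmod \<alpha> f z)\<^sup>2) \<partial>lborel) < \<infinity>"
      using fs fock_space_iff[OF \<alpha>] by blast+
    obtain N where N: "N \<ge> 0" "(\<integral>\<^sup>+z. ennreal ((wmod \<alpha> f z)\<^sup>2) \<partial>lborel) = ennreal N"
      using f(2) by (cases "\<integral>\<^sup>+z. ennreal ((wmod \<alpha> f z)\<^sup>2) \<partial>lborel") auto
    have fn: "(fock_norm \<alpha> f)\<^sup>2 = \<alpha> / pi * N"
      using fock_norm_eq[OF \<alpha> fs] N \<alpha> by (simp add: ennreal_mult[symmetric])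
    have fin: "(\<Sum>\<gamma>\<in>F. (wmod \<alpha> f \<gamma>)\<^sup>2) \<le> C * N" if F: "finite F" "F \<subseteq> \<Gamma>" for F
      using C(2)[OF f(1) F] N C(1) by (simp add: sum_ennreal sum_nonneg ennreal_mult[symmetric])
    have sm: "(\<lambda>z. (wmod \<alpha> f z)\<^sup>2) summable_on \<Gamma>"
      by (rule nonneg_bdd_above_summable_on) (auto intro!: bdd_aboveI2[of _ _ "C * N"] fin)
    have up: "(\<Sum>\<^sub>\<infinity>z\<in>\<Gamma>. (wmod \<alpha> f z)\<^sup>2) \<le> B * (fock_norm \<alpha> f)\<^sup>2"
      using infsum_le_finite_sums[OF sm fin] \<alpha> by (simp add: fn B_def)
    have sm': "(\<lambda>z. (wmod \<alpha> f z)\<^sup>2) summable_on \<Gamma>'"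
      using sm sub by (rule summable_on_subset_banach)
    have "ennreal N \<le> ennreal (K * (\<Sum>\<^sub>\<infinity>z\<in>\<Gamma>'. (wmod \<alpha> f z)\<^sup>2))"
      using lower[OF f] K by (simp add: N nn_integral_count_space_eq_infsum[OF _ sm'] ennreal_mult infsum_nonneg)
    then have "N \<le> K * (\<Sum>\<^sub>\<infinity>z\<in>\<Gamma>'. (wmod \<alpha> f z)\<^sup>2)"
      using K by (subst (asm) ennreal_le_iff) (auto simp: infsum_nonneg)
    also have "\<dots> \<le> K * (\<Sum>\<^sub>\<infinity>z\<in>\<Gamma>. (wmod \<alpha> f z)\<^sup>2)"
      using K sub by (intro mult_left_mono infsum_mono_neutral sm sm') auto
    finally have "(fock_norm \<alpha> f)\<^sup>2 \<le> A * (\<Sum>\<^sub>\<infinity>z\<in>\<Gamma>. (wmod \<alpha> f z)\<^sup>2)"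
      unfolding fn A_def mult.assoc using \<alpha> by (intro mult_left_mono) auto
    then show ?thesis using sm up by blast
  qed
  then have "(\<lambda>z. (wmod \<alpha> f z)\<^sup>2) summable_on \<Gamma> \<and> (1 / A) * (fock_norm \<alpha> f)\<^sup>2 \<le> (\<Sum>\<^sub>\<infinity>z\<in>\<Gamma>. (wmod \<alpha> f z)\<^sup>2) \<and>
      (\<Sum>\<^sub>\<infinity>z\<in>\<Gamma>. (wmod \<alpha> f z)\<^sup>2) \<le> B * (fock_norm \<alpha> f)\<^sup>2" if "f \<in> fock_space \<alpha>" for f
    using that AB(1) by (simp add: divide_le_eq mult.commute)
  moreover have "1 / A > 0" using AB(1) by simp
  ultimately show ?thesis
    unfolding sampling_set_def wmod_power2[symmetric] using AB(2) by blast
qed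

section \<open>From square sampling to uniform sampling at a larger exponent\<close>

text \<open>
  Sampling for the space of entire functions with bounded weighted modulus. The number \<open>M\<close> only
  witnesses that the weighted modulus is bounded.
\<close>

definition sup_sampling :: "real \<Rightarrow> complex set \<Rightarrow> real \<Rightarrow> bool" where
  "sup_sampling \<alpha> \<Gamma> K \<longleftrightarrow> (\<forall>f M \<eta>. f holomorphic_on UNIV \<longrightarrow> (\<forall>z. wmod \<alpha> f z \<le> M) \<longrightarrow> 0 \<le> \<eta> \<longrightarrow>
     (\<forall>\<gamma>\<in>\<Gamma>. wmod \<alpha> f \<gamma> \<le> \<eta>) \<longrightarrow> (\<forall>z. wmod \<alpha> f z \<le> K * \<eta>))"

lemma sup_samplingD:
  assumes "sup_sampling \<alpha> \<Gamma> K" "f holomorphic_on UNIV" "\<And>z. wmod \<alpha> f z \<le> M" "0 \<le> \<eta>"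
    "\<And>\<gamma>. \<gamma> \<in> \<Gamma> \<Longrightarrow> wmod \<alpha> f \<gamma> \<le> \<eta>"
  shows "wmod \<alpha> f z \<le> K * \<eta>"
  using assms unfolding sup_sampling_def by blast

text \<open>
  The wide Gaussian is the convolution of the narrow one with a Gaussian of exponent \<open>\<tau>/3\<close>, up to a constant. The
  factor 4 does not depend on \<open>\<tau>\<close>, as is seen by scaling; the absorption argument below relies on that.
\<close>

lemma gauss_widen:
  fixes a :: complex
  assumes [measurable]: "\<phi> \<in> borel_measurable borel" and \<tau>: "\<tau> > 0"
  shows "(\<integral>\<^sup>+z. \<phi> z * ennreal (exp (- (\<tau> / 4) * (cmod (z - a))\<^sup>2)) \<partial>lborel)
    \<le> 4 * (SUP b. \<integral>\<^sup>+z. \<phi> z * ennreal (exp (- \<tau> * (cmod (z - b))\<^sup>2)) \<partial>lborel)"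
    (is "?L \<le> 4 * ?S")
proof -
  have conv: "(\<integral>\<^sup>+b. ennreal (exp (- \<tau> * (cmod (z - b))\<^sup>2)) * ennreal (exp (- (\<tau> / 3) * (cmod (b - a))\<^sup>2)) \<partial>lborel)
      = ennreal (3 * pi / (4 * \<tau>)) * ennreal (exp (- (\<tau> / 4) * (cmod (z - a))\<^sup>2))" for z
  proof -
    define w where "w = (3 / 4) *\<^sub>R z + (1 / 4) *\<^sub>R a"
    have "\<tau> * (cmod (z - b))\<^sup>2 + (\<tau> / 3) * (cmod (b - a))\<^sup>2
        = (4 * \<tau> / 3) * (cmod (b - w))\<^sup>2 + (\<tau> / 4) * (cmod (z - a))\<^sup>2" for b
      unfolding cmod_power2 w_def by (simp add: field_simps power2_eq_square)
    then have "exp (- \<tau> * (cmod (z - b))\<^sup>2 + - (\<tau> / 3) * (cmod (b - a))\<^sup>2)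
        = exp (- (4 * \<tau> / 3) * (cmod (b - w))\<^sup>2 + - (\<tau> / 4) * (cmod (z - a))\<^sup>2)" for b
      by (intro arg_cong[where f = exp]) (smt (verit) mult_minus_left)
    then have "ennreal (exp (- \<tau> * (cmod (z - b))\<^sup>2)) * ennreal (exp (- (\<tau> / 3) * (cmod (b - a))\<^sup>2))
        = ennreal (exp (- (4 * \<tau> / 3) * (cmod (b - w))\<^sup>2)) * ennreal (exp (- (\<tau> / 4) * (cmod (z - a))\<^sup>2))" for b
      by (simp only: ennreal_mult[symmetric] exp_ge_zero exp_add)
    then have "(\<integral>\<^sup>+b. ennreal (exp (- \<tau> * (cmod (z - b))\<^sup>2)) * ennreal (exp (- (\<tau> / 3) * (cmod (b - a))\<^sup>2)) \<partial>lborel)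
      = (\<integral>\<^sup>+b. ennreal (exp (- (4 * \<tau> / 3) * (cmod (b - w))\<^sup>2)) \<partial>lborel) * ennreal (exp (- (\<tau> / 4) * (cmod (z - a))\<^sup>2))"
      by (subst nn_integral_multc[symmetric]) simp_all
    also have "(\<integral>\<^sup>+b. ennreal (exp (- (4 * \<tau> / 3) * (cmod (b - w))\<^sup>2)) \<partial>lborel) = ennreal (3 * pi / (4 * \<tau>))"
      using \<tau> by (subst nn_integral_gauss) (auto simp: mult.commute)
    finally show ?thesis .
  qed
  have "ennreal (3 * pi / (4 * \<tau>)) * ?L
    = (\<integral>\<^sup>+z. \<integral>\<^sup>+b. \<phi> z * (ennreal (exp (- \<tau> * (cmod (z - b))\<^sup>2)) * ennreal (exp (- (\<tau> / 3) * (cmod (b - a))\<^sup>2))) \<partial>lborel \<partial>lborel)"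
  proof -
    have "(\<integral>\<^sup>+b. \<phi> z * (ennreal (exp (- \<tau> * (cmod (z - b))\<^sup>2)) * ennreal (exp (- (\<tau> / 3) * (cmod (b - a))\<^sup>2))) \<partial>lborel)
      = ennreal (3 * pi / (4 * \<tau>)) * (\<phi> z * ennreal (exp (- (\<tau> / 4) * (cmod (z - a))\<^sup>2)))" for z
      by (subst nn_integral_cmult, measurable, subst conv) (rule mult.left_commute)
    then show ?thesis
      by (simp only:) (rule nn_integral_cmult[symmetric], measurable)
  qed
  also have "\<dots> = (\<integral>\<^sup>+b. \<integral>\<^sup>+z. \<phi> z * (ennreal (exp (- \<tau> * (cmod (z - b))\<^sup>2)) * ennreal (exp (- (\<tau> / 3) * (cmod (b - a))\<^sup>2))) \<partial>lborel \<partial>lborel)"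
    by (rule lborel_pair.Fubini') (simp add: case_prod_beta)
  also have "\<dots> = (\<integral>\<^sup>+b. (\<integral>\<^sup>+z. \<phi> z * ennreal (exp (- \<tau> * (cmod (z - b))\<^sup>2)) \<partial>lborel) * ennreal (exp (- (\<tau> / 3) * (cmod (b - a))\<^sup>2)) \<partial>lborel)"
    by (subst nn_integral_multc[symmetric]) (auto simp: mult.assoc)
  also have "\<dots> \<le> (\<integral>\<^sup>+b. ?S * ennreal (exp (- (\<tau> / 3) * (cmod (b - a))\<^sup>2)) \<partial>lborel)"
    by (intro nn_integral_mono mult_right_mono SUP_upper) auto
  also have "\<dots> = ?S * ennreal (3 * pi / \<tau>)"
    using \<tau> by (subst nn_integral_cmult, measurable, subst nn_integral_gauss) (auto simp: mult.commute)
  finally have "ennreal (4 * \<tau> / (3 * pi)) * (ennreal (3 * pi / (4 * \<tau>)) * ?L) \<le> ennreal (4 * \<tau> / (3 * pi)) * (ennreal (3 * pi / \<tau>) * ?S)"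
    unfolding mult.commute[of _ ?S]
    by (rule mult_left_mono) simp
  moreover have "ennreal (4 * \<tau> / (3 * pi)) * ennreal (3 * pi / (4 * \<tau>)) = 1"
    using \<tau> by (simp add: ennreal_mult[symmetric])
  moreover have "ennreal (4 * \<tau> / (3 * pi)) * ennreal (3 * pi / \<tau>) = 4"
    using \<tau> by (simp add: ennreal_mult[symmetric])
  ultimately show ?thesis
    by (simp only: mult.assoc[symmetric] mult.commute[of ?S] mult_1_left)
qed

text \<open>
  A contraction by \<open>s\<close> moves a point whose image has distance \<open>y\<close> from the centre by \<open>(1 - s) y / s\<close>, where
  \<open>1 - s\<close> is of order \<open>\<tau>\<close>. Since \<open>y\<close> is at most of order \<open>\<tau> powr (-1/2)\<close> under the Gaussian, the squared displacement
  is of order \<open>\<tau>\<close>; the price is a Gaussian of half the exponent.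
\<close>

lemma dilation_displacement:
  fixes y :: real
  assumes \<alpha>: "\<alpha> > 0" and \<tau>: "\<tau> > 0" and s: "s > 0" "s\<^sup>2 = \<alpha> / (\<alpha> + 2 * \<tau>)"
  shows "((1 - s) / s * y)\<^sup>2 * exp (- \<tau> * y\<^sup>2) \<le> 2 * \<tau> / \<alpha>\<^sup>2 * exp (- (\<tau> / 2) * y\<^sup>2)"
proof -
  have i2: "(1 / s)\<^sup>2 = 1 + 2 * \<tau> / \<alpha>"
    using s \<alpha> \<tau> by (simp add: power_divide field_simps)
  have "(1 / s)\<^sup>2 \<le> (1 + \<tau> / \<alpha>)\<^sup>2"
    unfolding i2 using \<alpha> \<tau> by (simp add: power2_eq_square algebra_simps)
  then have "1 / s \<le> 1 + \<tau> / \<alpha>"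
    by (rule power2_le_imp_le) (use \<alpha> \<tau> in simp)
  moreover have "1 / s \<ge> 1"
  proof -
    have "1\<^sup>2 \<le> (1 / s)\<^sup>2" unfolding i2 using \<alpha> \<tau> by simp
    then show ?thesis by (rule power2_le_imp_le) (use s in simp)
  qed
  moreover have "(1 - s) / s = 1 / s - 1" using s by (simp add: diff_divide_distrib)
  ultimately have "((1 - s) / s)\<^sup>2 \<le> (\<tau> / \<alpha>)\<^sup>2"
    by (intro power_mono) auto
  moreover have "y\<^sup>2 * exp (- \<tau> * y\<^sup>2) \<le> 2 / \<tau> * exp (- (\<tau> / 2) * y\<^sup>2)"
  proof -
    have "\<tau> / 2 * y\<^sup>2 \<le> exp (\<tau> / 2 * y\<^sup>2)"
      using exp_ge_add_one_self[of "\<tau> / 2 * y\<^sup>2"] by linarith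
    then have "\<tau> / 2 * y\<^sup>2 * exp (- \<tau> * y\<^sup>2) \<le> exp (\<tau> / 2 * y\<^sup>2) * exp (- \<tau> * y\<^sup>2)"
      by (intro mult_right_mono) auto
    also have "\<dots> = exp (- (\<tau> / 2) * y\<^sup>2)"
      by (simp add: exp_add[symmetric])
    finally show ?thesis using \<tau> by (simp add: field_simps)
  qed
  ultimately have "((1 - s) / s)\<^sup>2 * (y\<^sup>2 * exp (- \<tau> * y\<^sup>2)) \<le> (\<tau> / \<alpha>)\<^sup>2 * (2 / \<tau> * exp (- (\<tau> / 2) * y\<^sup>2))"
    by (rule mult_mono) (use \<tau> in auto)
  then show ?thesis
    using \<tau> \<alpha> by (simp add: power_mult_distrib power2_eq_square power_divide mult_ac)
qed

text \<open>
  Let \<open>N t a\<close> be the integral of \<open>u\<^sup>2\<close> against a Gaussian of exponent \<open>t\<close> around \<open>a\<close>, where \<open>u\<close> is the weighted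
  modulus of \<open>f\<close> at the exponent \<open>\<beta> = \<alpha> + \<tau>\<close>. The contraction of \<open>f\<close> towards \<open>a\<close> has square norm comparable to \<open>N \<tau> a\<close>,
  and its samples are values of \<open>u\<close> at displaced points. Undoing the displacement leaves an error of order
  \<open>\<tau> N (\<tau>/4) a\<close>, which by \<open>gauss_widen\<close> is at most of order \<open>\<tau> S\<close> with \<open>S\<close> the supremum of \<open>N \<tau>\<close>. Taking the
  supremum over \<open>a\<close> on the left, one absorbs the error for small \<open>\<tau>\<close>. Boundedness of \<open>u\<close> ensures that \<open>S\<close> is
  finite. A pointwise supremum instead of \<open>S\<close> would not do: the Gaussian has area of order \<open>1/\<tau>\<close>, which would cancel
  the gain of \<open>\<tau>\<close>.
\<close>

lemma sampling_imp_sup_sampling: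
  assumes \<alpha>: "\<alpha> > 0" and samp: "sampling_set \<alpha> \<Gamma>"
  shows "\<exists>\<beta>>\<alpha>. \<exists>K>0. sup_sampling \<beta> \<Gamma> K"
proof -
  obtain c where c: "c > 0" and lower:
    "\<And>f X. f holomorphic_on UNIV \<Longrightarrow> (\<integral>\<^sup>+z. ennreal ((wmod \<alpha> f z)\<^sup>2) \<partial>lborel) < \<infinity> \<Longrightarrow>
      (\<And>F. finite F \<Longrightarrow> F \<subseteq> \<Gamma> \<Longrightarrow> (\<Sum>\<gamma>\<in>F. ennreal ((wmod \<alpha> f \<gamma>)\<^sup>2)) \<le> X) \<Longrightarrow>
      ennreal c * (\<integral>\<^sup>+z. ennreal ((wmod \<alpha> f z)\<^sup>2) \<partial>lborel) \<le> X"
    using sampling_imp_lower_bound[OF \<alpha> samp] by blast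
  have ulf: "uniformly_locally_finite \<Gamma>" using \<alpha> samp by (rule sampling_imp_uniformly_locally_finite)
  obtain m where m: "\<And>a. finite (\<Gamma> \<inter> cball a 2)" "\<And>a. card (\<Gamma> \<inter> cball a 2) \<le> m"
    using ulf unfolding uniformly_locally_finite_def by meson
  define E where "E = exp (2 * \<alpha>)"
  \<comment> \<open>\<open>D * \<tau> * S\<close> will bound the error made by undoing the displacement, and the choice of \<open>\<tau>\<close>
    makes it at most half of the left-hand side\<close>
  define D where "D = 4800 * E * (real m + 1) / \<alpha>\<^sup>2"
  define \<tau> where "\<tau> = Min {\<alpha> / 2, 1, c / (2 * D)}"
  \<comment> \<open>with this \<open>s\<close> the Gaussian factor has exponent \<open>\<tau>\<close> in terms of the contracted point\<close>
  define s where "s = sqrt (\<alpha> / (\<alpha> + 2 * \<tau>))"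
  define \<beta> where "\<beta> = \<alpha> + \<tau>"
  define \<kappa> where "\<kappa> = s\<^sup>2 * \<tau>"
  have E: "E \<ge> 1" using \<alpha> by (simp add: E_def)
  have D: "D > 0" using \<alpha> E by (simp add: D_def add_nonneg_pos)
  have \<tau>: "\<tau> > 0" "\<tau> \<le> \<alpha> / 2" "\<tau> \<le> 1" "\<tau> \<le> c / (2 * D)"
    using \<alpha> c D by (auto simp: \<tau>_def)
  have D\<tau>: "D * \<tau> \<le> c / 2" using \<tau>(4) D by (simp add: field_simps)
  have s2: "s\<^sup>2 = \<alpha> / (\<alpha> + 2 * \<tau>)" and s0: "s > 0"
    using \<alpha> \<tau> by (auto simp: s_def)
  have s1: "s \<le> 1" using \<alpha> \<tau> by (simp add: s_def)
  have s_half: "s \<ge> 1 / 2"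
  proof (rule power2_le_imp_le)
    show "(1 / 2)\<^sup>2 \<le> s\<^sup>2" unfolding s2 using \<alpha> \<tau> by (simp add: field_simps power2_eq_square)
  qed (use s0 in simp)
  have \<kappa>0: "\<kappa> > 0" using s0 \<tau> by (simp add: \<kappa>_def)
  have \<kappa>: "\<alpha> - s\<^sup>2 * \<beta> = \<kappa>"
    unfolding \<kappa>_def s2 \<beta>_def using \<alpha> \<tau> by (simp add: field_simps)
  have \<beta>: "\<beta> > \<alpha>" "\<beta> \<ge> 0" "exp \<beta> \<le> E"
    using \<tau> \<alpha> by (auto simp: \<beta>_def E_def)
  have e\<tau>: "exp \<tau> \<le> 3"
    using \<tau>(3) exp_le order_trans[of "exp \<tau>" "exp 1" 3] by simp
  obtain C where C: "C > 0" "\<And>a F. finite F \<Longrightarrow> F \<subseteq> \<Gamma> \<Longrightarrow> (\<Sum>\<gamma>\<in>F. exp (- \<kappa> * (cmod (\<gamma> - a))\<^sup>2)) \<le> C"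
    using sum_gauss_le[OF ulf \<kappa>0] by meson
  define K where "K = sqrt (12 * E\<^sup>2 * C / c)"
  have K0: "K > 0" using E C(1) c by (simp add: K_def)
  have "wmod \<beta> f z \<le> K * \<eta>" 
    if f: "f holomorphic_on UNIV" and M: "\<And>z. wmod \<beta> f z \<le> M" and \<eta>: "0 \<le> \<eta>" "\<And>\<gamma>. \<gamma> \<in> \<Gamma> \<Longrightarrow> wmod \<beta> f \<gamma> \<le> \<eta>" 
    for f M \<eta> z
  proof -
    define u where "u = wmod \<beta> f"
    have um [measurable]: "u \<in> borel_measurable borel" unfolding u_def using f by simp
    have u0: "u z \<ge> 0" for z by (simp add: u_def)
    have M0: "M \<ge> 0" using order_trans[OF wmod_nonneg M] by blast
    define N where "N = (\<lambda>t a. \<integral>\<^sup>+z. ennreal ((u z)\<^sup>2) * ennreal (exp (- t * (cmod (z - a))\<^sup>2)) \<partial>lborel)"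
    define S where "S = (SUP b. N \<tau> b)"
    have Nfin: "N t b \<le> ennreal (M\<^sup>2 * (pi / t))" if "t > 0" for t b
    proof -
      have "N t b \<le> (\<integral>\<^sup>+z. ennreal (M\<^sup>2) * ennreal (exp (- t * (cmod (z - b))\<^sup>2)) \<partial>lborel)"
        unfolding N_def u_def by (intro nn_integral_mono mult_right_mono ennreal_leI power_mono M) auto
      also have "\<dots> = ennreal (M\<^sup>2) * ennreal (pi / t)"
        unfolding nn_integral_gauss[OF that, of b, symmetric] by (rule nn_integral_cmult) measurable
      also have "\<dots> = ennreal (M\<^sup>2 * (pi / t))"
        using that by (intro ennreal_mult[symmetric]) auto
      finally show ?thesis .
    qed
    have S_fin: "S \<noteq> top"
    proof -
      have "S \<le> ennreal (M\<^sup>2 * (pi / \<tau>))"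
        unfolding S_def by (intro SUP_least Nfin \<tau>)
      then show ?thesis by (auto simp: top_unique)
    qed
    have widen: "N (\<tau> / 4) a \<le> 4 * S" for a
      unfolding N_def S_def by (rule gauss_widen) (use \<tau> in auto)
    have key: "ennreal c * N \<tau> a \<le> ennreal (2 * E * C * \<eta>\<^sup>2) + ennreal (D * \<tau>) * S" for a
    proof -
      define p where "p = (\<lambda>\<gamma>. a + s *\<^sub>R (\<gamma> - a))"
      have pa: "cmod (p \<gamma> - a) = s * cmod (\<gamma> - a)" for \<gamma>
        using s0 by (simp add: p_def)
      have p\<gamma>: "cmod (p \<gamma> - \<gamma>) = (1 - s) / s * cmod (p \<gamma> - a)" for \<gamma>
      proof -
        have "p \<gamma> - \<gamma> = (s - 1) *\<^sub>R (\<gamma> - a)" by (simp add: p_def algebra_simps)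
        then show ?thesis using s0 s1 by (simp add: pa)
      qed
      have \<kappa>p: "\<kappa> * (cmod (\<gamma> - a))\<^sup>2 = \<tau> * (cmod (p \<gamma> - a))\<^sup>2" for \<gamma>
        by (simp add: pa \<kappa>_def power_mult_distrib)
      obtain G where G: "G holomorphic_on UNIV"
        "\<And>z. wmod \<alpha> G z = u (p z) * exp (- (\<kappa> / 2) * (cmod (z - a))\<^sup>2)"
        using recenter[OF f, of \<alpha> \<beta> a s] unfolding \<kappa> u_def p_def by blast
      have G2: "(wmod \<alpha> G z)\<^sup>2 = (u (p z))\<^sup>2 * exp (- \<tau> * (cmod (p z - a))\<^sup>2)" for z
        by (simp add: G(2) power_mult_distrib power2_eq_square[of "exp _"] exp_add[symmetric] \<kappa>p)
      have NG: "N \<tau> a = ennreal (s\<^sup>2) * (\<integral>\<^sup>+z. ennreal ((wmod \<alpha> G z)\<^sup>2) \<partial>lborel)"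
      proof -
        have "p z = (a - s *\<^sub>R a) + s *\<^sub>R z" for z by (simp add: p_def algebra_simps)
        then show ?thesis
          unfolding N_def G2 using s0
          by (subst nn_integral_complex_affine[of _ s "a - s *\<^sub>R a"]) (auto simp: ennreal_mult)
      qed
      have Gfin: "(\<integral>\<^sup>+z. ennreal ((wmod \<alpha> G z)\<^sup>2) \<partial>lborel) < \<infinity>"
      proof (rule ccontr)
        assume "\<not> ?thesis"
        then have "(\<integral>\<^sup>+z. ennreal ((wmod \<alpha> G z)\<^sup>2) \<partial>lborel) = top"
          by (simp add: not_less top_unique)
        then have "N \<tau> a = top" unfolding NG using s0 by (simp add: ennreal_mult_top)
        then show False using Nfin[OF \<tau>(1), of a] by (simp add: top_unique)
      qed
      have bound: "(\<Sum>\<gamma>\<in>F. ennreal ((wmod \<alpha> G \<gamma>)\<^sup>2)) \<le> ennreal (2 * E * C * \<eta>\<^sup>2) + ennreal (D * \<tau>) * S"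
        if F: "finite F" "F \<subseteq> \<Gamma>" for F
      proof -
        have "ennreal ((wmod \<alpha> G \<gamma>)\<^sup>2) \<le> ennreal (2 * E * \<eta>\<^sup>2 * exp (- \<kappa> * (cmod (\<gamma> - a))\<^sup>2))
            + ennreal (1200 * E * \<tau> / \<alpha>\<^sup>2) * 
              (\<integral>\<^sup>+z. ennreal ((u z)\<^sup>2) * ennreal (exp (- (\<tau> / 4) * (cmod (z - a))\<^sup>2)) * indicator (cball (p \<gamma>) 1) z \<partial>lborel)" 
            (is "_ \<le> _ + ?c * ?I \<gamma>")
          if \<gamma>: "\<gamma> \<in> F" for \<gamma>
        proof -
          define g where "g = exp (- \<tau> * (cmod (p \<gamma> - a))\<^sup>2)"
          have "ennreal ((wmod \<alpha> G \<gamma>)\<^sup>2) = ennreal ((u (p \<gamma>))\<^sup>2) * ennreal g"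
            unfolding G2 g_def by (simp add: ennreal_mult)
          also have "\<dots> \<le> (ennreal (2 * exp \<beta> * (u \<gamma>)\<^sup>2) 
              + ennreal (200 * exp \<beta> * (cmod (p \<gamma> - \<gamma>))\<^sup>2) * local_mass \<beta> f (p \<gamma>)) * ennreal g"
            unfolding u_def by (intro mult_right_mono wmod_variation f \<beta>) auto
          also have "\<dots> = ennreal (2 * exp \<beta> * (u \<gamma>)\<^sup>2 * g) + ennreal (200 * exp \<beta> * (cmod (p \<gamma> - \<gamma>))\<^sup>2 * g) * local_mass \<beta> f (p \<gamma>)"
          proof -
            have e: "ennreal (x * g) = ennreal x * ennreal g" for x
              unfolding g_def by (rule ennreal_mult'') simp
            show ?thesis unfolding e distrib_right by (simp only: mult_ac)
          qed
          also have "\<dots> \<le> ennreal (2 * E * \<eta>\<^sup>2 * exp (- \<kappa> * (cmod (\<gamma> - a))\<^sup>2)) + ?c * ?I \<gamma>"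
          proof (rule add_mono)
            have "(u \<gamma>)\<^sup>2 \<le> \<eta>\<^sup>2" using \<eta>(2)[of \<gamma>] F \<gamma> u0 by (intro power_mono) (auto simp: u_def)
            then have "2 * exp \<beta> * (u \<gamma>)\<^sup>2 * g \<le> 2 * E * \<eta>\<^sup>2 * g"
              using \<beta>(3) E by (intro mult_right_mono mult_mono) (auto simp: g_def)
            then show "ennreal (2 * exp \<beta> * (u \<gamma>)\<^sup>2 * g) \<le> ennreal (2 * E * \<eta>\<^sup>2 * exp (- \<kappa> * (cmod (\<gamma> - a))\<^sup>2))"
              unfolding g_def using \<kappa>p[of \<gamma>] by (intro ennreal_leI) simp
            define h where "h = exp (- (\<tau> / 2) * (cmod (p \<gamma> - a))\<^sup>2)"
            have "200 * exp \<beta> * ((cmod (p \<gamma> - \<gamma>))\<^sup>2 * g) \<le> 200 * E * (2 * \<tau> / \<alpha>\<^sup>2 * h)"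
              unfolding p\<gamma> g_def h_def
              by (intro mult_mono dilation_displacement \<alpha> \<tau> s0 s2) (use \<beta>(3) E in auto)
            then have 1: "200 * exp \<beta> * (cmod (p \<gamma> - \<gamma>))\<^sup>2 * g \<le> 400 * E * \<tau> / \<alpha>\<^sup>2 * h"
              by (simp add: mult_ac)
            have 2: "ennreal h * local_mass \<beta> f (p \<gamma>) \<le> ennreal 3 * ?I \<gamma>"
            proof -
              have [measurable]: "cball (p \<gamma>) 1 \<in> sets borel" by simp
              have "ennreal h * local_mass \<beta> f (p \<gamma>) = (\<integral>\<^sup>+z. ennreal h * (ennreal ((u z)\<^sup>2) * indicator (cball (p \<gamma>) 1) z) \<partial>lborel)"
                unfolding local_mass_def u_def[symmetric] by (rule nn_integral_cmult[symmetric]) measurable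
              also have "\<dots> \<le> (\<integral>\<^sup>+z. ennreal 3 * (ennreal ((u z)\<^sup>2) * ennreal (exp (- (\<tau> / 4) * (cmod (z - a))\<^sup>2)) * indicator (cball (p \<gamma>) 1) z) \<partial>lborel)"
              proof (rule nn_integral_mono)
                fix z
                show "ennreal h * (ennreal ((u z)\<^sup>2) * indicator (cball (p \<gamma>) 1) z)
                  \<le> ennreal 3 * (ennreal ((u z)\<^sup>2) * ennreal (exp (- (\<tau> / 4) * (cmod (z - a))\<^sup>2)) * indicator (cball (p \<gamma>) 1) z)"
                proof (cases "z \<in> cball (p \<gamma>) 1")
                  case True
                  then have "cmod (z - a) \<le> cmod (p \<gamma> - a) + 1"
                    using norm_triangle_ineq[of "z - p \<gamma>" "p \<gamma> - a"] by (simp add: dist_norm norm_minus_commute)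
                  then have "(cmod (z - a))\<^sup>2 \<le> (cmod (p \<gamma> - a) + 1)\<^sup>2"
                    by (intro power_mono) auto
                  also have "\<dots> \<le> 2 * (cmod (p \<gamma> - a))\<^sup>2 + 2"
                    using sum_squares_bound[of "cmod (p \<gamma> - a)" 1] by (simp add: power2_eq_square algebra_simps)
                  finally have "\<tau> / 4 * (cmod (z - a))\<^sup>2 \<le> \<tau> / 4 * (2 * (cmod (p \<gamma> - a))\<^sup>2 + 2)"
                    using \<tau> by (intro mult_left_mono) auto
                  then have "h \<le> exp (\<tau> + - (\<tau> / 4) * (cmod (z - a))\<^sup>2)"
                    unfolding h_def using \<tau> by (simp add: algebra_simps)
                  also have "\<dots> \<le> 3 * exp (- (\<tau> / 4) * (cmod (z - a))\<^sup>2)"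
                    unfolding exp_add using e\<tau> by (intro mult_right_mono) auto
                  finally have "h * (u z)\<^sup>2 \<le> 3 * exp (- (\<tau> / 4) * (cmod (z - a))\<^sup>2) * (u z)\<^sup>2"
                    by (rule mult_right_mono) simp
                  then have "ennreal (h * (u z)\<^sup>2) \<le> ennreal (3 * ((u z)\<^sup>2 * exp (- (\<tau> / 4) * (cmod (z - a))\<^sup>2)))"
                    by (intro ennreal_leI) (simp add: mult_ac)
                  then show ?thesis using True by (simp add: ennreal_mult h_def)
                qed simp
              qed
              also have "\<dots> = ennreal 3 * ?I \<gamma>"
                by (rule nn_integral_cmult) measurable
              finally show ?thesis .
            qed
            have "ennreal (200 * exp \<beta> * (cmod (p \<gamma> - \<gamma>))\<^sup>2 * g) * local_mass \<beta> f (p \<gamma>)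
              \<le> ennreal (400 * E * \<tau> / \<alpha>\<^sup>2) * (ennreal h * local_mass \<beta> f (p \<gamma>))"
              unfolding mult.assoc[symmetric] using 1 E \<tau>
              by (intro mult_right_mono) (auto simp: ennreal_mult[symmetric] h_def intro!: ennreal_leI)
            also have "\<dots> \<le> ennreal (400 * E * \<tau> / \<alpha>\<^sup>2) * (ennreal 3 * ?I \<gamma>)"
              by (intro mult_left_mono 2) auto
            also have "\<dots> = ?c * ?I \<gamma>"
            proof -
              have "ennreal (400 * E * \<tau> / \<alpha>\<^sup>2) * ennreal 3 = ?c"
                using E \<tau> by (subst ennreal_mult[symmetric]) auto
              then show ?thesis by (simp only: mult.assoc[symmetric])
            qed
            finally show "ennreal (200 * exp \<beta> * (cmod (p \<gamma> - \<gamma>))\<^sup>2 * g) * local_mass \<beta> f (p \<gamma>) \<le> ?c * ?I \<gamma>" .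
          qed
          finally show ?thesis .
        qed
        then have "(\<Sum>\<gamma>\<in>F. ennreal ((wmod \<alpha> G \<gamma>)\<^sup>2)) 
            \<le> (\<Sum>\<gamma>\<in>F. ennreal (2 * E * \<eta>\<^sup>2 * exp (- \<kappa> * (cmod (\<gamma> - a))\<^sup>2)) + ?c * ?I \<gamma>)"
          by (rule sum_mono)
        also have "\<dots> = (\<Sum>\<gamma>\<in>F. ennreal (2 * E * \<eta>\<^sup>2 * exp (- \<kappa> * (cmod (\<gamma> - a))\<^sup>2))) + ?c * (\<Sum>\<gamma>\<in>F. ?I \<gamma>)"
          by (simp add: sum.distrib sum_distrib_left)
        also have "\<dots> \<le> ennreal (2 * E * C * \<eta>\<^sup>2) + ennreal (D * \<tau>) * S"
        proof (rule add_mono)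
          have "(\<Sum>\<gamma>\<in>F. ennreal (2 * E * \<eta>\<^sup>2 * exp (- \<kappa> * (cmod (\<gamma> - a))\<^sup>2))) 
            = ennreal (2 * E * \<eta>\<^sup>2 * (\<Sum>\<gamma>\<in>F. exp (- \<kappa> * (cmod (\<gamma> - a))\<^sup>2)))"
            using E by (subst sum_ennreal) (auto simp: sum_distrib_left)
          also have "\<dots> \<le> ennreal (2 * E * \<eta>\<^sup>2 * C)"
            using E by (intro ennreal_leI mult_left_mono C(2) F) auto
          finally show "(\<Sum>\<gamma>\<in>F. ennreal (2 * E * \<eta>\<^sup>2 * exp (- \<kappa> * (cmod (\<gamma> - a))\<^sup>2))) \<le> ennreal (2 * E * C * \<eta>\<^sup>2)"
            by (simp add: mult_ac)
          have "(\<Sum>\<gamma>\<in>F. ?I \<gamma>) \<le> of_nat m * N (\<tau> / 4) a"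
            unfolding N_def
          proof (rule sum_ball_integrals_le[OF F(1)])
            fix z
            have "{\<gamma> \<in> F. dist (p \<gamma>) z \<le> 1} \<subseteq> \<Gamma> \<inter> cball (a + (1 / s) *\<^sub>R (z - a)) 2"
            proof
              fix \<gamma> assume "\<gamma> \<in> {\<gamma> \<in> F. dist (p \<gamma>) z \<le> 1}"
              then have \<gamma>: "\<gamma> \<in> F" "dist (p \<gamma>) z \<le> 1" by auto
              have "a + (1 / s) *\<^sub>R (z - a) - \<gamma> = (1 / s) *\<^sub>R (z - p \<gamma>)"
                using s0 by (simp add: p_def algebra_simps)
              then have "dist (a + (1 / s) *\<^sub>R (z - a)) \<gamma> = 1 / s * dist (p \<gamma>) z"
                using s0 by (simp add: dist_norm norm_minus_commute)
              also have "\<dots> \<le> 2 * 1"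
                using \<gamma>(2) s0 s_half by (intro mult_mono) (auto simp: field_simps)
              finally show "\<gamma> \<in> \<Gamma> \<inter> cball (a + (1 / s) *\<^sub>R (z - a)) 2"
                using F \<gamma>(1) by auto
            qed
            then show "card {\<gamma> \<in> F. dist (p \<gamma>) z \<le> 1} \<le> m"
              by (intro order_trans[OF card_mono[OF m(1)] m(2)])
          qed measurable
          also have "\<dots> \<le> of_nat m * (4 * S)"
            by (intro mult_left_mono widen) auto
          finally have "?c * (\<Sum>\<gamma>\<in>F. ?I \<gamma>) \<le> ?c * (of_nat m * (4 * S))"
            by (rule mult_left_mono) simp
          also have "\<dots> = ennreal (1200 * E * \<tau> / \<alpha>\<^sup>2 * (real m * 4)) * S"
            using E \<tau> by (simp add: ennreal_mult ennreal_of_nat_eq_real_of_nat mult.assoc del: times_divide_eq_right times_divide_eq_left)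
          also have "\<dots> \<le> ennreal (D * \<tau>) * S"
            using E \<tau> \<alpha> by (intro mult_right_mono ennreal_leI) (auto simp: D_def field_simps)
          finally show "?c * (\<Sum>\<gamma>\<in>F. ?I \<gamma>) \<le> ennreal (D * \<tau>) * S" .
        qed
        finally show ?thesis .
      qed
      have "ennreal (s\<^sup>2) \<le> 1" using s0 s1 by (simp add: power_le_one)
      then have "N \<tau> a \<le> 1 * (\<integral>\<^sup>+z. ennreal ((wmod \<alpha> G z)\<^sup>2) \<partial>lborel)"
        unfolding NG by (intro mult_right_mono) auto
      then have "ennreal c * N \<tau> a \<le> ennreal c * (\<integral>\<^sup>+z. ennreal ((wmod \<alpha> G z)\<^sup>2) \<partial>lborel)"
        by (intro mult_left_mono) auto
      also have "\<dots> \<le> ennreal (2 * E * C * \<eta>\<^sup>2) + ennreal (D * \<tau>) * S"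
        by (rule lower[OF G(1) Gfin bound])
      finally show ?thesis .
    qed
    obtain S' where S': "S = ennreal S'" "S' \<ge> 0" using S_fin by (cases S) auto
    have "ennreal c * S = (SUP b. ennreal c * N \<tau> b)"
      unfolding S_def by (rule SUP_mult_left_ennreal)
    also have "\<dots> \<le> ennreal (2 * E * C * \<eta>\<^sup>2) + ennreal (D * \<tau>) * S"
      by (intro SUP_least key)
    finally have "ennreal (c * S') \<le> ennreal (2 * E * C * \<eta>\<^sup>2 + D * \<tau> * S')"
      using S' c E C(1) D \<tau> by (simp add: ennreal_mult[symmetric] ennreal_plus[symmetric] del: ennreal_plus)
    then have "c * S' \<le> 2 * E * C * \<eta>\<^sup>2 + D * \<tau> * S'"
      using S' E C(1) D \<tau> by (subst (asm) ennreal_le_iff) auto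
    also have "\<dots> \<le> 2 * E * C * \<eta>\<^sup>2 + c / 2 * S'"
      using D\<tau> S' by (intro add_left_mono mult_right_mono) auto
    finally have S'le: "S' \<le> 4 * E * C * \<eta>\<^sup>2 / c"
      using c by (simp add: field_simps)
    have "ennreal ((u z)\<^sup>2) \<le> ennreal (exp \<beta> / pi) * local_mass \<beta> f z"
      unfolding u_def by (rule wmod_le_local_mass[OF f \<beta>(2)])
    also have "local_mass \<beta> f z \<le> (\<integral>\<^sup>+w. ennreal 3 * (ennreal ((u w)\<^sup>2) * ennreal (exp (- \<tau> * (cmod (w - z))\<^sup>2))) \<partial>lborel)"
      unfolding local_mass_def u_def[symmetric]
    proof (rule nn_integral_mono)
      fix w
      show "ennreal ((u w)\<^sup>2) * indicator (cball z 1) w \<le> ennreal 3 * (ennreal ((u w)\<^sup>2) * ennreal (exp (- \<tau> * (cmod (w - z))\<^sup>2)))"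
      proof (cases "w \<in> cball z 1")
        case True
        then have "cmod (w - z) \<le> 1" by (simp add: dist_norm norm_minus_commute)
        then have "\<tau> * (cmod (w - z))\<^sup>2 \<le> \<tau>"
          using \<tau> by (simp add: mult_left_le power_le_one)
        then have "exp \<tau> * exp (- \<tau> * (cmod (w - z))\<^sup>2) \<ge> 1"
          by (simp add: exp_add[symmetric])
        moreover have "exp \<tau> * exp (- \<tau> * (cmod (w - z))\<^sup>2) \<le> 3 * exp (- \<tau> * (cmod (w - z))\<^sup>2)"
          using e\<tau> by (intro mult_right_mono) auto
        ultimately have "1 \<le> 3 * exp (- \<tau> * (cmod (w - z))\<^sup>2)"
          by linarith
        then have "1 * (u w)\<^sup>2 \<le> (3 * exp (- \<tau> * (cmod (w - z))\<^sup>2)) * (u w)\<^sup>2"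
          by (intro mult_right_mono) auto
        then have "ennreal ((u w)\<^sup>2) \<le> ennreal (3 * ((u w)\<^sup>2 * exp (- \<tau> * (cmod (w - z))\<^sup>2)))"
          by (intro ennreal_leI) (simp add: mult_ac)
        then show ?thesis using True by (simp add: ennreal_mult)
      qed simp
    qed
    also have "\<dots> = ennreal 3 * N \<tau> z"
      unfolding N_def by (rule nn_integral_cmult) measurable
    also have "N \<tau> z \<le> S" unfolding S_def by (rule SUP_upper) simp
    also have "ennreal (exp \<beta> / pi) * (ennreal 3 * S) = ennreal (exp \<beta> / pi * 3 * S')"
      using S' by (simp add: ennreal_mult[symmetric] del: ennreal_numeral)
    finally have "ennreal ((u z)\<^sup>2) \<le> ennreal (exp \<beta> / pi * 3 * S')"
      by (simp add: mult_left_mono)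
    then have "(u z)\<^sup>2 \<le> exp \<beta> / pi * 3 * S'"
      using S' by (subst (asm) ennreal_le_iff) auto
    also have "\<dots> \<le> E * 3 * (4 * E * C * \<eta>\<^sup>2 / c)"
    proof (intro mult_mono S'le)
      have "exp \<beta> / pi \<le> exp \<beta> / 1" using pi_gt3 by (intro divide_left_mono) auto
      then show "exp \<beta> / pi \<le> E" using \<beta>(3) by simp
    qed (use E S' in auto)
    also have "\<dots> = (K * \<eta>)\<^sup>2"
    proof -
      have "K\<^sup>2 = 12 * E\<^sup>2 * C / c" using E C(1) c by (simp add: K_def)
      then show ?thesis unfolding power_mult_distrib by (simp add: power2_eq_square[of E])
    qed
    finally have "u z \<le> K * \<eta>"
      by (rule power2_le_imp_le) (use K0 \<eta> in simp)
    then show ?thesis by (simp add: u_def)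
  qed
  then have "sup_sampling \<beta> \<Gamma> K" unfolding sup_sampling_def by blast
  then show ?thesis using \<beta>(1) K0 by blast
qed

text \<open>
  Every point of \<open>\<Gamma>\<close> lies within \<open>\<delta>\<close> of a maximal \<open>\<delta>\<close>-separated subset. So a sample at \<open>\<Gamma>\<close> is at
  most a constant times a sample at the subset plus a constant times \<open>\<delta> sup u\<close>, and the last term is absorbed for
  small \<open>\<delta>\<close>.
\<close>

lemma sup_sampling_separated_subset:
  assumes \<beta>: "\<beta> \<ge> 0" and K: "K > 0" and ss: "sup_sampling \<beta> \<Gamma> K"
  obtains \<Gamma>' K' where "\<Gamma>' \<subseteq> \<Gamma>" "uniform_discrete \<Gamma>'" "K' > 0" "sup_sampling \<beta> \<Gamma>' K'"
proof -
  define q where "q = K\<^sup>2 * (200 * pi * exp \<beta>)"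
  have q: "q > 0" using K by (simp add: q_def)
  define \<delta> where "\<delta> = sqrt (1 / (2 * q))"
  have \<delta>: "\<delta> > 0" "q * \<delta>\<^sup>2 = 1 / 2" using q by (auto simp: \<delta>_def)
  obtain \<Gamma>' where \<Gamma>': "\<Gamma>' \<subseteq> \<Gamma>" "\<And>x y. x \<in> \<Gamma>' \<Longrightarrow> y \<in> \<Gamma>' \<Longrightarrow> x \<noteq> y \<Longrightarrow> \<delta> \<le> dist x y"
    "\<And>x. x \<in> \<Gamma> \<Longrightarrow> \<exists>y\<in>\<Gamma>'. dist x y < \<delta>"
    using maximal_separated_subset[OF \<delta>(1), of \<Gamma>] by blast
  define K' where "K' = sqrt (4 * K\<^sup>2 * exp \<beta>)"
  have K': "K' > 0" using K by (simp add: K'_def)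
  have "wmod \<beta> f z \<le> K' * \<eta>" 
    if f: "f holomorphic_on UNIV" and M: "\<And>z. wmod \<beta> f z \<le> M" and \<eta>: "0 \<le> \<eta>" "\<And>\<gamma>. \<gamma> \<in> \<Gamma>' \<Longrightarrow> wmod \<beta> f \<gamma> \<le> \<eta>" 
    for f M \<eta> z
  proof -
    define M0 where "M0 = (SUP z. wmod \<beta> f z)"
    have bdd: "bdd_above (range (wmod \<beta> f))" using M by (intro bdd_aboveI[of _ M]) auto
    have le: "wmod \<beta> f z \<le> M0" for z unfolding M0_def using bdd by (intro cSUP_upper) auto
    have M0: "M0 \<ge> 0" using le[of 0] wmod_nonneg[of \<beta> f 0] by linarith
    define \<eta>' where "\<eta>' = sqrt (2 * exp \<beta> * \<eta>\<^sup>2 + 200 * pi * exp \<beta> * \<delta>\<^sup>2 * M0\<^sup>2)"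
    have \<eta>'2: "\<eta>'\<^sup>2 = 2 * exp \<beta> * \<eta>\<^sup>2 + 200 * pi * exp \<beta> * \<delta>\<^sup>2 * M0\<^sup>2" and \<eta>'0: "\<eta>' \<ge> 0"
      by (auto simp: \<eta>'_def)
    have "wmod \<beta> f \<gamma> \<le> \<eta>'" if \<gamma>: "\<gamma> \<in> \<Gamma>" for \<gamma>
    proof -
      obtain g where g: "g \<in> \<Gamma>'" "dist \<gamma> g < \<delta>" using \<Gamma>'(3)[OF \<gamma>] by blast
      have "(wmod \<beta> f \<gamma>)\<^sup>2 \<le> 2 * exp \<beta> * (wmod \<beta> f g)\<^sup>2 + 200 * pi * exp \<beta> * (cmod (\<gamma> - g))\<^sup>2 * M0\<^sup>2"
        by (rule wmod_variation_bounded[OF f \<beta> le])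
      also have "\<dots> \<le> 2 * exp \<beta> * \<eta>\<^sup>2 + 200 * pi * exp \<beta> * \<delta>\<^sup>2 * M0\<^sup>2"
        using \<eta>(2)[OF g(1)] g(2) by (intro add_mono mult_left_mono mult_right_mono power_mono) (auto simp: dist_norm)
      finally show ?thesis unfolding \<eta>'2[symmetric] using \<eta>'0 by (rule power2_le_imp_le)
    qed
    then have "wmod \<beta> f z \<le> K * \<eta>'" for z
      using sup_samplingD[OF ss f le \<eta>'0] by blast
    then have "M0 \<le> K * \<eta>'" unfolding M0_def by (intro cSUP_least) auto
    then have "M0\<^sup>2 \<le> (K * \<eta>')\<^sup>2" using M0 by (intro power_mono) auto
    also have "\<dots> = 2 * K\<^sup>2 * exp \<beta> * \<eta>\<^sup>2 + (q * \<delta>\<^sup>2) * M0\<^sup>2"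
      by (simp add: power_mult_distrib \<eta>'2 q_def algebra_simps)
    finally have "M0\<^sup>2 \<le> (K' * \<eta>)\<^sup>2"
      by (simp add: \<delta>(2) K'_def power_mult_distrib)
    then have "M0 \<le> K' * \<eta>" by (rule power2_le_imp_le) (use K' \<eta> in simp)
    then show ?thesis using le[of z] by linarith
  qed
  then have "sup_sampling \<beta> \<Gamma>' K'" unfolding sup_sampling_def by blast
  moreover have "uniform_discrete \<Gamma>'" using \<Gamma>'(2) \<delta>(1) by (intro uniformI2) auto
  ultimately show ?thesis using that \<Gamma>'(1) K' by blast
qed

section \<open>Uniform sampling forces many points into every large disc\<close>

text \<open>
  A polynomial of degree \<open>N\<close> grows at most like the \<open>N\<close>-th power of the distance from \<open>a\<close>: apply the maximum
  principle to the reversed polynomial \<open>q\<close>, for which the outside of the disc becomes a disc.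
\<close>

lemma polynomial_growth_outside_disc:
  fixes A :: "complex set" and a :: complex
  assumes A: "finite A" and \<rho>: "0 < \<rho>" "\<rho> \<le> cmod (z - a)"
  obtains \<zeta> where "cmod (\<zeta> - a) = \<rho>"
    "cmod (\<Prod>\<gamma>\<in>A. z - \<gamma>) * \<rho> ^ card A \<le> cmod (\<Prod>\<gamma>\<in>A. \<zeta> - \<gamma>) * cmod (z - a) ^ card A"
proof -
  define q where "q = (\<lambda>w. \<Prod>\<gamma>\<in>A. 1 - w * (\<gamma> - a))"
  have q: "cmod (\<Prod>\<gamma>\<in>A. x - \<gamma>) = cmod (x - a) ^ card A * cmod (q (1 / (x - a)))" if "x \<noteq> a" for x
  proof -
    have "(\<Prod>\<gamma>\<in>A. x - \<gamma>) = (\<Prod>\<gamma>\<in>A. (x - a) * (1 - 1 / (x - a) * (\<gamma> - a)))"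
      using that by (intro prod.cong) (auto simp: field_simps)
    then show ?thesis
      by (simp add: q_def prod.distrib norm_mult norm_power)
  qed
  have hol: "q holomorphic_on X" for X unfolding q_def by (intro holomorphic_intros)
  have cont: "continuous_on X q" for X using hol by (rule holomorphic_on_imp_continuous_on)
  have "compact (sphere (0::complex) (1 / \<rho>))" "sphere (0::complex) (1 / \<rho>) \<noteq> {}"
    using \<rho> by auto
  then obtain w where w: "w \<in> sphere 0 (1 / \<rho>)" "\<And>x. x \<in> sphere 0 (1 / \<rho>) \<Longrightarrow> cmod (q x) \<le> cmod (q w)"
    using continuous_attains_sup[of "sphere (0::complex) (1 / \<rho>)" "\<lambda>x. cmod (q x)"] cont continuous_on_norm by blast
  have zr: "cmod (1 / (z - a)) \<le> 1 / \<rho>"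
    using \<rho> by (simp add: norm_divide frac_le)
  have max: "cmod (q (1 / (z - a))) \<le> cmod (q w)"
  proof (rule maximum_modulus_frontier[where f = q and S = "cball 0 (1 / \<rho>)" and \<xi> = "1 / (z - a)"])
    show "1 / (z - a) \<in> cball 0 (1 / \<rho>)" using zr by simp
  qed (use w \<rho> hol cont in auto)
  define \<zeta> where "\<zeta> = a + 1 / w"
  have w0: "w \<noteq> 0" "cmod w = 1 / \<rho>" using w(1) \<rho> by auto
  have \<zeta>: "cmod (\<zeta> - a) = \<rho>" "\<zeta> \<noteq> a" "1 / (\<zeta> - a) = w"
    using w0 \<rho> by (auto simp: \<zeta>_def norm_divide)
  have z: "z \<noteq> a" using \<rho> by auto
  have "cmod (z - a) ^ card A * \<rho> ^ card A * cmod (q (1 / (z - a))) \<le> cmod (z - a) ^ card A * \<rho> ^ card A * cmod (q w)"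
    using max \<rho> by (intro mult_left_mono) auto
  then have "cmod (\<Prod>\<gamma>\<in>A. z - \<gamma>) * \<rho> ^ card A \<le> cmod (\<Prod>\<gamma>\<in>A. \<zeta> - \<gamma>) * cmod (z - a) ^ card A"
    unfolding q[OF z] q[OF \<zeta>(2)] \<zeta> by (simp add: mult_ac)
  then show ?thesis using that \<zeta>(1) by blast
qed

text \<open>
  Suppose that the disc of radius \<open>R\<close> contains fewer than \<open>b \<rho>\<^sup>2\<close> points, where \<open>\<rho>\<^sup>2 = R\<^sup>2 - c\<close>, and let \<open>p\<close> be the
  polynomial with these zeros. Outside the disc of radius \<open>\<rho>\<close> its growth \<open>(r/\<rho>)^N \<le> exp(b(r\<^sup>2 - \<rho>\<^sup>2)/2)\<close> loses against the
  weight \<open>exp(-\<beta> r\<^sup>2/2)\<close>. So the weighted modulus has its maximum \<open>M\<close> within radius \<open>\<rho>\<close> and is at most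
  \<open>M exp(-(\<beta> - b)c/2)\<close> beyond radius \<open>R\<close>, while it vanishes at the points within: a contradiction for large \<open>c\<close>.
\<close>

lemma sup_sampling_count:
  assumes ss: "sup_sampling \<beta> \<Gamma> K" and K: "K > 0" and b: "0 \<le> b" "b < \<beta>" and ulf: "uniformly_locally_finite \<Gamma>"
  shows "\<exists>c\<ge>0. \<forall>a R. 0 < R \<longrightarrow> c < R\<^sup>2 \<longrightarrow> b * (R\<^sup>2 - c) \<le> real (card (\<Gamma> \<inter> cball a R))"
proof -
  \<comment> \<open>the least gap for which the loss beyond radius \<open>R\<close> beats the sampling constant\<close>
  define c where "c = 2 * ln (2 * K + 1) / (\<beta> - b)"
  have c: "c \<ge> 0" using K b by (simp add: c_def)
  have "- ((\<beta> - b) / 2) * c = - ln (2 * K + 1)"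
    using b by (simp add: c_def)
  then have e: "exp (- ((\<beta> - b) / 2) * c) = 1 / (2 * K + 1)"
    using K by (simp only: exp_minus exp_ln) (simp add: inverse_eq_divide)
  have Kc: "K * exp (- ((\<beta> - b) / 2) * c) \<le> 1 / 2"
    unfolding e using K by (simp add: field_simps)
  have "b * (R\<^sup>2 - c) \<le> real (card (\<Gamma> \<inter> cball a R))" if R: "0 < R" "c < R\<^sup>2" for a R
  proof (rule ccontr)
    assume neg: "\<not> ?thesis"
    define A where "A = \<Gamma> \<inter> cball a R"
    have A: "finite A" unfolding A_def by (rule uniformly_locally_finite_finite[OF ulf])
    define \<rho> where "\<rho> = sqrt (R\<^sup>2 - c)"
    have \<rho>: "\<rho> > 0" "\<rho>\<^sup>2 = R\<^sup>2 - c" using R by (auto simp: \<rho>_def)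
    have N: "real (card A) \<le> b * \<rho>\<^sup>2" using neg \<rho> by (simp add: A_def)
    define p where "p = (\<lambda>z. \<Prod>\<gamma>\<in>A. z - \<gamma>)"
    have p: "p holomorphic_on UNIV" unfolding p_def by (intro holomorphic_intros)
    obtain f where f: "f holomorphic_on UNIV" "\<And>z. wmod \<beta> f z = cmod (p z) * exp (- (\<beta> / 2) * (cmod (z - a))\<^sup>2)"
      using recenter[OF p, of \<beta> 0 a 1] by (auto simp: wmod_def[of 0])
    have decay: "\<exists>\<zeta>. cmod (\<zeta> - a) = \<rho> \<and> wmod \<beta> f z \<le> wmod \<beta> f \<zeta> * exp (- ((\<beta> - b) / 2) * ((cmod (z - a))\<^sup>2 - \<rho>\<^sup>2))"
      if z: "\<rho> \<le> cmod (z - a)" for z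
    proof -
      define r where "r = cmod (z - a)"
      have r: "r \<ge> \<rho>" "r > 0" using z \<rho> by (auto simp: r_def)
      obtain \<zeta> where \<zeta>: "cmod (\<zeta> - a) = \<rho>" "cmod (p z) * \<rho> ^ card A \<le> cmod (p \<zeta>) * r ^ card A"
        using polynomial_growth_outside_disc[OF A \<rho>(1) z] unfolding p_def r_def by blast
      have "(r / \<rho>) ^ card A = exp (real (card A) * ln (r / \<rho>))"
        using r \<rho> by (simp add: exp_of_nat_mult)
      also have "\<dots> \<le> exp (real (card A) * (((r / \<rho>)\<^sup>2 - 1) / 2))"
      proof -
        have "2 * ln (r / \<rho>) = ln ((r / \<rho>)\<^sup>2)"
          using r \<rho> by (subst ln_realpow) auto
        also have "\<dots> \<le> (r / \<rho>)\<^sup>2 - 1"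
          using r \<rho> by (intro ln_le_minus_one) auto
        finally show ?thesis
          using mult_left_mono[of "2 * ln (r / \<rho>)" "(r / \<rho>)\<^sup>2 - 1" "real (card A)"] by simp
      qed
      also have "\<dots> \<le> exp ((b * \<rho>\<^sup>2) * (((r / \<rho>)\<^sup>2 - 1) / 2))"
      proof -
        have "1 \<le> (r / \<rho>)\<^sup>2" using r \<rho> by (intro one_le_power) simp
        then show ?thesis using N by (simp add: mult_right_mono)
      qed
      also have "(b * \<rho>\<^sup>2) * (((r / \<rho>)\<^sup>2 - 1) / 2) = b / 2 * (r\<^sup>2 - \<rho>\<^sup>2)"
        using \<rho>(1) by (simp add: power_divide field_simps)
      finally have ratio: "(r / \<rho>) ^ card A \<le> exp (b / 2 * (r\<^sup>2 - \<rho>\<^sup>2))" .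
      have "cmod (p z) \<le> cmod (p \<zeta>) * (r / \<rho>) ^ card A"
        using \<zeta>(2) \<rho>(1) by (simp add: power_divide field_simps)
      also have "\<dots> \<le> cmod (p \<zeta>) * exp (b / 2 * (r\<^sup>2 - \<rho>\<^sup>2))"
        by (intro mult_left_mono ratio) auto
      finally have "wmod \<beta> f z \<le> cmod (p \<zeta>) * exp (b / 2 * (r\<^sup>2 - \<rho>\<^sup>2)) * exp (- (\<beta> / 2) * r\<^sup>2)"
        unfolding f r_def by (rule mult_right_mono) simp
      also have "\<dots> = wmod \<beta> f \<zeta> * exp (- ((\<beta> - b) / 2) * (r\<^sup>2 - \<rho>\<^sup>2))"
        unfolding f \<zeta>(1) mult.assoc exp_add[symmetric] by (simp add: field_simps)
      finally show ?thesis using \<zeta>(1) unfolding r_def by blast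
    qed
    have cont: "continuous_on X (wmod \<beta> f)" for X using f(1) by (rule continuous_on_wmod)
    have "\<exists>z0\<in>cball a \<rho>. \<forall>z\<in>cball a \<rho>. wmod \<beta> f z \<le> wmod \<beta> f z0"
      using \<rho>(1) by (intro continuous_attains_sup cont) auto
    then obtain z0 where z0: "\<And>z. z \<in> cball a \<rho> \<Longrightarrow> wmod \<beta> f z \<le> wmod \<beta> f z0" by blast
    define M where "M = wmod \<beta> f z0"
    have M0: "M \<ge> 0" by (simp add: M_def)
    have outer: "wmod \<beta> f z \<le> M * exp (- ((\<beta> - b) / 2) * ((cmod (z - a))\<^sup>2 - \<rho>\<^sup>2))" if z: "\<rho> \<le> cmod (z - a)" for z
    proof -
      obtain \<zeta> where \<zeta>: "cmod (\<zeta> - a) = \<rho>" "wmod \<beta> f z \<le> wmod \<beta> f \<zeta> * exp (- ((\<beta> - b) / 2) * ((cmod (z - a))\<^sup>2 - \<rho>\<^sup>2))"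
        using decay[OF z] by blast
      have "wmod \<beta> f \<zeta> \<le> M" unfolding M_def using \<zeta>(1) by (intro z0) (simp add: dist_norm norm_minus_commute)
      then have "wmod \<beta> f \<zeta> * exp (- ((\<beta> - b) / 2) * ((cmod (z - a))\<^sup>2 - \<rho>\<^sup>2)) \<le> M * exp (- ((\<beta> - b) / 2) * ((cmod (z - a))\<^sup>2 - \<rho>\<^sup>2))"
        by (rule mult_right_mono) simp
      with \<zeta>(2) show ?thesis by linarith
    qed
    have all: "wmod \<beta> f z \<le> M" for z
    proof (cases "cmod (z - a) \<le> \<rho>")
      case True
      then show ?thesis unfolding M_def by (intro z0) (simp add: dist_norm norm_minus_commute)
    next
      case False
      then have "\<rho>\<^sup>2 \<le> (cmod (z - a))\<^sup>2" using \<rho>(1) by (intro power_mono) auto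
      then have "exp (- ((\<beta> - b) / 2) * ((cmod (z - a))\<^sup>2 - \<rho>\<^sup>2)) \<le> 1"
        using b by simp
      then have "M * exp (- ((\<beta> - b) / 2) * ((cmod (z - a))\<^sup>2 - \<rho>\<^sup>2)) \<le> M"
        by (rule mult_left_le[OF _ M0])
      then show ?thesis using outer[of z] False by linarith
    qed
    define \<eta> where "\<eta> = M * exp (- ((\<beta> - b) / 2) * c)"
    have \<eta>0: "\<eta> \<ge> 0" using M0 by (simp add: \<eta>_def)
    have on\<Gamma>: "wmod \<beta> f \<gamma> \<le> \<eta>" if \<gamma>: "\<gamma> \<in> \<Gamma>" for \<gamma>
    proof (cases "cmod (\<gamma> - a) \<le> R")
      case True
      then have "\<gamma> \<in> A" using \<gamma> by (simp add: A_def dist_norm norm_minus_commute)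
      then have "p \<gamma> = 0" unfolding p_def using A by (simp add: prod_zero_iff)
      then show ?thesis using \<eta>0 by (simp add: f)
    next
      case False
      then have R2: "R\<^sup>2 \<le> (cmod (\<gamma> - a))\<^sup>2" using R by (intro power_mono) auto
      have "\<rho>\<^sup>2 \<le> (cmod (\<gamma> - a))\<^sup>2" using R2 \<rho>(2) c by linarith
      then have "\<rho> \<le> cmod (\<gamma> - a)" by (rule power2_le_imp_le) simp
      then have "wmod \<beta> f \<gamma> \<le> M * exp (- ((\<beta> - b) / 2) * ((cmod (\<gamma> - a))\<^sup>2 - \<rho>\<^sup>2))"
        by (rule outer)
      also have "\<dots> \<le> \<eta>"
        unfolding \<eta>_def using M0 b R2 \<rho>(2)
        by (intro mult_left_mono) (auto simp: mult_left_mono)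
      finally show ?thesis .
    qed
    have "M \<le> K * \<eta>"
      unfolding M_def by (rule sup_samplingD[OF ss f(1) all \<eta>0 on\<Gamma>])
    also have "\<dots> = (K * exp (- ((\<beta> - b) / 2) * c)) * M" by (simp add: \<eta>_def)
    also have "\<dots> \<le> 1 / 2 * M" using Kc M0 by (rule mult_right_mono)
    finally have "M = 0" using M0 by simp
    then have "p z = 0" for z using all[of z] by (simp add: f mult_le_0_iff)
    moreover obtain z where "z \<notin> A" using A ex_new_if_finite infinite_UNIV_char_0 by blast
    ultimately show False unfolding p_def using A by (auto simp: prod_zero_iff)
  qed
  then show ?thesis using c by blast
qed

section \<open>Averaging counts over translates\<close>

text \<open>
  Integrate the number of points in \<open>a + S\<close> over \<open>a\<close> in \<open>T\<close>. Each point of \<open>\<Gamma>\<close> is counted for a set of \<open>a\<close> of measure at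
  most that of \<open>S\<close>, and only points of \<open>U\<close> are counted.
\<close>

lemma count_averaging:
  fixes S T U \<Gamma> :: "complex set"
  assumes S: "S \<in> sets borel" and T: "T \<in> sets borel" and fin: "finite (\<Gamma> \<inter> U)"
    and sub: "\<And>a. a \<in> T \<Longrightarrow> (\<lambda>s. a + s) ` S \<subseteq> U"
    and m: "\<And>a. a \<in> T \<Longrightarrow> m \<le> real (card (\<Gamma> \<inter> (\<lambda>s. a + s) ` S))"
  shows "ennreal m * emeasure lborel T \<le> emeasure lborel S * ennreal (real (card (\<Gamma> \<inter> U)))"
proof -
  note [measurable] = S T
  have refl: "(\<integral>\<^sup>+a. indicator S (\<gamma> - a) \<partial>lborel) = emeasure lborel S" for \<gamma>
  proof -
    have "(\<integral>\<^sup>+a. indicator S a \<partial>lborel) = ennreal ((-1)\<^sup>2) * (\<integral>\<^sup>+a. indicator S (\<gamma> + (-1) *\<^sub>R a) \<partial>lborel)"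
      by (rule nn_integral_complex_affine) auto
    then show ?thesis using S by simp
  qed
  have "ennreal m * emeasure lborel T = (\<integral>\<^sup>+a. ennreal m * indicator T a \<partial>lborel)"
    by (simp add: nn_integral_cmult_indicator)
  also have "\<dots> \<le> (\<integral>\<^sup>+a. (\<Sum>\<gamma>\<in>\<Gamma> \<inter> U. indicator S (\<gamma> - a)) \<partial>lborel)"
  proof (rule nn_integral_mono)
    fix a
    show "ennreal m * indicator T a \<le> (\<Sum>\<gamma>\<in>\<Gamma> \<inter> U. indicator S (\<gamma> - a) :: ennreal)"
    proof (cases "a \<in> T")
      case True
      have "(\<Sum>\<gamma>\<in>\<Gamma> \<inter> U. indicator S (\<gamma> - a) :: ennreal) = of_nat (card ((\<Gamma> \<inter> U) \<inter> {\<gamma>. \<gamma> - a \<in> S}))"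
        using fin by (simp add: indicator_def sum.If_cases)
      also have "(\<Gamma> \<inter> U) \<inter> {\<gamma>. \<gamma> - a \<in> S} = \<Gamma> \<inter> (\<lambda>s. a + s) ` S"
      proof -
        have "(\<lambda>s. a + s) ` S = {\<gamma>. \<gamma> - a \<in> S}"
          by (auto simp: image_iff) (metis add.commute diff_add_cancel)
        then show ?thesis using sub[OF True] by blast
      qed
      finally show ?thesis
        using m[OF True] True by (simp add: ennreal_of_nat_eq_real_of_nat ennreal_leI)
    qed simp
  qed
  also have "\<dots> = (\<Sum>\<gamma>\<in>\<Gamma> \<inter> U. \<integral>\<^sup>+a. indicator S (\<gamma> - a) \<partial>lborel)"
    by (rule nn_integral_sum) measurable
  also have "\<dots> = emeasure lborel S * ennreal (real (card (\<Gamma> \<inter> U)))"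
    by (simp add: refl ennreal_of_nat_eq_real_of_nat mult.commute)
  finally show ?thesis .
qed

lemma lower_count_attained:
  obtains a where "lower_count I \<Gamma> r = card (\<Gamma> \<inter> (\<lambda>w. a + r *\<^sub>R w) ` I)"
proof -
  have "lower_count I \<Gamma> r \<in> range (\<lambda>a. card (\<Gamma> \<inter> (\<lambda>w. a + r *\<^sub>R w) ` I))"
    unfolding lower_count_def by (rule Inf_nat_def1) simp
  then show ?thesis using that by blast
qed

lemma lower_count_le: "lower_count I \<Gamma> r \<le> card (\<Gamma> \<inter> (\<lambda>w. a + r *\<^sub>R w) ` I)"
  unfolding lower_count_def by (rule cINF_lower) auto

text \<open>
  Average the discs of radius \<open>R\<close> over the part \<open>T\<close> of a large copy of \<open>I\<close> that has distance at least \<open>R\<close> from the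
  complement. Relative to the copy, \<open>T\<close> exhausts the interior of \<open>I\<close>, which has full measure since the
  frontier is a null set.
\<close>

lemma lower_density_ge_if_disc_counts:
  fixes I \<Gamma> :: "complex set"
  assumes I: "compact I" "emeasure lborel I = 1" "emeasure lborel (frontier I) = 0"
    and ulf: "uniformly_locally_finite \<Gamma>" and R: "R > 0" and d: "0 \<le> d'" "d' < d"
    and count: "\<And>a. d * (pi * R\<^sup>2) \<le> real (card (\<Gamma> \<inter> cball a R))"
  shows "ereal d' \<le> lower_density I \<Gamma>"
proof -
  define J where "J = (\<lambda>n::nat. {x. cball x (1 / (n + 1)) \<subseteq> I})"
  have clI: "closed I" using I(1) by (rule compact_imp_closed)
  have J_eq: "J n = (\<Inter>h\<in>cball 0 (1 / (n + 1)). (\<lambda>x. x + h) -` I)" for n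
  proof -
    have "cball x (1 / (real n + 1)) \<subseteq> I \<longleftrightarrow> (\<forall>h\<in>cball 0 (1 / (real n + 1)). x + h \<in> I)" for x
    proof safe
      fix h :: complex assume "cball x (1 / (real n + 1)) \<subseteq> I" "h \<in> cball 0 (1 / (real n + 1))"
      moreover from this have "x + h \<in> cball x (1 / (real n + 1))" by (simp add: dist_norm)
      ultimately show "x + h \<in> I" by blast
    next
      fix y assume *: "\<forall>h\<in>cball 0 (1 / (real n + 1)). x + h \<in> I" "y \<in> cball x (1 / (real n + 1))"
      then have "y - x \<in> cball 0 (1 / (real n + 1))" by (simp add: dist_norm norm_minus_commute)
      then have "x + (y - x) \<in> I" using *(1) by blast
      then show "y \<in> I" by simp
    qed
    then show ?thesis
      unfolding J_def by (intro set_eqI) (simp only: mem_Collect_eq INT_iff vimage_eq)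
  qed
  have J_closed: "closed (J n)" for n
    unfolding J_eq by (intro closed_INT ballI closed_vimage clI continuous_intros)
  then have J_meas: "J n \<in> sets borel" for n by simp
  have inc: "incseq J"
  proof (rule incseq_SucI)
    fix n
    have "cball x (1 / (Suc n + 1)) \<subseteq> cball x (1 / (n + 1))" for x :: complex
      by (intro subset_cball) (simp add: field_simps)
    then show "J n \<subseteq> J (Suc n)" unfolding J_def by fastforce
  qed
  have UJ: "(\<Union>n. J n) = interior I"
  proof (intro equalityI subsetI)
    fix x assume "x \<in> (\<Union>n. J n)"
    then obtain n where "cball x (1 / (real n + 1)) \<subseteq> I" by (auto simp: J_def)
    then have "ball x (1 / (real n + 1)) \<subseteq> I" using ball_subset_cball by blast
    then show "x \<in> interior I"
      by (intro interiorI[of "ball x (1 / (real n + 1))"]) auto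
  next
    fix x assume "x \<in> interior I"
    then obtain e where e: "e > 0" "cball x e \<subseteq> I"
      using mem_interior_cball by blast
    obtain n where "1 / (real n + 1) < e"
      using reals_Archimedean[OF e(1)] by (auto simp: inverse_eq_divide add.commute)
    then have "cball x (1 / (real n + 1)) \<subseteq> I" using e(2) subset_cball[of "1 / (real n + 1)" e x] by auto
    then show "x \<in> (\<Union>n. J n)" by (auto simp: J_def)
  qed
  have intI: "emeasure lborel (interior I) \<ge> 1"
  proof -
    have "I \<subseteq> interior I \<union> frontier I" using clI by (auto simp: frontier_def closure_closed)
    then have "emeasure lborel I \<le> emeasure lborel (interior I \<union> frontier I)"
      by (intro emeasure_mono) auto
    also have "\<dots> \<le> emeasure lborel (interior I) + emeasure lborel (frontier I)"
      by (intro emeasure_subadditive) auto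
    finally show ?thesis using I by simp
  qed
  have "(\<lambda>n. emeasure lborel (J n)) \<longlonglongrightarrow> emeasure lborel (\<Union>n. J n)"
    using J_meas inc by (intro Lim_emeasure_incseq) auto
  moreover have "ennreal (d' / d) < emeasure lborel (\<Union>n. J n)"
  proof -
    have "ennreal (d' / d) < 1" using d by (simp add: field_simps ennreal_less_one_iff)
    then show ?thesis unfolding UJ using intI by (rule less_le_trans)
  qed
  ultimately have "\<forall>\<^sub>F n in sequentially. ennreal (d' / d) < emeasure lborel (J n)"
    by (rule order_tendstoD(1))
  then obtain n where n: "ennreal (d' / d) < emeasure lborel (J n)"
    by (meson eventually_sequentially order_refl)
  have "ereal d' \<le> ereal (real (lower_count I \<Gamma> r) / r\<^sup>2)" if r: "r \<ge> (real n + 1) * R" for r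
  proof -
    have r0: "r > 0" using r R by (meson add_nonneg_pos less_le_trans mult_pos_pos of_nat_0_le_iff zero_less_one)
    obtain b where b: "lower_count I \<Gamma> r = card (\<Gamma> \<inter> (\<lambda>w. b + r *\<^sub>R w) ` I)"
      using lower_count_attained by blast
    define U where "U = (\<lambda>w. b + r *\<^sub>R w) ` I"
    define T where "T = (\<lambda>w. b + r *\<^sub>R w) ` J n"
    have "compact U" unfolding U_def by (intro compact_continuous_image I continuous_intros)
    then obtain x e where "\<forall>y\<in>U. dist x y \<le> e" using compact_imp_bounded unfolding bounded_def by blast
    then have "U \<subseteq> cball x e" by auto
    then have "finite (\<Gamma> \<inter> U)"
      using uniformly_locally_finite_finite[OF ulf, of x e] finite_subset[of "\<Gamma> \<inter> U" "\<Gamma> \<inter> cball x e"] by blast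
    have T: "T \<in> sets borel" "emeasure lborel T = ennreal (r\<^sup>2) * emeasure lborel (J n)"
      unfolding T_def by (rule emeasure_affine_image[OF J_meas r0])+
    have cb: "(\<lambda>s. a + s) ` cball 0 R = cball a R" for a :: complex by simp
    have "ennreal (d * (pi * R\<^sup>2)) * emeasure lborel T \<le> emeasure lborel (cball (0::complex) R) * ennreal (real (card (\<Gamma> \<inter> U)))"
    proof (rule count_averaging)
      fix a assume "a \<in> T"
      then obtain x where x: "x \<in> J n" "a = b + r *\<^sub>R x" by (auto simp: T_def)
      show "(\<lambda>s. a + s) ` cball 0 R \<subseteq> U"
      proof
        fix y assume "y \<in> (\<lambda>s. a + s) ` cball 0 R"
        then obtain s where "s \<in> cball 0 R" and s: "y = a + s" by blast
        then have sR: "cmod s \<le> R" by simp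
        have "x + (1 / r) *\<^sub>R s \<in> cball x (1 / (real n + 1))"
        proof -
          have "cmod s / r \<le> R / ((real n + 1) * R)"
            using sR r R r0 by (intro frac_le) auto
          then show ?thesis using r0 R by (simp add: dist_norm)
        qed
        then have "x + (1 / r) *\<^sub>R s \<in> I" using x(1) by (auto simp: J_def)
        moreover have "y = b + r *\<^sub>R (x + (1 / r) *\<^sub>R s)"
          using r0 by (simp add: s x(2) scaleR_add_right add.assoc)
        ultimately show "y \<in> U" unfolding U_def by blast
      qed
      show "d * (pi * R\<^sup>2) \<le> real (card (\<Gamma> \<inter> (\<lambda>s. a + s) ` cball 0 R))"
        unfolding cb by (rule count)
    qed (use T(1) \<open>finite (\<Gamma> \<inter> U)\<close> in auto)
    moreover have "ennreal (d * (pi * R\<^sup>2)) * (ennreal (r\<^sup>2) * ennreal (d' / d)) \<le> ennreal (d * (pi * R\<^sup>2)) * emeasure lborel T"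
      unfolding T(2) using n by (intro mult_left_mono) auto
    ultimately have "ennreal (d * (pi * R\<^sup>2)) * (ennreal (r\<^sup>2) * ennreal (d' / d)) \<le> ennreal (pi * R\<^sup>2) * ennreal (real (card (\<Gamma> \<inter> U)))"
      using R by (simp add: emeasure_complex_cball)
    then have "ennreal (d * (pi * R\<^sup>2) * (r\<^sup>2 * (d' / d))) \<le> ennreal (pi * R\<^sup>2 * real (card (\<Gamma> \<inter> U)))"
    proof -
      have "ennreal (d * (pi * R\<^sup>2) * (r\<^sup>2 * (d' / d))) = ennreal (d * (pi * R\<^sup>2)) * ennreal (r\<^sup>2 * (d' / d))"
        using d by (intro ennreal_mult) auto
      also have "ennreal (r\<^sup>2 * (d' / d)) = ennreal (r\<^sup>2) * ennreal (d' / d)"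
        using d by (intro ennreal_mult) auto
      also have "ennreal (d * (pi * R\<^sup>2)) * \<dots> \<le> ennreal (pi * R\<^sup>2) * ennreal (real (card (\<Gamma> \<inter> U)))"
        by fact
      also have "\<dots> = ennreal (pi * R\<^sup>2 * real (card (\<Gamma> \<inter> U)))"
        by (intro ennreal_mult[symmetric]) auto
      finally show ?thesis .
    qed
    then have "d * (pi * R\<^sup>2) * (r\<^sup>2 * (d' / d)) \<le> pi * R\<^sup>2 * real (card (\<Gamma> \<inter> U))"
      by (subst (asm) ennreal_le_iff) auto
    then have "(pi * R\<^sup>2) * (d' * r\<^sup>2) \<le> (pi * R\<^sup>2) * real (card (\<Gamma> \<inter> U))"
      using d by (simp add: field_simps)
    then have "d' * r\<^sup>2 \<le> real (card (\<Gamma> \<inter> U))"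
      using R by (subst (asm) mult_le_cancel_left_pos) auto
    then show ?thesis
      using r0 by (simp add: b U_def le_divide_eq)
  qed
  then have "\<forall>\<^sub>F r in at_top. ereal d' \<le> ereal (real (lower_count I \<Gamma> r) / r\<^sup>2)"
    unfolding eventually_at_top_linorder by blast
  then show ?thesis
    unfolding lower_density_def by (rule Liminf_bounded)
qed

text \<open>
  Average a fixed copy of \<open>I\<close> over the disc of radius \<open>t - c\<close>, where \<open>c\<close> is large enough for the translates to stay
  in the disc of radius \<open>t\<close>.
\<close>

lemma disc_counts_if_lower_density:
  fixes I \<Gamma> :: "complex set"
  assumes I: "compact I" "emeasure lborel I = 1"
    and ulf: "uniformly_locally_finite \<Gamma>" and d: "0 \<le> d" "ereal d < lower_density I \<Gamma>"
  shows "\<exists>c\<ge>0. \<forall>a t. c \<le> t \<longrightarrow> d * (pi * (t - c)\<^sup>2) \<le> real (card (\<Gamma> \<inter> cball a t))"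
proof -
  have "\<forall>\<^sub>F r in at_top. ereal d < ereal (real (lower_count I \<Gamma> r) / r\<^sup>2)"
    using d(2) unfolding lower_density_def by (rule less_LiminfD)
  then obtain r0 where r0: "\<And>r. r \<ge> r0 \<Longrightarrow> d < real (lower_count I \<Gamma> r) / r\<^sup>2"
    unfolding eventually_at_top_linorder by auto
  define r where "r = max r0 1"
  have r: "r > 0" "d < real (lower_count I \<Gamma> r) / r\<^sup>2"
    using r0[of r] by (auto simp: r_def)
  have count: "d * r\<^sup>2 \<le> real (card (\<Gamma> \<inter> (\<lambda>w. a + r *\<^sub>R w) ` I))" for a
  proof -
    have "d * r\<^sup>2 \<le> real (lower_count I \<Gamma> r)" using r by (simp add: field_simps)
    then show ?thesis using lower_count_le[of I \<Gamma> r a] by linarith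
  qed
  obtain B where B: "B > 0" "\<And>x. x \<in> I \<Longrightarrow> cmod x \<le> B"
    using compact_imp_bounded[OF I(1)] unfolding bounded_pos by blast
  define S where "S = (\<lambda>w. 0 + r *\<^sub>R w) ` I"
  have Im: "I \<in> sets borel" using I(1) by (intro borel_closed compact_imp_closed)
  have S: "S \<in> sets borel" "emeasure lborel S = ennreal (r\<^sup>2)"
    unfolding S_def using emeasure_affine_image[OF Im r(1), of 0] I(2) by simp_all
  have Sa: "(\<lambda>s. a + s) ` S = (\<lambda>w. a + r *\<^sub>R w) ` I" for a
    by (simp add: S_def image_image)
  define c where "c = r * B"
  have "d * (pi * (t - c)\<^sup>2) \<le> real (card (\<Gamma> \<inter> cball a t))" if t: "c \<le> t" for a t
  proof -
    have "ennreal (d * r\<^sup>2) * emeasure lborel (cball a (t - c)) \<le> emeasure lborel S * ennreal (real (card (\<Gamma> \<inter> cball a t)))"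
    proof (rule count_averaging)
      fix a' assume a': "a' \<in> cball a (t - c)"
      show "(\<lambda>s. a' + s) ` S \<subseteq> cball a t"
      proof
        fix y assume "y \<in> (\<lambda>s. a' + s) ` S"
        then obtain w where w: "w \<in> I" "y = a' + r *\<^sub>R w" unfolding Sa by blast
        have "cmod (r *\<^sub>R w) \<le> c" using B(2)[OF w(1)] r by (simp add: c_def)
        moreover have "dist a y \<le> dist a a' + cmod (r *\<^sub>R w)"
          using dist_triangle[of a y a'] by (simp add: w dist_norm)
        ultimately show "y \<in> cball a t" using a' by simp
      qed
      show "d * r\<^sup>2 \<le> real (card (\<Gamma> \<inter> (\<lambda>s. a' + s) ` S))"
        unfolding Sa by (rule count)
    qed (use S(1) uniformly_locally_finite_finite[OF ulf] in auto)
    then have "ennreal (d * r\<^sup>2 * (pi * (t - c)\<^sup>2)) \<le> ennreal (r\<^sup>2 * real (card (\<Gamma> \<inter> cball a t)))"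
      using t d S(2) by (simp add: emeasure_complex_cball ennreal_mult)
    then have "r\<^sup>2 * (d * (pi * (t - c)\<^sup>2)) \<le> r\<^sup>2 * real (card (\<Gamma> \<inter> cball a t))"
      by (subst (asm) ennreal_le_iff) (auto simp: mult_ac)
    then show ?thesis using r by (subst (asm) mult_le_cancel_left_pos) auto
  qed
  moreover have "c \<ge> 0" using r B by (simp add: c_def)
  ultimately show ?thesis by blast
qed

section \<open>Dense sets are uniformly sampling\<close>

lemma norm_centre_le_if_circle_bound:
  assumes R: "R > 0" and g: "g holomorphic_on UNIV" and M: "\<forall>z\<in>sphere 0 R. cmod (g z) \<le> M"
  shows "cmod (g 0) \<le> M"
proof (rule maximum_modulus_frontier[where f = g and S = "cball 0 R" and \<xi> = 0])
  show "g holomorphic_on interior (cball 0 R)" using g holomorphic_on_subset by blast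
  show "continuous_on (closure (cball 0 R)) g"
    using g holomorphic_on_imp_continuous_on continuous_on_subset by blast
qed (use R M in auto)

text \<open>
  With \<open>\<eta> = 0\<close> this is Jensen's inequality for a function with zeros in \<open>Z\<close>. The induction removes one zero \<open>w\<close> at a
  time, dividing \<open>g - g(w)\<close> by the Blaschke factor of \<open>w\<close>. This changes the values at the remaining points by
  a factor controlled by the separation \<open>q\<close>, so they stay of order \<open>\<eta>\<close>. The constant depends on the number of
  points, which is bounded in the application.
\<close>

lemma approximate_zeros_bound:
  assumes R: "R > 0" and q: "q > 0"
  shows "\<exists>C\<ge>0. \<forall>Z g M \<eta>. finite Z \<longrightarrow> card Z \<le> N \<longrightarrow> Z \<subseteq> cball 0 R \<longrightarrow>
    (\<forall>z\<in>Z. \<forall>w\<in>Z. z \<noteq> w \<longrightarrow> q \<le> dist z w) \<longrightarrow> g holomorphic_on UNIV \<longrightarrow> 0 \<le> \<eta> \<longrightarrow>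
    (\<forall>z\<in>sphere 0 R. cmod (g z) \<le> M) \<longrightarrow> (\<forall>z\<in>Z. cmod (g z) \<le> \<eta>) \<longrightarrow>
    cmod (g 0) \<le> (M + C * \<eta>) * (\<Prod>z\<in>Z. cmod z / R) + C * \<eta>"
proof (induction N)
  case 0
  show ?case by (intro exI[of _ 0]) (auto intro!: norm_centre_le_if_circle_bound[OF R])
next
  case (Suc N)
  then obtain C where C: "C \<ge> 0" and IH: "\<And>Z g M \<eta>. finite Z \<Longrightarrow> card Z \<le> N \<Longrightarrow> Z \<subseteq> cball 0 R \<Longrightarrow>
    \<forall>z\<in>Z. \<forall>w\<in>Z. z \<noteq> w \<longrightarrow> q \<le> dist z w \<Longrightarrow> g holomorphic_on UNIV \<Longrightarrow> 0 \<le> \<eta> \<Longrightarrow>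
    \<forall>z\<in>sphere 0 R. cmod (g z) \<le> M \<Longrightarrow> \<forall>z\<in>Z. cmod (g z) \<le> \<eta> \<Longrightarrow>
    cmod (g 0) \<le> (M + C * \<eta>) * (\<Prod>z\<in>Z. cmod z / R) + C * \<eta>"
    by blast
  define \<kappa> where "\<kappa> = 4 * R / q"
  define C' where "C' = 1 + C * \<kappa>"
  have \<kappa>: "\<kappa> > 0" and C': "C' \<ge> 0" using R q C by (auto simp: \<kappa>_def C'_def)
  have "cmod (g 0) \<le> (M + C' * \<eta>) * (\<Prod>z\<in>Z. cmod z / R) + C' * \<eta>"
    if Z: "finite Z" "card Z \<le> Suc N" "Z \<subseteq> cball 0 R" and sep: "\<forall>z\<in>Z. \<forall>w\<in>Z. z \<noteq> w \<longrightarrow> q \<le> dist z w"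
      and g: "g holomorphic_on UNIV" and \<eta>: "0 \<le> \<eta>" 
      and M: "\<forall>z\<in>sphere 0 R. cmod (g z) \<le> M" and gZ: "\<forall>z\<in>Z. cmod (g z) \<le> \<eta>" for Z g M \<eta>
  proof (cases "Z = {}")
    case True
    have "0 \<le> C' * \<eta>" using C' \<eta> by simp
    then show ?thesis using norm_centre_le_if_circle_bound[OF R g M] True by simp
  next
    case False
    then obtain w where w: "w \<in> Z" by blast
    define Z' where "Z' = Z - {w}"
    define h where "h = (\<lambda>z. if z = w then deriv g w else (g z - g w) / (z - w))"
    have h: "h holomorphic_on UNIV"
      unfolding h_def by (rule pole_lemma_open[OF g open_UNIV])
    have gh: "g z = g w + (z - w) * h z" for z by (simp add: h_def)
    \<comment> \<open>the second factor has modulus \<open>\<bar>z - w\<bar>\<close> on the circle, so \<open>k\<close> is \<open>g - g(w)\<close> divided by a Blaschke factor\<close>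
    define k where "k = (\<lambda>z. h z * ((of_real (R\<^sup>2) - z * cnj w) / of_real R))"
    have k: "k holomorphic_on UNIV" unfolding k_def using R by (intro holomorphic_intros h) auto
    have wR: "cmod w \<le> R" using w Z by auto
    have gw: "cmod (g w) \<le> \<eta>" using gZ w by blast
    have kM: "\<forall>z\<in>sphere 0 R. cmod (k z) \<le> M + \<eta>"
    proof
      fix z assume z: "z \<in> sphere (0::complex) R"
      have "of_real (R\<^sup>2) = z * cnj z" using z by (simp add: complex_norm_square[symmetric] del: of_real_power)
      then have "of_real (R\<^sup>2) - z * cnj w = z * cnj (z - w)" by (simp add: algebra_simps)
      then have "cmod (k z) = cmod (h z) * cmod (z - w)"
        unfolding k_def using z R by (simp add: norm_mult norm_divide flip: complex_cnj_diff)
      also have "\<dots> = cmod (g z - g w)" unfolding gh[of z] by (simp add: norm_mult)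
      also have "\<dots> \<le> cmod (g z) + cmod (g w)" by (rule norm_triangle_ineq4)
      also have "\<dots> \<le> M + \<eta>" using M z gw by (intro add_mono) auto
      finally show "cmod (k z) \<le> M + \<eta>" .
    qed
    have kZ: "\<forall>z\<in>Z'. cmod (k z) \<le> \<kappa> * \<eta>"
    proof
      fix z assume "z \<in> Z'"
      then have z: "z \<in> Z" "z \<noteq> w" by (auto simp: Z'_def)
      have qz: "q \<le> cmod (z - w)" using sep z w by (auto simp: dist_norm)
      have "cmod (g z - g w) \<le> 2 * \<eta>"
        using norm_triangle_ineq4[of "g z" "g w"] gZ z(1) gw by fastforce
      then have hz: "cmod (h z) \<le> 2 * \<eta> / q"
        using z qz q \<eta> by (simp add: h_def norm_divide frac_le)
      have "cmod (of_real (R\<^sup>2) - z * cnj w) \<le> R\<^sup>2 + cmod z * cmod w"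
        using norm_triangle_ineq4[of "of_real (R\<^sup>2)" "z * cnj w"] by (simp add: norm_mult norm_power)
      also have "\<dots> \<le> R\<^sup>2 + R * R"
        using wR z(1) Z R by (intro add_left_mono mult_mono) auto
      finally have "cmod (of_real (R\<^sup>2) - z * cnj w) / R \<le> 2 * R"
        using R by (simp add: divide_le_eq power2_eq_square)
      then have "cmod (h z) * (cmod (of_real (R\<^sup>2) - z * cnj w) / R) \<le> (2 * \<eta> / q) * (2 * R)"
        using hz \<eta> q R by (intro mult_mono) auto
      then show "cmod (k z) \<le> \<kappa> * \<eta>"
        using R by (simp add: k_def norm_mult norm_divide \<kappa>_def mult_ac)
    qed
    have Z': "finite Z'" "card Z' \<le> N" "Z' \<subseteq> cball 0 R" "\<forall>z\<in>Z'. \<forall>w\<in>Z'. z \<noteq> w \<longrightarrow> q \<le> dist z w"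
      using Z sep w by (auto simp: Z'_def card_Diff_singleton)
    define P where "P = (\<Prod>z\<in>Z'. cmod z / R)"
    have P0: "P \<ge> 0" unfolding P_def using R by (intro prod_nonneg) auto
    have k0: "cmod (k 0) \<le> (M + \<eta> + C * (\<kappa> * \<eta>)) * P + C * (\<kappa> * \<eta>)"
      unfolding P_def by (rule IH[OF Z' k _ kM kZ]) (use \<kappa> \<eta> in simp)
    have PZ: "(\<Prod>z\<in>Z. cmod z / R) = cmod w / R * P"
      unfolding P_def Z'_def using Z(1) w by (rule prod.remove)
    have "cmod (g 0) \<le> cmod (g w) + cmod w * cmod (h 0)"
      using norm_triangle_ineq4[of "g w" "w * h 0"] by (simp add: gh[of 0] norm_mult)
    also have "cmod w * cmod (h 0) = cmod w / R * cmod (k 0)"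
      using R by (simp add: k_def norm_mult norm_divide norm_power power2_eq_square)
    also have "cmod (g w) + cmod w / R * cmod (k 0) \<le> \<eta> + cmod w / R * ((M + \<eta> + C * (\<kappa> * \<eta>)) * P + C * (\<kappa> * \<eta>))"
      using gw k0 R by (intro add_mono mult_left_mono) auto
    also have "\<dots> = (M + C' * \<eta>) * (cmod w / R * P) + (\<eta> + cmod w / R * (C * (\<kappa> * \<eta>)))"
      by (simp add: C'_def algebra_simps add_divide_distrib)
    also have "\<eta> + cmod w / R * (C * (\<kappa> * \<eta>)) \<le> \<eta> + 1 * (C * (\<kappa> * \<eta>))"
      using wR R C \<kappa> \<eta> by (intro add_left_mono mult_right_mono) auto
    also have "\<dots> = C' * \<eta>" by (simp add: C'_def algebra_simps)
    finally show ?thesis by (simp add: PZ)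
  qed
  then show ?case using C' by blast
qed

text \<open>
  The sum of \<open>ln (R/\<bar>z\<bar>)\<close> over \<open>z\<close> in \<open>Z\<close> is at least the integral over \<open>[c, R]\<close> of the number of points of modulus at most
  \<open>t\<close>, divided by \<open>t\<close>. By the assumption on the counts the integrand is at least \<open>D (t - 2c)\<close>.
\<close>

lemma prod_moduli_le:
  fixes Z :: "complex set"
  assumes Z: "finite Z" "Z \<subseteq> cball 0 R" and c: "0 < c" "c \<le> R" and D: "D \<ge> 0"
    and count: "\<And>t. c \<le> t \<Longrightarrow> t \<le> R \<Longrightarrow> D * (t - c)\<^sup>2 \<le> real (card (Z \<inter> cball 0 t))"
  shows "(\<Prod>z\<in>Z. cmod z / R) \<le> exp (- D * ((R\<^sup>2 - c\<^sup>2) / 2 - 2 * c * (R - c)))"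
proof (cases "0 \<in> Z")
  case True
  then have "(\<Prod>z\<in>Z. cmod z / R) = 0" using Z(1) by (intro prod_zero) auto
  then show ?thesis by simp
next
  case False
  have R: "R > 0" using c by simp
  \<comment> \<open>a point of modulus below \<open>c\<close> is counted from \<open>t = c\<close> on\<close>
  define m where "m = (\<lambda>z::complex. max c (cmod z))"
  have m: "c \<le> m z" "cmod z \<le> m z" "m z > 0" for z using c by (auto simp: m_def)
  have mR: "m z \<le> R" if "z \<in> Z" for z using that Z(2) c by (auto simp: m_def)
  have each: "((\<lambda>t. if t \<in> {m z..R} then 1 / t else 0) has_integral (ln R - ln (m z))) {c..R}" if z: "z \<in> Z" for z
  proof -
    have "((\<lambda>t. 1 / t) has_integral (ln R - ln (m z))) {m z..R}"
      using mR[OF z] m(3)[of z] 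
      by (intro fundamental_theorem_of_calculus) 
         (auto simp flip: has_real_derivative_iff_has_vector_derivative intro!: derivative_eq_intros)
    then show ?thesis
      using m(1)[of z] by (subst has_integral_restrict) auto
  qed
  have total: "((\<lambda>t. \<Sum>z\<in>Z. if t \<in> {m z..R} then 1 / t else 0) has_integral (\<Sum>z\<in>Z. ln R - ln (m z))) {c..R}"
    by (intro has_integral_sum Z each)
  have low: "((\<lambda>t. D * (t - 2 * c)) has_integral (D * (R\<^sup>2 / 2 - 2 * c * R) - D * (c\<^sup>2 / 2 - 2 * c * c))) {c..R}"
    using c(2) by (intro fundamental_theorem_of_calculus) 
       (auto simp flip: has_real_derivative_iff_has_vector_derivative intro!: derivative_eq_intros simp: algebra_simps)
  have "D * (R\<^sup>2 / 2 - 2 * c * R) - D * (c\<^sup>2 / 2 - 2 * c * c) \<le> (\<Sum>z\<in>Z. ln R - ln (m z))"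
  proof (rule has_integral_le[OF low total])
    fix t assume t: "t \<in> {c..R}"
    then have t0: "t > 0" using c by simp
    have "D * (t - 2 * c) \<le> D * (t - c)\<^sup>2 / t"
    proof -
      have "t - 2 * c \<le> (t - c)\<^sup>2 / t" using t0 by (simp add: field_simps power2_eq_square)
      then show ?thesis using D mult_left_mono[of "t - 2 * c" "(t - c)\<^sup>2 / t" D] by simp
    qed
    also have "\<dots> \<le> real (card (Z \<inter> cball 0 t)) / t"
      using count[of t] t t0 by (intro divide_right_mono) auto
    also have "\<dots> = (\<Sum>z\<in>Z. if z \<in> cball 0 t then 1 / t else 0)"
      using Z(1) by (simp add: sum.If_cases Int_def)
    also have "\<dots> = (\<Sum>z\<in>Z. if t \<in> {m z..R} then 1 / t else 0)"
      using t by (intro sum.cong) (auto simp: m_def)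
    finally show "D * (t - 2 * c) \<le> (\<Sum>z\<in>Z. if t \<in> {m z..R} then 1 / t else 0)" .
  qed
  also have "\<dots> \<le> (\<Sum>z\<in>Z. - ln (cmod z / R))"
  proof (rule sum_mono)
    fix z assume "z \<in> Z"
    then have "cmod z > 0" using False by auto
    then show "ln R - ln (m z) \<le> - ln (cmod z / R)"
      using R m[of z] by (simp add: ln_div)
  qed
  also have "\<dots> = - ln (\<Prod>z\<in>Z. cmod z / R)"
    using Z(1) False R by (subst ln_prod) (auto simp: sum_negf)
  finally have *: "ln (\<Prod>z\<in>Z. cmod z / R) \<le> - D * ((R\<^sup>2 - c\<^sup>2) / 2 - 2 * c * (R - c))"
    by (simp add: algebra_simps power2_eq_square diff_divide_distrib)
  have "(\<Prod>z\<in>Z. cmod z / R) > 0"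
  proof (intro prod_pos ballI)
    fix z assume "z \<in> Z"
    then have "z \<noteq> 0" using False by auto
    then show "0 < cmod z / R" using R by simp
  qed
  then show ?thesis using * by (metis exp_le_cancel_iff exp_ln)
qed

text \<open>
  Choose \<open>a\<close> with \<open>u(a)\<close> close to \<open>sup u\<close>, recentre \<open>f\<close> at \<open>a\<close> and apply the bound with approximate zeros on the disc of
  radius \<open>R\<close>. There the recentred function is at most \<open>sup u\<close> times \<open>exp(\<beta> R\<^sup>2/2)\<close>, whereas the product over the zeros is
  at most about \<open>exp(-D R\<^sup>2/2)\<close>. As \<open>\<beta> < D\<close>, for a suitable fixed \<open>R\<close> the first term is at most \<open>sup u / 8\<close> and is absorbed.
\<close>

lemma disc_counts_imp_sup_sampling:
  assumes ud: "uniform_discrete \<Gamma>" and \<beta>: "0 \<le> \<beta>" "\<beta> < D" and c: "c > 0"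
    and count: "\<And>a t. c \<le> t \<Longrightarrow> D * (t - c)\<^sup>2 \<le> real (card (\<Gamma> \<inter> cball a t))"
  shows "\<exists>K>0. sup_sampling \<beta> \<Gamma> K"
proof -
  obtain q where q: "q > 0" "\<And>z w. z \<in> \<Gamma> \<Longrightarrow> w \<in> \<Gamma> \<Longrightarrow> dist z w < q \<Longrightarrow> z = w"
    using ud unfolding uniform_discrete_def by blast
  have ulf: "uniformly_locally_finite \<Gamma>" using ud by (rule uniform_discrete_imp_uniformly_locally_finite)
  \<comment> \<open>large enough for the exponent \<open>(D - \<beta>) R\<^sup>2 / 2 - 2 c D R\<close> to be at least \<open>ln 8\<close>\<close>
  define R where "R = 1 + c + 2 * (2 * c * D + ln 8) / (D - \<beta>)"
  have Rb: "1 + c \<le> R" "2 * (2 * c * D + ln 8) / (D - \<beta>) \<le> R"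
    using \<beta> c by (auto simp: R_def)
  then have R: "R > 0" "R \<ge> 1" "c \<le> R" using c by auto
  have small: "exp (\<beta> / 2 * R\<^sup>2) * exp (- D * ((R\<^sup>2 - c\<^sup>2) / 2 - 2 * c * (R - c))) \<le> 1 / 8"
  proof -
    have "2 * c * D + ln 8 \<le> (D - \<beta>) / 2 * R"
      using Rb(2) \<beta> by (simp add: field_simps)
    then have "(2 * c * D + ln 8) * R \<le> (D - \<beta>) / 2 * R * R"
      using R by (intro mult_right_mono) auto
    moreover have "ln 8 * 1 \<le> ln 8 * R" using R by (intro mult_left_mono) auto
    moreover have "0 \<le> 3 / 2 * D * c\<^sup>2" using \<beta> by simp
    moreover have "\<beta> / 2 * R\<^sup>2 + - D * ((R\<^sup>2 - c\<^sup>2) / 2 - 2 * c * (R - c))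
        = 2 * c * D * R - (D - \<beta>) / 2 * R * R - 3 / 2 * D * c\<^sup>2"
      by (simp add: algebra_simps power2_eq_square diff_divide_distrib)
    moreover have "(2 * c * D + ln 8) * R = 2 * c * D * R + ln 8 * R"
      by (rule distrib_right)
    ultimately have "\<beta> / 2 * R\<^sup>2 + - D * ((R\<^sup>2 - c\<^sup>2) / 2 - 2 * c * (R - c)) \<le> - ln 8"
      by linarith
    then have "exp (\<beta> / 2 * R\<^sup>2 + - D * ((R\<^sup>2 - c\<^sup>2) / 2 - 2 * c * (R - c))) \<le> exp (- ln 8)"
      by simp
    then show ?thesis unfolding exp_add by (simp add: exp_minus)
  qed
  obtain n where n: "\<And>a. finite (\<Gamma> \<inter> cball a R)" "\<And>a. card (\<Gamma> \<inter> cball a R) \<le> n"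
    using ulf unfolding uniformly_locally_finite_def by meson
  obtain C where C: "C \<ge> 0" and approx: "\<And>Z g M \<eta>. finite Z \<Longrightarrow> card Z \<le> n \<Longrightarrow> Z \<subseteq> cball 0 R \<Longrightarrow>
    \<forall>z\<in>Z. \<forall>w\<in>Z. z \<noteq> w \<longrightarrow> q \<le> dist z w \<Longrightarrow> g holomorphic_on UNIV \<Longrightarrow> 0 \<le> \<eta> \<Longrightarrow>
    \<forall>z\<in>sphere 0 R. cmod (g z) \<le> M \<Longrightarrow> \<forall>z\<in>Z. cmod (g z) \<le> \<eta> \<Longrightarrow>
    cmod (g 0) \<le> (M + C * \<eta>) * (\<Prod>z\<in>Z. cmod z / R) + C * \<eta>"
    using approximate_zeros_bound[OF R(1) q(1), of n] by blast
  define E where "E = exp (\<beta> / 2 * R\<^sup>2)"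
  define K where "K = 6 * C * E + 1"
  have K: "K > 0" using C by (simp add: K_def E_def add_nonneg_pos)
  have "wmod \<beta> f z \<le> K * \<eta>" 
    if f: "f holomorphic_on UNIV" and M: "\<And>z. wmod \<beta> f z \<le> M" and \<eta>: "0 \<le> \<eta>" "\<And>\<gamma>. \<gamma> \<in> \<Gamma> \<Longrightarrow> wmod \<beta> f \<gamma> \<le> \<eta>" 
    for f M \<eta> z
  proof -
    define M0 where "M0 = (SUP z. wmod \<beta> f z)"
    have bdd: "bdd_above (range (wmod \<beta> f))" using M by (intro bdd_aboveI[of _ M]) auto
    have le: "wmod \<beta> f z \<le> M0" for z unfolding M0_def using bdd by (intro cSUP_upper) auto
    have M0: "M0 \<ge> 0" using le[of 0] wmod_nonneg[of \<beta> f 0] by linarith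
    have "M0 \<le> K * \<eta>"
    proof (cases "M0 = 0")
      case True
      then show ?thesis using K \<eta> by simp
    next
      case False
      then have "M0 / 2 < M0" using M0 by simp
      moreover have "\<exists>x\<in>UNIV. y < wmod \<beta> f x" if "y < M0" for y
        using that less_cSUP_iff[OF UNIV_not_empty bdd] unfolding M0_def by blast
      ultimately obtain a where a: "M0 / 2 < wmod \<beta> f a" by blast
      obtain G where G: "G holomorphic_on UNIV" "\<And>z. cmod (G z) = wmod \<beta> f z * exp (\<beta> / 2 * (cmod (z - a))\<^sup>2)"
        using recenter_local[OF f] by blast
      define g where "g = (\<lambda>w. G (a + w))"
      have g: "g holomorphic_on UNIV"
        unfolding g_def by (intro holomorphic_on_compose_gen[OF _ G(1), unfolded o_def] holomorphic_intros) auto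
      have gle: "cmod (g w) \<le> wmod \<beta> f (a + w) * E" if "cmod w \<le> R" for w
      proof -
        have "(cmod w)\<^sup>2 \<le> R\<^sup>2" using that by (intro power_mono) auto
        then show ?thesis
          unfolding g_def G E_def using \<beta> by (intro mult_left_mono) (auto simp: mult_left_mono)
      qed
      define Z where "Z = (\<lambda>\<gamma>. \<gamma> - a) ` (\<Gamma> \<inter> cball a R)"
      have inj: "inj_on (\<lambda>\<gamma>. \<gamma> - a) X" for X by (auto simp: inj_on_def)
      have Zt: "Z \<inter> cball 0 t = (\<lambda>\<gamma>. \<gamma> - a) ` (\<Gamma> \<inter> cball a t)" if "t \<le> R" for t
        using that by (auto simp: Z_def dist_norm norm_minus_commute)
      have Z: "finite Z" "card Z \<le> n" "Z \<subseteq> cball 0 R"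
        using n[of a] by (auto simp: Z_def card_image[OF inj] dist_norm norm_minus_commute)
      have Zsep: "\<forall>z\<in>Z. \<forall>w\<in>Z. z \<noteq> w \<longrightarrow> q \<le> dist z w"
        unfolding Z_def using q(2) by (force simp: dist_norm not_less[symmetric])
      define P where "P = (\<Prod>z\<in>Z. cmod z / R)"
      have "cmod (g 0) \<le> (M0 * E + C * (\<eta> * E)) * P + C * (\<eta> * E)"
        unfolding P_def
      proof (rule approx[OF Z Zsep g])
        show "\<forall>z\<in>sphere 0 R. cmod (g z) \<le> M0 * E"
        proof
          fix z assume "z \<in> sphere (0::complex) R"
          then have "cmod (g z) \<le> wmod \<beta> f (a + z) * E" by (intro gle) auto
          also have "\<dots> \<le> M0 * E" using le by (intro mult_right_mono) (auto simp: E_def)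
          finally show "cmod (g z) \<le> M0 * E" .
        qed
        show "\<forall>z\<in>Z. cmod (g z) \<le> \<eta> * E"
        proof
          fix z assume z: "z \<in> Z"
          then have "cmod (g z) \<le> wmod \<beta> f (a + z) * E" using Z(3) by (intro gle) auto
          also have "\<dots> \<le> \<eta> * E" using z \<eta>(2) by (intro mult_right_mono) (auto simp: E_def Z_def)
          finally show "cmod (g z) \<le> \<eta> * E" .
        qed
      qed (use \<eta> in \<open>simp add: E_def\<close>)
      also have "\<dots> = (M0 * (E * P) + C * (\<eta> * E) * P) + C * (\<eta> * E)" by (simp add: algebra_simps)
      also have "\<dots> \<le> (M0 * (1 / 8) + C * (\<eta> * E) * 1) + C * (\<eta> * E)"
      proof -
        have P: "P \<le> exp (- D * ((R\<^sup>2 - c\<^sup>2) / 2 - 2 * c * (R - c)))"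
          unfolding P_def
        proof (rule prod_moduli_le[OF Z(1,3) c R(3)])
          fix t assume "c \<le> t" "t \<le> R"
          then show "D * (t - c)\<^sup>2 \<le> real (card (Z \<inter> cball 0 t))"
            using count[of t a] by (simp add: Zt card_image[OF inj])
        qed (use \<beta> in simp)
        have "E * P \<le> 1 / 8"
          using order_trans[OF mult_left_mono[OF P, of E] small[folded E_def]] by (simp add: E_def)
        moreover have "P \<le> 1" unfolding P_def using Z(3) R by (intro prod_le_1) auto
        ultimately show ?thesis using M0 C \<eta> by (intro add_mono mult_left_mono) (auto simp: E_def)
      qed
      also have "cmod (g 0) = wmod \<beta> f a" by (simp add: g_def G)
      finally have "M0 / 2 \<le> M0 / 8 + 2 * (C * (\<eta> * E))" using a by linarith
      then have "M0 \<le> 16 / 3 * (C * (\<eta> * E))" by linarith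
      also have "\<dots> \<le> 6 * (C * (\<eta> * E))" using C \<eta> by (intro mult_right_mono) (auto simp: E_def)
      also have "\<dots> \<le> K * \<eta>" using \<eta> by (simp add: K_def algebra_simps)
      finally show ?thesis .
    qed
    then show ?thesis using le[of z] by linarith
  qed
  then have "sup_sampling \<beta> \<Gamma> K" unfolding sup_sampling_def by blast
  then show ?thesis using K by blast
qed

section \<open>From uniform sampling to square sampling at a smaller exponent\<close>

lemma wmod_bounded_if_square_integrable:
  assumes f: "f holomorphic_on UNIV" and \<alpha>: "\<alpha> \<ge> 0" and fin: "(\<integral>\<^sup>+z. ennreal ((wmod \<alpha> f z)\<^sup>2) \<partial>lborel) < \<infinity>"
  obtains M where "\<And>z. wmod \<alpha> f z \<le> M"
proof -
  obtain V where V: "V \<ge> 0" "(\<integral>\<^sup>+z. ennreal ((wmod \<alpha> f z)\<^sup>2) \<partial>lborel) = ennreal V"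
    using fin by (cases "\<integral>\<^sup>+z. ennreal ((wmod \<alpha> f z)\<^sup>2) \<partial>lborel") auto
  have "wmod \<alpha> f z \<le> sqrt (exp \<alpha> / pi * V)" for z
  proof -
    have "local_mass \<alpha> f z \<le> ennreal V"
      unfolding local_mass_def V(2)[symmetric] by (intro nn_integral_mono) (auto simp: indicator_def)
    then have "ennreal ((wmod \<alpha> f z)\<^sup>2) \<le> ennreal (exp \<alpha> / pi) * ennreal V"
      using wmod_le_local_mass[OF f \<alpha>, of z] by (meson mult_left_mono order_trans zero_le)
    also have "\<dots> = ennreal (exp \<alpha> / pi * V)" using V by (intro ennreal_mult[symmetric]) auto
    finally have "(wmod \<alpha> f z)\<^sup>2 \<le> exp \<alpha> / pi * V" using V by (subst (asm) ennreal_le_iff) auto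
    then show ?thesis by (rule real_le_rsqrt)
  qed
  then show ?thesis using that by blast
qed

text \<open>
  For each \<open>z\<close>, multiply \<open>f\<close> by a Gaussian centred at \<open>z\<close>, which raises the exponent from \<open>\<alpha>\<close> to \<open>\<beta>\<close>. The supremum over \<open>\<Gamma>'\<close> of
  the resulting samples is at most their \<open>\<ell>\<^sup>2\<close> norm, and integrating its square over \<open>z\<close> spreads each sample over a
  Gaussian of total mass \<open>\<pi>/(\<beta> - \<alpha>)\<close>.
\<close>

lemma sup_sampling_imp_sampling:
  assumes \<alpha>: "0 < \<alpha>" "\<alpha> < \<beta>" and K: "K > 0" and ss: "sup_sampling \<beta> \<Gamma>' K" and sub: "\<Gamma>' \<subseteq> \<Gamma>" and ulf: "uniformly_locally_finite \<Gamma>"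
  shows "sampling_set \<alpha> \<Gamma>"
proof -
  define \<delta> where "\<delta> = \<beta> - \<alpha>"
  have \<delta>: "\<delta> > 0" using \<alpha> by (simp add: \<delta>_def)
  have count: "countable \<Gamma>'" using uniformly_locally_finite_countable[OF ulf] sub countable_subset by blast
  have "(\<integral>\<^sup>+z. ennreal ((wmod \<alpha> f z)\<^sup>2) \<partial>lborel) 
      \<le> ennreal (K\<^sup>2 * (pi / \<delta>)) * (\<integral>\<^sup>+\<gamma>. ennreal ((wmod \<alpha> f \<gamma>)\<^sup>2) \<partial>count_space \<Gamma>')"
    if f: "f holomorphic_on UNIV" and fin: "(\<integral>\<^sup>+z. ennreal ((wmod \<alpha> f z)\<^sup>2) \<partial>lborel) < \<infinity>" for f
  proof -
    obtain M where M: "\<And>z. wmod \<alpha> f z \<le> M"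
      using wmod_bounded_if_square_integrable[OF f _ fin] \<alpha> by auto
    define X where "X = (\<lambda>z. \<integral>\<^sup>+\<gamma>. ennreal ((wmod \<alpha> f \<gamma>)\<^sup>2) * ennreal (exp (- \<delta> * (cmod (z - \<gamma>))\<^sup>2)) \<partial>count_space \<Gamma>')"
    have pointwise: "ennreal ((wmod \<alpha> f z)\<^sup>2) \<le> ennreal (K\<^sup>2) * X z" for z
    proof (cases "X z")
      case (real x)
      obtain G where G: "G holomorphic_on UNIV" "\<And>\<zeta>. wmod \<beta> G \<zeta> = wmod \<alpha> f \<zeta> * exp (- (\<delta> / 2) * (cmod (\<zeta> - z))\<^sup>2)"
        using recenter[OF f, of \<beta> \<alpha> z 1] unfolding \<delta>_def by auto
      have "wmod \<beta> G \<zeta> \<le> M" for \<zeta>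
      proof -
        have "wmod \<beta> G \<zeta> \<le> wmod \<alpha> f \<zeta> * 1" unfolding G using \<delta> by (intro mult_left_mono) auto
        then show ?thesis using M[of \<zeta>] by simp
      qed
      moreover have "wmod \<beta> G \<gamma> \<le> sqrt x" if \<gamma>: "\<gamma> \<in> \<Gamma>'" for \<gamma>
      proof -
        have "ennreal ((wmod \<alpha> f \<gamma>)\<^sup>2) * ennreal (exp (- \<delta> * (cmod (z - \<gamma>))\<^sup>2)) \<le> ennreal x"
          using nn_integral_ge_point[OF \<gamma>, of "\<lambda>\<gamma>. ennreal ((wmod \<alpha> f \<gamma>)\<^sup>2) * ennreal (exp (- \<delta> * (cmod (z - \<gamma>))\<^sup>2))"] real
          unfolding X_def by simp
        then have "(wmod \<alpha> f \<gamma>)\<^sup>2 * exp (- \<delta> * (cmod (z - \<gamma>))\<^sup>2) \<le> x"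
          using real by (simp add: ennreal_mult[symmetric])
        then have "(wmod \<beta> G \<gamma>)\<^sup>2 \<le> x"
          by (simp add: G power_mult_distrib power2_eq_square[of "exp _"] exp_add[symmetric] norm_minus_commute)
        then show ?thesis by (rule real_le_rsqrt)
      qed
      ultimately have "wmod \<beta> G z \<le> K * sqrt x"
        using real by (intro sup_samplingD[OF ss G(1)]) auto
      then have "wmod \<alpha> f z \<le> K * sqrt x" by (simp add: G)
      then have "(wmod \<alpha> f z)\<^sup>2 \<le> (K * sqrt x)\<^sup>2" by (intro power_mono) auto
      also have "\<dots> = K\<^sup>2 * x" using real by (simp add: power_mult_distrib)
      finally show ?thesis using real by (simp add: ennreal_mult[symmetric] ennreal_leI)
    qed (use K in \<open>simp add: ennreal_mult_top\<close>)
    have "(\<integral>\<^sup>+z. ennreal ((wmod \<alpha> f z)\<^sup>2) \<partial>lborel) \<le> (\<integral>\<^sup>+z. \<integral>\<^sup>+\<gamma>. ennreal (K\<^sup>2) * (ennreal ((wmod \<alpha> f \<gamma>)\<^sup>2) * ennreal (exp (- \<delta> * (cmod (z - \<gamma>))\<^sup>2))) \<partial>count_space \<Gamma>' \<partial>lborel)"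
      using pointwise unfolding X_def by (intro nn_integral_mono) (simp add: nn_integral_cmult)
    also have "\<dots> = (\<integral>\<^sup>+\<gamma>. \<integral>\<^sup>+z. ennreal (K\<^sup>2) * (ennreal ((wmod \<alpha> f \<gamma>)\<^sup>2) * ennreal (exp (- \<delta> * (cmod (z - \<gamma>))\<^sup>2))) \<partial>lborel \<partial>count_space \<Gamma>')"
      by (rule nn_integral_count_space_nn_integral[OF count]) measurable
    also have "\<dots> = (\<integral>\<^sup>+\<gamma>. ennreal (K\<^sup>2 * (pi / \<delta>)) * ennreal ((wmod \<alpha> f \<gamma>)\<^sup>2) \<partial>count_space \<Gamma>')"
    proof (rule nn_integral_cong)
      fix \<gamma>
      have "(\<integral>\<^sup>+z. ennreal (K\<^sup>2) * (ennreal ((wmod \<alpha> f \<gamma>)\<^sup>2) * ennreal (exp (- \<delta> * (cmod (z - \<gamma>))\<^sup>2))) \<partial>lborel)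
        = ennreal (K\<^sup>2) * (ennreal ((wmod \<alpha> f \<gamma>)\<^sup>2) * ennreal (pi / \<delta>))"
        by (subst nn_integral_cmult, measurable, subst nn_integral_cmult, measurable, subst nn_integral_gauss[OF \<delta>]) simp
      also have "\<dots> = ennreal (K\<^sup>2 * (pi / \<delta>)) * ennreal ((wmod \<alpha> f \<gamma>)\<^sup>2)"
        using \<delta> by (simp only: ennreal_mult zero_le_power2 pi_ge_zero divide_nonneg_pos mult_ac)
      finally show "(\<integral>\<^sup>+z. ennreal (K\<^sup>2) * (ennreal ((wmod \<alpha> f \<gamma>)\<^sup>2) * ennreal (exp (- \<delta> * (cmod (z - \<gamma>))\<^sup>2))) \<partial>lborel)
        = ennreal (K\<^sup>2 * (pi / \<delta>)) * ennreal ((wmod \<alpha> f \<gamma>)\<^sup>2)" .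
    qed
    also have "\<dots> = ennreal (K\<^sup>2 * (pi / \<delta>)) * (\<integral>\<^sup>+\<gamma>. ennreal ((wmod \<alpha> f \<gamma>)\<^sup>2) \<partial>count_space \<Gamma>')"
      by (rule nn_integral_cmult) simp
    finally show ?thesis .
  qed
  then show ?thesis
    using K \<delta> by (intro sampling_setI[OF \<alpha>(1) ulf sub, of "K\<^sup>2 * (pi / \<delta>)"]) auto
qed

section \<open>The density theorem\<close>

text \<open>
  The numbers \<open>\<alpha> < d' < d < b < \<beta>\<close> share out the gap between \<open>\<alpha>\<close> and \<open>\<beta>\<close>: from \<open>b\<close> to \<open>d\<close> for the additive loss in the disc
  counts, from \<open>d\<close> to \<open>d'\<close> for the passage from discs to \<open>I\<close>, from \<open>d'\<close> to \<open>\<alpha>\<close> for strictness.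
\<close>

lemma sampling_imp_dense_subset:
  assumes \<alpha>: "\<alpha> > 0" and I: "compact I" "emeasure lborel I = 1" "emeasure lborel (frontier I) = 0"
    and samp: "sampling_set \<alpha> \<Gamma>"
  shows "\<exists>\<Gamma>'\<subseteq>\<Gamma>. uniform_discrete \<Gamma>' \<and> lower_density I \<Gamma>' > ereal (\<alpha> / pi)"
proof -
  obtain \<beta> K where \<beta>: "\<beta> > \<alpha>" "K > 0" "sup_sampling \<beta> \<Gamma> K"
    using sampling_imp_sup_sampling[OF \<alpha> samp] by blast
  obtain \<Gamma>' K' where \<Gamma>': "\<Gamma>' \<subseteq> \<Gamma>" "uniform_discrete \<Gamma>'" "K' > 0" "sup_sampling \<beta> \<Gamma>' K'"
    using sup_sampling_separated_subset[OF _ \<beta>(2,3)] \<alpha> \<beta>(1) by auto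
  have ulf: "uniformly_locally_finite \<Gamma>'" using \<Gamma>'(2) by (rule uniform_discrete_imp_uniformly_locally_finite)
  define b where "b = (\<alpha> + \<beta>) / 2"
  have b: "\<alpha> < b" "b < \<beta>" "0 < b" using \<alpha> \<beta>(1) by (auto simp: b_def)
  obtain c where c: "c \<ge> 0" "\<And>a R. 0 < R \<Longrightarrow> c < R\<^sup>2 \<Longrightarrow> b * (R\<^sup>2 - c) \<le> real (card (\<Gamma>' \<inter> cball a R))"
    using sup_sampling_count[OF \<Gamma>'(4,3) _ b(2) ulf] b(3) by auto
  define d where "d = (\<alpha> + b) / 2"
  have d: "\<alpha> < d" "d < b" using b by (auto simp: d_def)
  define R where "R = sqrt (b * c / (b - d) + 1)"
  have R2: "R\<^sup>2 = b * c / (b - d) + 1" and R: "R > 0"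
    using b c d by (auto simp: R_def add_nonneg_pos)
  have key: "d * R\<^sup>2 \<le> b * (R\<^sup>2 - c)"
  proof -
    have "(b - d) * R\<^sup>2 = b * c + (b - d)" unfolding R2 using d by (simp add: field_simps)
    then show ?thesis using d by (simp add: algebra_simps)
  qed
  have "c < R\<^sup>2"
  proof -
    have "0 < d * R\<^sup>2" using d \<alpha> R by simp
    then have "0 < b * (R\<^sup>2 - c)" using key by linarith
    then show ?thesis using b(3) by (simp add: zero_less_mult_iff)
  qed
  then have count: "(d / pi) * (pi * R\<^sup>2) \<le> real (card (\<Gamma>' \<inter> cball a R))" for a
    using c(2)[OF R, of a] key by simp
  define d' where "d' = (\<alpha> + d) / 2"
  have d': "\<alpha> < d'" "d' < d" using d by (auto simp: d'_def)
  have "ereal (d' / pi) \<le> lower_density I \<Gamma>'"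
    using d' \<alpha> by (intro lower_density_ge_if_disc_counts[OF I ulf R _ _ count]) (auto simp: divide_strict_right_mono)
  moreover have "ereal (\<alpha> / pi) < ereal (d' / pi)" using d' by (simp add: divide_strict_right_mono)
  ultimately have "ereal (\<alpha> / pi) < lower_density I \<Gamma>'" by (rule less_le_trans[rotated])
  then show ?thesis using \<Gamma>' by blast
qed

lemma dense_subset_imp_sampling:
  assumes \<alpha>: "\<alpha> > 0" and I: "compact I" "emeasure lborel I = 1"
    and ulf: "uniformly_locally_finite \<Gamma>" and sub: "\<Gamma>' \<subseteq> \<Gamma>" and ud: "uniform_discrete \<Gamma>'" and dens: "lower_density I \<Gamma>' > ereal (\<alpha> / pi)"
  shows "sampling_set \<alpha> \<Gamma>"
proof -
  obtain d where d: "ereal (\<alpha> / pi) < ereal d" "ereal d < lower_density I \<Gamma>'"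
    using ereal_dense2[OF dens] by blast
  have "\<alpha> / pi < d" using d(1) by simp
  then have d\<alpha>: "\<alpha> < d * pi" by (simp only: pos_divide_less_eq[OF pi_gt_zero])
  then have "0 < d * pi" using \<alpha> by linarith
  then have d0: "d \<ge> 0" by (simp add: zero_less_mult_iff)
  obtain c where c: "c \<ge> 0" "\<And>a t. c \<le> t \<Longrightarrow> d * (pi * (t - c)\<^sup>2) \<le> real (card (\<Gamma>' \<inter> cball a t))"
    using disc_counts_if_lower_density[OF I uniform_discrete_imp_uniformly_locally_finite[OF ud] d0 d(2)] by blast
  have count: "(d * pi) * (t - (c + 1))\<^sup>2 \<le> real (card (\<Gamma>' \<inter> cball a t))" if t: "c + 1 \<le> t" for a t
  proof -
    have "(t - (c + 1))\<^sup>2 \<le> (t - c)\<^sup>2" using t by (intro power_mono) auto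
    then have "(d * pi) * (t - (c + 1))\<^sup>2 \<le> (d * pi) * (t - c)\<^sup>2" using d0 by (intro mult_left_mono) auto
    then show ?thesis using c(2)[of t a] t by (simp add: mult.assoc)
  qed
  obtain \<beta> where \<beta>: "\<alpha> < \<beta>" "\<beta> < d * pi" using dense[OF d\<alpha>] by blast
  obtain K where K: "K > 0" "sup_sampling \<beta> \<Gamma>' K"
    using disc_counts_imp_sup_sampling[OF ud _ \<beta>(2) _ count] \<beta>(1) \<alpha> c(1) by auto
  show ?thesis
    by (rule sup_sampling_imp_sampling[OF \<alpha> \<beta>(1) K sub ulf])
qed

theorem theorem1p1:
  fixes \<alpha> :: real and I \<Gamma> :: "complex set"
  assumes "\<alpha> > 0"
    and "compact I" and "emeasure lborel I = 1" and "emeasure lborel (frontier I) = 0"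
    and "discrete \<Gamma>"
  shows "sampling_set \<alpha> \<Gamma> \<longleftrightarrow>
    (\<exists>\<G>. finite \<G> \<and> (\<forall>S\<in>\<G>. uniform_discrete S) \<and> \<Gamma> = \<Union>\<G>) \<and>
    (\<exists>\<Gamma>'\<subseteq>\<Gamma>. uniform_discrete \<Gamma>' \<and> lower_density I \<Gamma>' > ereal (\<alpha> / pi))"
proof
  assume "sampling_set \<alpha> \<Gamma>"
  then show "(\<exists>\<G>. finite \<G> \<and> (\<forall>S\<in>\<G>. uniform_discrete S) \<and> \<Gamma> = \<Union>\<G>) \<and>
    (\<exists>\<Gamma>'\<subseteq>\<Gamma>. uniform_discrete \<Gamma>' \<and> lower_density I \<Gamma>' > ereal (\<alpha> / pi))"
    using assms uniformly_locally_finite_imp_union_of_uniform_discrete[OF sampling_imp_uniformly_locally_finite] sampling_imp_dense_subset by simp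
next
  assume R: "(\<exists>\<G>. finite \<G> \<and> (\<forall>S\<in>\<G>. uniform_discrete S) \<and> \<Gamma> = \<Union>\<G>) \<and>
    (\<exists>\<Gamma>'\<subseteq>\<Gamma>. uniform_discrete \<Gamma>' \<and> lower_density I \<Gamma>' > ereal (\<alpha> / pi))"
  then have "uniformly_locally_finite \<Gamma>"
    using uniformly_locally_finite_Union uniform_discrete_imp_uniformly_locally_finite by blast
  then show "sampling_set \<alpha> \<Gamma>"
    using R dense_subset_imp_sampling[OF assms(1,2,3)] by blast
qed

end
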